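(* Let $\mathbf{k}$ be an algebraically closed field, let $Q$ be a quiver with finite vertex set, and let $\Delta:\mathbf{k}Q\to\mathbf{k}Q\otimes_{\mathbf{k}}\mathbf{k}Q$ be a coassociative partitioning morphism such that $\Delta(\mu)=\mu\otimes\mu$ for all paths $\mu$ of length at least $1$. Let $M$ be a finite-dimensional representation of $Q$ over $\mathbf{k}$ and $n$ a positive integer. Then $$b_n^\Delta(M)=b_n(M)+(\dim M)^n-\sum_{k\in Q_0}(\dim M_k)^n .$$ In particular, $b_n^\Delta(M)$ is independent of the choice of $\Delta$.
   Context: Let $\mathbf{k}Q$ be the path algebra and $e_i$ the trivial path at $i\in Q_0$, so $1_{\mathbf{k}Q}=\sum_{i\in Q_0}e_i$. Representations of $Q$ are identified with left $\mathbf{k}Q$-modules; $M_i=e_iM$, $\dim M=\sum_i\dim M_i$. A partition of a set $E$ is a family of pairwise disjoint subsets whose union is $E$. A linear map $\Delta:\mathbf{k}Q\to\mathbf{k}Q\otimes_{\mathbf{k}}\mathbf{k}Q$ is a partitioning map if there is a partition $\{E_k\mid k\in Q_0\}$ of $Q_0\times Q_0$ with $\Delta(e_k)=\sum_{(i,j)\in E_k}e_i\otimes e_j$ for all $k\in Q_0$. It is a partitioning morphism if it is both an algebra morphism and a partitioning map. It is coassociative if $(1\otimes\Delta)\Delta=(\Delta\otimes1)\Delta$. $M\otimes^\Delta N$ is the vector space $M\otimes_{\mathbf{k}}N$ with action $\alpha\cdot(m\otimes n)=\sum_{\mu,\nu}\lambda_{\mu,\nu}(\mu\cdot m)\otimes(\nu\cdot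 n)$ where $\Delta(\alpha)=\sum_{\mu,\nu}\lambda_{\mu,\nu}\,\mu\otimes\nu$; $M^{\otimes^\Delta n}$ is the $n$-fold power, and $b_n^\Delta(M)$ is the number of indecomposable direct summands of $M^{\otimes^\Delta n}$ counted with multiplicities. The pointwise tensor product is $(M\otimes N)_i=M_i\otimes_{\mathbf{k}}N_i$, $(M\otimes N)_\alpha=M_\alpha\otimes N_\alpha$; $b_n(M)$ is the number of indecomposable direct summands, counted with multiplicities, of the $n$-fold pointwise tensor power $M^{\otimes n}$. *)

theory Defs
  imports
    "HOL-Algebra.AbelCoset"
    "Jordan_Normal_Form.VS_Connect"
    "Graph_Theory.Arc_Walk"
    "HOL-Library.Poly_Mapping"
begin

text \<open>
  A quiver is a \<^typ>\<open>('v, 'a) pre_digraph\<close> with \<^const>\<open>wf_digraph\<close>; loops, parallel arrows and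
  infinitely many arrows are allowed.  The ground field is a type of class \<^class>\<open>field\<close>, and
  vector spaces over it are records \<^typ>\<open>('k, 'x) module\<close> satisfying \<^term>\<open>vectorspace class_ring\<close>.
\<close>

section \<open>Free vector spaces and tensor products of vector spaces\<close>

definition free_space :: "'b set \<Rightarrow> ('k::field, 'b \<Rightarrow>\<^sub>0 'k) module" where
  "free_space B = \<lparr>carrier = {f. Poly_Mapping.keys f \<subseteq> B}, mult = undefined, one = undefined,
     zero = 0, add = (+), smult = (\<lambda>c. Poly_Mapping.map ((*) c))\<rparr>"

definition basis_vec :: "'b \<Rightarrow> ('b \<Rightarrow>\<^sub>0 'k::field)" where
  "basis_vec b = Poly_Mapping.single b 1"

definition free_extend :: "('b \<Rightarrow> ('c \<Rightarrow>\<^sub>0 'k::field)) \<Rightarrow> ('b \<Rightarrow>\<^sub>0 'k) \<Rightarrow> ('c \<Rightarrow>\<^sub>0 'k)" where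
  "free_extend h f =
     (\<Sum>b\<in>Poly_Mapping.keys f. Poly_Mapping.map ((*) (Poly_Mapping.lookup f b)) (h b))"

definition quotient_space :: "('k::field, 'x) module \<Rightarrow> 'x set \<Rightarrow> ('k, 'x set) module" where
  "quotient_space F N = \<lparr>carrier = a_rcosets\<^bsub>F\<^esub> N, mult = undefined, one = undefined,
     zero = N, add = set_add F, smult = (\<lambda>c A. \<Union>a\<in>A. N +>\<^bsub>F\<^esub> (c \<odot>\<^bsub>F\<^esub> a))\<rparr>"

definition tensor_free ::
  "('k::field, 'x) module \<Rightarrow> ('k, 'y) module \<Rightarrow> ('k, 'x \<times> 'y \<Rightarrow>\<^sub>0 'k) module" where
  "tensor_free V W = free_space (carrier V \<times> carrier W)"

definition tensor_relations ::
  "('k::field, 'x) module \<Rightarrow> ('k, 'y) module \<Rightarrow> ('x \<times> 'y \<Rightarrow>\<^sub>0 'k) set" where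
  "tensor_relations V W =
     {basis_vec (x \<oplus>\<^bsub>V\<^esub> x', y) - basis_vec (x, y) - basis_vec (x', y) | x x' y.
        x \<in> carrier V \<and> x' \<in> carrier V \<and> y \<in> carrier W} \<union>
     {basis_vec (x, y \<oplus>\<^bsub>W\<^esub> y') - basis_vec (x, y) - basis_vec (x, y') | x y y'.
        x \<in> carrier V \<and> y \<in> carrier W \<and> y' \<in> carrier W} \<union>
     {basis_vec (c \<odot>\<^bsub>V\<^esub> x, y) - Poly_Mapping.single (x, y) c | c x y.
        x \<in> carrier V \<and> y \<in> carrier W} \<union>
     {basis_vec (x, c \<odot>\<^bsub>W\<^esub> y) - Poly_Mapping.single (x, y) c | c x y.
        x \<in> carrier V \<and> y \<in> carrier W}"

definition tensor_null ::
  "('k::field, 'x) module \<Rightarrow> ('k, 'y) module \<Rightarrow> ('x \<times> 'y \<Rightarrow>\<^sub>0 'k) set" where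
  "tensor_null V W =
     LinearCombinations.module.span class_ring (tensor_free V W) (tensor_relations V W)"

definition tensor_space ::
  "('k::field, 'x) module \<Rightarrow> ('k, 'y) module \<Rightarrow> ('k, ('x \<times> 'y \<Rightarrow>\<^sub>0 'k) set) module" where
  "tensor_space V W = quotient_space (tensor_free V W) (tensor_null V W)"

text \<open>
  The map into \<^term>\<open>tensor_space V W\<close> induced by an assignment of representatives
  \<^term>\<open>h (x, y)\<close> to the generators \<open>x \<otimes> y\<close> of the source.
\<close>

definition tensor_induced ::
  "('k::field, 'x) module \<Rightarrow> ('k, 'y) module \<Rightarrow> ('b \<Rightarrow> ('x \<times> 'y \<Rightarrow>\<^sub>0 'k)) \<Rightarrow>
   ('b \<Rightarrow>\<^sub>0 'k) set \<Rightarrow> ('x \<times> 'y \<Rightarrow>\<^sub>0 'k) set" where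
  "tensor_induced V W h A = (\<Union>a\<in>A. tensor_null V W +>\<^bsub>tensor_free V W\<^esub> free_extend h a)"


section \<open>The path algebra and its tensor square\<close>

text \<open>
  A path is its source together with its list of arrows in the order in which they are traversed;
  \<^term>\<open>(i, [])\<close> is the trivial path at \<open>i\<close>.  Products are written as for left modules:
  in \<open>\<mu> \<nu>\<close> the path \<open>\<nu>\<close> is traversed first.
\<close>

type_synonym ('v, 'a) path = "'v \<times> 'a list"

definition quiver_paths :: "('v, 'a) pre_digraph \<Rightarrow> ('v, 'a) path set" where
  "quiver_paths Q = {(u, p). \<exists>v. pre_digraph.awalk Q u p v}"

definition path_target :: "('v, 'a) pre_digraph \<Rightarrow> ('v, 'a) path \<Rightarrow> 'v" where
  "path_target Q \<mu> = last (pre_digraph.awalk_verts Q (fst \<mu>) (snd \<mu>))"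

definition path_comp ::
  "('v, 'a) pre_digraph \<Rightarrow> ('v, 'a) path \<Rightarrow> ('v, 'a) path \<Rightarrow> ('v, 'a) path option" where
  "path_comp Q \<mu> \<nu> =
     (if path_target Q \<nu> = fst \<mu> then Some (fst \<nu>, snd \<nu> @ snd \<mu>) else None)"

definition path_comp2 ::
  "('v, 'a) pre_digraph \<Rightarrow> ('v, 'a) path \<times> ('v, 'a) path \<Rightarrow> ('v, 'a) path \<times> ('v, 'a) path \<Rightarrow>
   (('v, 'a) path \<times> ('v, 'a) path) option" where
  "path_comp2 Q s t =
     (case (path_comp Q (fst s) (fst t), path_comp Q (snd s) (snd t)) of
        (Some \<mu>, Some \<nu>) \<Rightarrow> Some (\<mu>, \<nu>) | _ \<Rightarrow> None)"

text \<open>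
  The algebra with basis \<open>B\<close> in which the product of two basis elements is a basis element
  or zero, as prescribed by \<open>c\<close>.
\<close>

definition basis_algebra ::
  "'b set \<Rightarrow> ('b \<Rightarrow> 'b \<Rightarrow> 'b option) \<Rightarrow> ('b \<Rightarrow>\<^sub>0 'k) \<Rightarrow> ('k::field, 'b \<Rightarrow>\<^sub>0 'k) module" where
  "basis_algebra B c e = (free_space B)\<lparr>
     mult := (\<lambda>f g. \<Sum>b\<in>Poly_Mapping.keys f. \<Sum>d\<in>Poly_Mapping.keys g.
        (case c b d of None \<Rightarrow> 0
         | Some r \<Rightarrow> Poly_Mapping.single r (Poly_Mapping.lookup f b * Poly_Mapping.lookup g d))),
     one := e\<rparr>"

definition path_algebra ::
  "('v, 'a) pre_digraph \<Rightarrow> ('k::field, ('v, 'a) path \<Rightarrow>\<^sub>0 'k) module" where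
  "path_algebra Q = basis_algebra (quiver_paths Q) (path_comp Q) (\<Sum>i\<in>verts Q. basis_vec (i, []))"

text \<open>
  \<open>kQ \<otimes> kQ\<close> is given by its coordinates in the basis \<open>\<mu> \<otimes> \<nu>\<close>, with the usual
  componentwise product.
\<close>

definition path_algebra_square ::
  "('v, 'a) pre_digraph \<Rightarrow> ('k::field, ('v, 'a) path \<times> ('v, 'a) path \<Rightarrow>\<^sub>0 'k) module" where
  "path_algebra_square Q = basis_algebra (quiver_paths Q \<times> quiver_paths Q) (path_comp2 Q)
     (\<Sum>(i, j)\<in>verts Q \<times> verts Q. basis_vec ((i, []), (j, [])))"

type_synonym ('k, 'v, 'a) comult =
  "(('v, 'a) path \<Rightarrow>\<^sub>0 'k) \<Rightarrow> (('v, 'a) path \<times> ('v, 'a) path \<Rightarrow>\<^sub>0 'k)"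

definition partitioning_map ::
  "('v, 'a) pre_digraph \<Rightarrow> ('k::field, 'v, 'a) comult \<Rightarrow> bool" where
  "partitioning_map Q \<Delta> \<longleftrightarrow>
     linear_map class_ring (path_algebra Q) (path_algebra_square Q) \<Delta> \<and>
     (\<exists>E. disjoint_family_on E (verts Q) \<and> (\<Union>k\<in>verts Q. E k) = verts Q \<times> verts Q \<and>
        (\<forall>k\<in>verts Q. \<Delta> (basis_vec (k, [])) = (\<Sum>(i, j)\<in>E k. basis_vec ((i, []), (j, [])))))"

definition partitioning_morphism ::
  "('v, 'a) pre_digraph \<Rightarrow> ('k::field, 'v, 'a) comult \<Rightarrow> bool" where
  "partitioning_morphism Q \<Delta> \<longleftrightarrow>
     partitioning_map Q \<Delta> \<and> \<Delta> \<in> Ring.ring_hom (path_algebra Q) (path_algebra_square Q)"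

text \<open>\<open>1 \<otimes> \<Delta>\<close> and \<open>\<Delta> \<otimes> 1\<close>, with values in the coordinates of \<open>kQ \<otimes> kQ \<otimes> kQ\<close>.\<close>

definition id_tensor_comult ::
  "('k::field, 'v, 'a) comult \<Rightarrow> (('v, 'a) path \<times> ('v, 'a) path \<Rightarrow>\<^sub>0 'k) \<Rightarrow>
   (('v, 'a) path \<times> ('v, 'a) path \<times> ('v, 'a) path \<Rightarrow>\<^sub>0 'k)" where
  "id_tensor_comult \<Delta> =
     free_extend (\<lambda>(\<mu>, \<nu>). free_extend (\<lambda>(\<rho>, \<sigma>). basis_vec (\<mu>, \<rho>, \<sigma>)) (\<Delta> (basis_vec \<nu>)))"

definition comult_tensor_id ::
  "('k::field, 'v, 'a) comult \<Rightarrow> (('v, 'a) path \<times> ('v, 'a) path \<Rightarrow>\<^sub>0 'k) \<Rightarrow>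
   (('v, 'a) path \<times> ('v, 'a) path \<times> ('v, 'a) path \<Rightarrow>\<^sub>0 'k)" where
  "comult_tensor_id \<Delta> =
     free_extend (\<lambda>(\<mu>, \<nu>). free_extend (\<lambda>(\<rho>, \<sigma>). basis_vec (\<rho>, \<sigma>, \<nu>)) (\<Delta> (basis_vec \<mu>)))"

definition coassociative ::
  "('v, 'a) pre_digraph \<Rightarrow> ('k::field, 'v, 'a) comult \<Rightarrow> bool" where
  "coassociative Q \<Delta> \<longleftrightarrow>
     (\<forall>a\<in>carrier (path_algebra Q). id_tensor_comult \<Delta> (\<Delta> a) = comult_tensor_id \<Delta> (\<Delta> a))"


section \<open>Representations\<close>

record ('k, 'x, 'v, 'a) rep =
  space :: "'v \<Rightarrow> ('k, 'x) module"
  mor :: "'a \<Rightarrow> 'x \<Rightarrow> 'x"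

definition is_rep ::
  "('v, 'a) pre_digraph \<Rightarrow> ('k::field, 'x, 'v, 'a) rep \<Rightarrow> bool" where
  "is_rep Q V \<longleftrightarrow>
     (\<forall>i\<in>verts Q. vectorspace class_ring (space V i)) \<and>
     (\<forall>\<alpha>\<in>arcs Q. linear_map class_ring (space V (tail Q \<alpha>)) (space V (head Q \<alpha>)) (mor V \<alpha>))"

definition finite_dimensional ::
  "('v, 'a) pre_digraph \<Rightarrow> ('k::field, 'x, 'v, 'a) rep \<Rightarrow> bool" where
  "finite_dimensional Q V \<longleftrightarrow> (\<forall>i\<in>verts Q. vectorspace.fin_dim class_ring (space V i))"

definition dim_at :: "('k::field, 'x, 'v, 'a) rep \<Rightarrow> 'v \<Rightarrow> nat" where
  "dim_at V i = vectorspace.dim class_ring (space V i)"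

definition rep_dim :: "('v, 'a) pre_digraph \<Rightarrow> ('k::field, 'x, 'v, 'a) rep \<Rightarrow> nat" where
  "rep_dim Q V = (\<Sum>i\<in>verts Q. dim_at V i)"

definition rep_iso ::
  "('v, 'a) pre_digraph \<Rightarrow> ('k::field, 'x, 'v, 'a) rep \<Rightarrow> ('k, 'y, 'v, 'a) rep \<Rightarrow> bool" where
  "rep_iso Q V W \<longleftrightarrow>
     (\<exists>\<phi>. (\<forall>i\<in>verts Q. linear_map class_ring (space V i) (space W i) (\<phi> i) \<and>
              bij_betw (\<phi> i) (carrier (space V i)) (carrier (space W i))) \<and>
          (\<forall>\<alpha>\<in>arcs Q. \<forall>x\<in>carrier (space V (tail Q \<alpha>)).
              \<phi> (head Q \<alpha>) (mor V \<alpha> x) = mor W \<alpha> (\<phi> (tail Q \<alpha>) x)))"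

definition subrep ::
  "('v, 'a) pre_digraph \<Rightarrow> ('v \<Rightarrow> 'x set) \<Rightarrow> ('k::field, 'x, 'v, 'a) rep \<Rightarrow> bool" where
  "subrep Q U V \<longleftrightarrow>
     (\<forall>i\<in>verts Q. VectorSpace.subspace class_ring (U i) (space V i)) \<and>
     (\<forall>\<alpha>\<in>arcs Q. mor V \<alpha> ` U (tail Q \<alpha>) \<subseteq> U (head Q \<alpha>))"

definition restrict_rep ::
  "('k::field, 'x, 'v, 'a) rep \<Rightarrow> ('v \<Rightarrow> 'x set) \<Rightarrow> ('k, 'x, 'v, 'a) rep" where
  "restrict_rep V U = V\<lparr>space := (\<lambda>i. (space V i)\<lparr>carrier := U i\<rparr>)\<rparr>"

definition zero_rep :: "('v, 'a) pre_digraph \<Rightarrow> ('k::field, 'x, 'v, 'a) rep \<Rightarrow> bool" where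
  "zero_rep Q V \<longleftrightarrow> (\<forall>i\<in>verts Q. carrier (space V i) = {\<zero>\<^bsub>space V i\<^esub>})"

definition is_direct_sum ::
  "('v, 'a) pre_digraph \<Rightarrow> ('k::field, 'x, 'v, 'a) rep \<Rightarrow> nat \<Rightarrow> (nat \<Rightarrow> 'v \<Rightarrow> 'x set) \<Rightarrow> bool" where
  "is_direct_sum Q V m U \<longleftrightarrow>
     (\<forall>j<m. subrep Q (U j) V) \<and>
     (\<forall>i\<in>verts Q. \<forall>x\<in>carrier (space V i).
        \<exists>!u. u \<in> (\<Pi>\<^sub>E j\<in>{..<m}. U j i) \<and> finsum (space V i) u {..<m} = x)"

definition indecomposable ::
  "('v, 'a) pre_digraph \<Rightarrow> ('k::field, 'x, 'v, 'a) rep \<Rightarrow> bool" where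
  "indecomposable Q V \<longleftrightarrow> \<not> zero_rep Q V \<and>
     (\<forall>U. is_direct_sum Q V 2 U \<longrightarrow>
        zero_rep Q (restrict_rep V (U 0)) \<or> zero_rep Q (restrict_rep V (U 1)))"

text \<open>Well defined (by Krull--Schmidt) for finite-dimensional representations.\<close>

definition num_summands :: "('v, 'a) pre_digraph \<Rightarrow> ('k::field, 'x, 'v, 'a) rep \<Rightarrow> nat" where
  "num_summands Q V =
     (THE m. \<exists>U. is_direct_sum Q V m U \<and> (\<forall>j<m. indecomposable Q (restrict_rep V (U j))))"


section \<open>The two tensor products of representations\<close>

definition pointwise_tensor ::
  "('v, 'a) pre_digraph \<Rightarrow> ('k::field, 'x, 'v, 'a) rep \<Rightarrow> ('k, 'y, 'v, 'a) rep \<Rightarrow>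
   ('k, ('x \<times> 'y \<Rightarrow>\<^sub>0 'k) set, 'v, 'a) rep" where
  "pointwise_tensor Q V W = \<lparr>
     space = (\<lambda>i. tensor_space (space V i) (space W i)),
     mor = (\<lambda>\<alpha>. tensor_induced (space V (head Q \<alpha>)) (space W (head Q \<alpha>))
                  (\<lambda>(x, y). basis_vec (mor V \<alpha> x, mor W \<alpha> y)))\<rparr>"

text \<open>
  The left \<open>kQ\<close>-module identified with a representation: the underlying space is the direct sum
  of the \<open>V\<^sub>i\<close>, and a path acts by the composite of the maps of its arrows.
\<close>

definition total_space ::
  "('v, 'a) pre_digraph \<Rightarrow> ('k::field, 'x, 'v, 'a) rep \<Rightarrow> ('k, 'v \<Rightarrow> 'x) module" where
  "total_space Q V = \<lparr>carrier = (\<Pi>\<^sub>E i\<in>verts Q. carrier (space V i)),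
     mult = undefined, one = undefined,
     zero = (\<lambda>i\<in>verts Q. \<zero>\<^bsub>space V i\<^esub>),
     add = (\<lambda>f g. \<lambda>i\<in>verts Q. f i \<oplus>\<^bsub>space V i\<^esub> g i),
     smult = (\<lambda>c f. \<lambda>i\<in>verts Q. c \<odot>\<^bsub>space V i\<^esub> f i)\<rparr>"

definition path_action ::
  "('v, 'a) pre_digraph \<Rightarrow> ('k::field, 'x, 'v, 'a) rep \<Rightarrow> ('v, 'a) path \<Rightarrow> ('v \<Rightarrow> 'x) \<Rightarrow> ('v \<Rightarrow> 'x)" where
  "path_action Q V \<mu> f =
     (\<lambda>j\<in>verts Q. if j = path_target Q \<mu> then fold (mor V) (snd \<mu>) (f (fst \<mu>)) else \<zero>\<^bsub>space V j\<^esub>)"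

definition comult_action ::
  "('v, 'a) pre_digraph \<Rightarrow> ('k::field, 'v, 'a) comult \<Rightarrow>
   ('k, 'x, 'v, 'a) rep \<Rightarrow> ('k, 'y, 'v, 'a) rep \<Rightarrow> (('v, 'a) path \<Rightarrow>\<^sub>0 'k) \<Rightarrow>
   (('v \<Rightarrow> 'x) \<times> ('v \<Rightarrow> 'y) \<Rightarrow>\<^sub>0 'k) set \<Rightarrow> (('v \<Rightarrow> 'x) \<times> ('v \<Rightarrow> 'y) \<Rightarrow>\<^sub>0 'k) set" where
  "comult_action Q \<Delta> V W a =
     tensor_induced (total_space Q V) (total_space Q W)
       (\<lambda>(m, n). \<Sum>(\<mu>, \<nu>)\<in>Poly_Mapping.keys (\<Delta> a).
          Poly_Mapping.single (path_action Q V \<mu> m, path_action Q W \<nu> n)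
            (Poly_Mapping.lookup (\<Delta> a) (\<mu>, \<nu>)))"

text \<open>
  The representation \<open>i \<mapsto> e\<^sub>i X\<close> identified with the left \<open>kQ\<close>-module
  \<open>X = V \<otimes>\<^sup>\<Delta> W\<close>, whose underlying space is the tensor product of the total spaces.
\<close>

definition comult_tensor ::
  "('v, 'a) pre_digraph \<Rightarrow> ('k::field, 'v, 'a) comult \<Rightarrow>
   ('k, 'x, 'v, 'a) rep \<Rightarrow> ('k, 'y, 'v, 'a) rep \<Rightarrow>
   ('k, (('v \<Rightarrow> 'x) \<times> ('v \<Rightarrow> 'y) \<Rightarrow>\<^sub>0 'k) set, 'v, 'a) rep" where
  "comult_tensor Q \<Delta> V W =
     (let X = tensor_space (total_space Q V) (total_space Q W) in \<lparr>
        space = (\<lambda>i. X\<lparr>carrier := comult_action Q \<Delta> V W (basis_vec (i, [])) ` carrier X\<rparr>),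
        mor = (\<lambda>\<alpha>. comult_action Q \<Delta> V W (basis_vec (tail Q \<alpha>, [\<alpha>])))\<rparr>)"

text \<open>
  Each tensor product changes the type of the vectors, so an iterated power has no fixed type.
  Every finite-dimensional representation is therefore replaced by an isomorphic copy whose
  spaces have their elements in \<^typ>\<open>'k vec\<close>, before the next factor is tensored on.
\<close>

definition vec_copy ::
  "('v, 'a) pre_digraph \<Rightarrow> ('k::field, 'x, 'v, 'a) rep \<Rightarrow> ('k, 'k vec, 'v, 'a) rep" where
  "vec_copy Q V = (SOME W. is_rep Q W \<and> rep_iso Q V W)"

text \<open>The \<open>n\<close>-fold power for \<open>n \<ge> 1\<close>, bracketed to the left; exponent 0 has no meaning here.\<close>

fun pointwise_power ::
  "('v, 'a) pre_digraph \<Rightarrow> ('k::field, 'x, 'v, 'a) rep \<Rightarrow> nat \<Rightarrow> ('k, 'k vec, 'v, 'a) rep" where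
  "pointwise_power Q M 0 = undefined"
| "pointwise_power Q M (Suc 0) = vec_copy Q M"
| "pointwise_power Q M (Suc (Suc n)) =
     vec_copy Q (pointwise_tensor Q (pointwise_power Q M (Suc n)) M)"

fun comult_power ::
  "('v, 'a) pre_digraph \<Rightarrow> ('k::field, 'v, 'a) comult \<Rightarrow> ('k, 'x, 'v, 'a) rep \<Rightarrow> nat \<Rightarrow>
   ('k, 'k vec, 'v, 'a) rep" where
  "comult_power Q \<Delta> M 0 = undefined"
| "comult_power Q \<Delta> M (Suc 0) = vec_copy Q M"
| "comult_power Q \<Delta> M (Suc (Suc n)) =
     vec_copy Q (comult_tensor Q \<Delta> (comult_power Q \<Delta> M (Suc n)) M)"

definition b_pointwise ::
  "('v, 'a) pre_digraph \<Rightarrow> nat \<Rightarrow> ('k::field, 'x, 'v, 'a) rep \<Rightarrow> nat" where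
  "b_pointwise Q n M = num_summands Q (pointwise_power Q M n)"

definition b_comult ::
  "('v, 'a) pre_digraph \<Rightarrow> ('k::field, 'v, 'a) comult \<Rightarrow> nat \<Rightarrow> ('k, 'x, 'v, 'a) rep \<Rightarrow> nat" where
  "b_comult Q \<Delta> n M = num_summands Q (comult_power Q \<Delta> M n)"

end

theory Submission
  imports Defs "HOL-Library.Function_Algebras"
begin

text \<open>
  The number of summands becomes a count of tuples once a basis \<open>C\<close> of \<open>M\<close>, made of bases of the
  spaces \<open>M\<^sub>k\<close>, is fixed.  Let \<open>c \<alpha>\<close> be the matrix of the arrow \<open>\<alpha>\<close>, extended by zero to
  \<open>C \<times> C\<close>.  The partition belonging to \<open>\<Delta>\<close> is a binary operation \<open>p\<close> on vertices.  The \<open>n\<close>-fold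
  power for \<open>\<Delta>\<close> has the \<open>n\<close>-tuples over \<open>C\<close> as a basis: a tuple lies at the vertex that \<open>p\<close> makes of
  the vertices of its entries, and \<open>\<alpha>\<close> acts by the matrix with entries
  \<open>\<Prod>\<^sub>t c \<alpha> (l' ! t) (l ! t)\<close>.  The pointwise power has the same matrix on the diagonal tuples, those
  whose entries all lie at one vertex.

  Such an entry is nonzero only if all entries of \<open>l\<close> lie at the tail and all entries of \<open>l'\<close> at the
  head of \<open>\<alpha>\<close>.  Let \<open>N\<close> be the set of diagonal tuples at endpoints of arrows.  A tuple outside \<open>N\<close>
  has zero row and zero column in every matrix, so it spans a one-dimensional direct summand, whatever
  its vertex is.  On \<open>N\<close> the two powers agree, because \<open>\<Delta> \<alpha> = \<Delta> \<alpha> * \<Delta> e\<^sub>i\<close> for \<open>i\<close> the tail of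
  \<open>\<alpha>\<close>, and the mirrored equation for the head, force \<open>p i i = i\<close> at every endpoint \<open>i\<close> of an arrow.
  Hence both numbers are the number of summands carried by \<open>N\<close> plus the number of remaining tuples
  (\<open>num_summands_split\<close>), and their difference is the number of non-diagonal tuples,
  \<open>(dim M)\<^sup>n - (\<Sum>\<^sub>k (dim M\<^sub>k)\<^sup>n)\<close>.

  Three ingredients are needed.  First, the number of indecomposable summands must be well defined:
  \<open>krull_schmidt_card\<close> shows this for abelian groups with operators that satisfy a chain condition,
  by Fitting's lemma and an exchange argument, and \<open>num_summands_eq\<close> carries it over to
  representations.  Second, a basis of each factor must give a basis of the tensor product:
  \<open>null_iff\<close> identifies the space spanned by the tensor relations with the kernel of the evaluation
  in coordinates.  Third, \<open>coord_rep_pointwise_tensor\<close> and \<open>coord_rep_comult_tensor\<close> compute the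
  two tensor products of representations in such bases.
\<close>

section \<open>Direct sums in abelian groups with operators\<close>

text \<open>
  Subrepresentations, seen in one big coordinate space, are the subgroups closed under a set \<open>T\<close> of
  additive maps: the scalars, the projections to the vertices and the arrows.  Only this structure
  enters the uniqueness of the number of summands, so it is treated in this generality.
\<close>

definition op_subgroup :: "('e::ab_group_add \<Rightarrow> 'e) set \<Rightarrow> 'e set \<Rightarrow> bool" where
  "op_subgroup T U \<longleftrightarrow> 0 \<in> U \<and> (\<forall>x\<in>U. \<forall>y\<in>U. x - y \<in> U) \<and> (\<forall>t\<in>T. \<forall>x\<in>U. t x \<in> U)"

definition splits :: "('e::ab_group_add \<Rightarrow> 'e) set \<Rightarrow> 'e set \<Rightarrow> 'e set \<Rightarrow> 'e set \<Rightarrow> bool" where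
  "splits T X A C \<longleftrightarrow> op_subgroup T A \<and> op_subgroup T C \<and> A \<inter> C = {0} \<and>
     X = {a + c | a c. a \<in> A \<and> c \<in> C}"

definition indec :: "('e::ab_group_add \<Rightarrow> 'e) set \<Rightarrow> 'e set \<Rightarrow> bool" where
  "indec T X \<longleftrightarrow> X \<noteq> {0} \<and> (\<forall>A C. splits T X A C \<longrightarrow> A = {0} \<or> C = {0})"

definition internal_sum ::
  "('e::ab_group_add \<Rightarrow> 'e) set \<Rightarrow> 'i set \<Rightarrow> ('i \<Rightarrow> 'e set) \<Rightarrow> 'e set \<Rightarrow> bool" where
  "internal_sum T J W X \<longleftrightarrow> finite J \<and> (\<forall>j\<in>J. op_subgroup T (W j)) \<and>
     X = {sum u J | u. \<forall>j\<in>J. u j \<in> W j} \<and>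
     (\<forall>u. (\<forall>j\<in>J. u j \<in> W j) \<and> sum u J = 0 \<longrightarrow> (\<forall>j\<in>J. u j = 0))"

text \<open>
  A strictly monotone rank with natural values below \<open>X\<close> gives both chain conditions at once; for vector
  spaces the dimension is such a rank.
\<close>

definition finite_length :: "('e::ab_group_add \<Rightarrow> 'e) set \<Rightarrow> 'e set \<Rightarrow> bool" where
  "finite_length T X \<longleftrightarrow> (\<exists>\<rho> :: 'e set \<Rightarrow> nat. \<forall>U W. op_subgroup T U \<and> op_subgroup T W \<and>
     U \<subset> W \<and> W \<subseteq> X \<longrightarrow> \<rho> U < \<rho> W)"

definition op_endo :: "('e::ab_group_add \<Rightarrow> 'e) set \<Rightarrow> 'e set \<Rightarrow> ('e \<Rightarrow> 'e) \<Rightarrow> bool" where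
  "op_endo T U f \<longleftrightarrow> (\<forall>x\<in>U. f x \<in> U) \<and> (\<forall>x\<in>U. \<forall>y\<in>U. f (x + y) = f x + f y) \<and>
     (\<forall>t\<in>T. \<forall>x\<in>U. f (t x) = t (f x))"

lemma op_subgroup_zero: "op_subgroup T U \<Longrightarrow> 0 \<in> U"
  and op_subgroup_diff: "op_subgroup T U \<Longrightarrow> x \<in> U \<Longrightarrow> y \<in> U \<Longrightarrow> x - y \<in> U"
  and op_subgroup_op: "op_subgroup T U \<Longrightarrow> t \<in> T \<Longrightarrow> x \<in> U \<Longrightarrow> t x \<in> U"
  by (auto simp: op_subgroup_def)

lemma op_subgroup_minus: "op_subgroup T U \<Longrightarrow> x \<in> U \<Longrightarrow> - x \<in> U"
  using op_subgroup_diff[of T U 0 x] op_subgroup_zero[of T U] by simp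

lemma op_subgroup_add: "op_subgroup T U \<Longrightarrow> x \<in> U \<Longrightarrow> y \<in> U \<Longrightarrow> x + y \<in> U"
  using op_subgroup_diff[of T U x "- y"] op_subgroup_minus[of T U y] by simp

lemma op_subgroup_sum:
  assumes "op_subgroup T U" "\<And>j. j \<in> J \<Longrightarrow> u j \<in> U"
  shows "sum u J \<in> U"
  using assms(2)
  by (induction J rule: infinite_finite_induct)
     (auto intro: op_subgroup_add[OF assms(1)] op_subgroup_zero[OF assms(1)])

lemma op_endo_closed: "op_endo T U f \<Longrightarrow> x \<in> U \<Longrightarrow> f x \<in> U"
  and op_endo_add: "op_endo T U f \<Longrightarrow> x \<in> U \<Longrightarrow> y \<in> U \<Longrightarrow> f (x + y) = f x + f y"
  and op_endo_op: "op_endo T U f \<Longrightarrow> t \<in> T \<Longrightarrow> x \<in> U \<Longrightarrow> f (t x) = t (f x)"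
  by (auto simp: op_endo_def)

lemma op_endo_zero:
  assumes "op_endo T U f" "op_subgroup T U"
  shows "f 0 = 0"
  using op_endo_add[OF assms(1), of 0 0] op_subgroup_zero[OF assms(2)] by simp

lemma op_endo_diff:
  assumes "op_endo T U f" "op_subgroup T U" "x \<in> U" "y \<in> U"
  shows "f (x - y) = f x - f y"
  using op_endo_add[OF assms(1), of "x - y" y] op_subgroup_diff[OF assms(2-4)] assms
  by (simp add: algebra_simps)

lemma op_endo_comp: "op_endo T U f \<Longrightarrow> op_endo T U g \<Longrightarrow> op_endo T U (\<lambda>x. f (g x))"
  by (auto simp: op_endo_def)

lemma op_endo_funpow: "op_endo T U f \<Longrightarrow> op_endo T U (f ^^ n)"
proof (induction n)
  case (Suc n)
  have "op_endo T U (\<lambda>x. f ((f ^^ n) x))" using op_endo_comp[OF Suc.prems Suc.IH[OF Suc.prems]] .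
  then show ?case by (simp add: comp_def)
qed (auto simp: op_endo_def)

lemma op_endo_inv_into:
  assumes f: "op_endo T U f" and U: "op_subgroup T U" and b: "bij_betw f U U"
  shows "op_endo T U (inv_into U f)"
proof -
  have inj: "inj_on f U" and im: "f ` U = U" using b by (auto simp: bij_betw_def)
  have g: "inv_into U f x \<in> U" "f (inv_into U f x) = x" if "x \<in> U" for x
    using that im by (auto intro: inv_into_into f_inv_into_f)
  have eq: "inv_into U f z = w" if "w \<in> U" "f w = z" for w z
    using that inv_into_f_f[OF inj] by auto
  show ?thesis unfolding op_endo_def
  proof (intro conjI ballI)
    fix x y assume xy: "x \<in> U" "y \<in> U"
    show "inv_into U f (x + y) = inv_into U f x + inv_into U f y"
      by (rule eq) (simp_all add: g xy op_subgroup_add[OF U] op_endo_add[OF f])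
  next
    fix t x assume tx: "t \<in> T" "x \<in> U"
    show "inv_into U f (t x) = t (inv_into U f x)"
      by (rule eq) (simp_all add: g tx op_subgroup_op[OF U] op_endo_op[OF f])
  qed (rule g)
qed

lemma internal_sum_finite: "internal_sum T J W X \<Longrightarrow> finite J"
  and internal_sum_op_subgroup: "internal_sum T J W X \<Longrightarrow> j \<in> J \<Longrightarrow> op_subgroup T (W j)"
  by (simp_all add: internal_sum_def)

lemma internal_sum_eq: "internal_sum T J W X \<Longrightarrow> X = {sum u J | u. \<forall>j\<in>J. u j \<in> W j}"
  unfolding internal_sum_def by (elim conjE)

lemma internal_sum_independent:
  assumes "internal_sum T J W X" "\<forall>j\<in>J. u j \<in> W j" "sum u J = 0"
  shows "\<forall>j\<in>J. u j = 0"
proof -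
  have "\<forall>u. (\<forall>j\<in>J. u j \<in> W j) \<and> sum u J = 0 \<longrightarrow> (\<forall>j\<in>J. u j = 0)"
    using assms(1) unfolding internal_sum_def by (elim conjE)
  from this[rule_format, OF conjI[OF assms(2,3)]] show ?thesis by simp
qed

lemma internal_sum_memI:
  assumes "internal_sum T J W X" "\<forall>j\<in>J. u j \<in> W j"
  shows "sum u J \<in> X"
  unfolding internal_sum_eq[OF assms(1)] using assms(2) by blast

lemma internal_sum_memE:
  assumes "internal_sum T J W X" "x \<in> X"
  obtains u where "x = sum u J" "\<forall>j\<in>J. u j \<in> W j"
  using assms(2) unfolding internal_sum_eq[OF assms(1)] by blast

lemma internal_sum_summand_subset:
  assumes d: "internal_sum T J W X" and j: "j \<in> J"
  shows "W j \<subseteq> X"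
proof
  fix x assume x: "x \<in> W j"
  have "\<forall>i\<in>J. (if i = j then x else 0) \<in> W i"
    using x op_subgroup_zero[OF internal_sum_op_subgroup[OF d]] by auto
  then have "(\<Sum>i\<in>J. if i = j then x else 0) \<in> X" by (rule internal_sum_memI[OF d])
  then show "x \<in> X" using internal_sum_finite[OF d] j by simp
qed

lemma internal_sum_cong:
  assumes "\<And>j. j \<in> J \<Longrightarrow> W j = W' j"
  shows "internal_sum T J W X \<longleftrightarrow> internal_sum T J W' X"
proof -
  have "(\<forall>j\<in>J. u j \<in> W j) \<longleftrightarrow> (\<forall>j\<in>J. u j \<in> W' j)" for u using assms by auto
  moreover have "(\<forall>j\<in>J. op_subgroup T (W j)) \<longleftrightarrow> (\<forall>j\<in>J. op_subgroup T (W' j))" using assms by auto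
  ultimately show ?thesis unfolding internal_sum_def by (simp only:)
qed

locale operators =
  fixes T :: "('e::ab_group_add \<Rightarrow> 'e) set"
  assumes op_add: "t \<in> T \<Longrightarrow> t (x + y) = t x + t y"
begin

lemma op_zero: "t \<in> T \<Longrightarrow> t 0 = 0"
  using op_add[of t 0 0] by simp

lemma op_diff: "t \<in> T \<Longrightarrow> t (x - y) = t x - t y"
  using op_add[of t "x - y" y] by (simp add: algebra_simps)

lemma op_sum: "t \<in> T \<Longrightarrow> t (sum u J) = (\<Sum>j\<in>J. t (u j))"
  by (induction J rule: infinite_finite_induct) (auto simp: op_add op_zero)

lemma op_subgroup_image:
  assumes "op_endo T U f" "op_subgroup T U"
  shows "op_subgroup T (f ` U)"
  unfolding op_subgroup_def
proof (intro conjI ballI)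
  show "0 \<in> f ` U"
    by (rule image_eqI[of 0 f 0]) (simp_all add: op_endo_zero[OF assms] op_subgroup_zero[OF assms(2)])
next
  fix x y assume "x \<in> f ` U" "y \<in> f ` U"
  then obtain a c where "a \<in> U" "c \<in> U" "x = f a" "y = f c" by blast
  then show "x - y \<in> f ` U"
    using op_endo_diff[OF assms, of a c, symmetric] op_subgroup_diff[OF assms(2), of a c] by simp
next
  fix t x assume "t \<in> T" "x \<in> f ` U"
  moreover from this obtain a where a: "a \<in> U" "x = f a" by blast
  ultimately have "t x = f (t a)" "t a \<in> U"
    using op_endo_op[OF assms(1), of t a] op_subgroup_op[OF assms(2), of t a] by auto
  then show "t x \<in> f ` U" by blast
qed

lemma op_subgroup_kernel:
  assumes "op_endo T U f" "op_subgroup T U"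
  shows "op_subgroup T {x \<in> U. f x = 0}"
  unfolding op_subgroup_def
  using op_endo_zero[OF assms] op_subgroup_zero[OF assms(2)] op_endo_diff[OF assms]
    op_subgroup_diff[OF assms(2)] op_endo_op[OF assms(1)] op_subgroup_op[OF assms(2)]
  by (auto simp: op_zero)

lemma op_subgroup_Int: "op_subgroup T A \<Longrightarrow> op_subgroup T C \<Longrightarrow> op_subgroup T (A \<inter> C)"
  by (auto simp: op_subgroup_def)

lemma op_subgroup_sumset:
  assumes "\<And>j. j \<in> J \<Longrightarrow> op_subgroup T (W j)"
  shows "op_subgroup T {sum u J | u. \<forall>j\<in>J. u j \<in> W j}" (is "op_subgroup T ?S")
proof -
  have mem: "sum u J \<in> ?S" if "\<And>j. j \<in> J \<Longrightarrow> u j \<in> W j" for u using that by blast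
  show ?thesis unfolding op_subgroup_def
  proof (intro conjI ballI)
    show "0 \<in> ?S" using mem[of "\<lambda>_. 0"] op_subgroup_zero[OF assms] by simp
  next
    fix x y assume "x \<in> ?S" "y \<in> ?S"
    then obtain u w where uw: "x = sum u J" "y = sum w J" "\<forall>j\<in>J. u j \<in> W j" "\<forall>j\<in>J. w j \<in> W j"
      by blast
    have "sum (\<lambda>j. u j - w j) J \<in> ?S"
      by (rule mem) (use uw op_subgroup_diff[OF assms] in blast)
    then show "x - y \<in> ?S" by (simp add: uw sum_subtractf)
  next
    fix t x assume t: "t \<in> T" and "x \<in> ?S"
    then obtain u where u: "x = sum u J" "\<forall>j\<in>J. u j \<in> W j" by blast
    have "sum (\<lambda>j. t (u j)) J \<in> ?S"
      by (rule mem) (use u op_subgroup_op[OF assms t] in blast)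
    then show "t x \<in> ?S" by (simp add: u op_sum[OF t])
  qed
qed

lemma op_subgroup_internal_sum: "internal_sum T J W X \<Longrightarrow> op_subgroup T X"
  unfolding internal_sum_def using op_subgroup_sumset[of J W] by auto

lemma op_subgroup_splits:
  assumes "splits T X A C"
  shows "op_subgroup T X"
proof -
  have A: "op_subgroup T A" and C: "op_subgroup T C" and X: "X = {a + c | a c. a \<in> A \<and> c \<in> C}"
    using assms by (auto simp: splits_def)
  show ?thesis unfolding op_subgroup_def
  proof (intro conjI ballI)
    show "0 \<in> X" unfolding X using op_subgroup_zero[OF A] op_subgroup_zero[OF C] by force
  next
    fix x y assume "x \<in> X" "y \<in> X"
    then obtain a c a' c' where "x = a + c" "y = a' + c'" "a \<in> A" "a' \<in> A" "c \<in> C" "c' \<in> C"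
      unfolding X by auto
    moreover from this have "x - y = (a - a') + (c - c')" by simp
    ultimately show "x - y \<in> X" unfolding X
      using op_subgroup_diff[OF A] op_subgroup_diff[OF C] by blast
  next
    fix t x assume "t \<in> T" "x \<in> X"
    then show "t x \<in> X" unfolding X
      using op_subgroup_op[OF A] op_subgroup_op[OF C] by (auto simp: op_add) blast
  qed
qed

lemma splits_subset: "splits T X A C \<Longrightarrow> A \<subseteq> X" "splits T X A C \<Longrightarrow> C \<subseteq> X"
  unfolding splits_def op_subgroup_def
  by (auto, metis add.right_neutral, metis add.left_neutral)

lemma splits_unique:
  assumes "splits T X A C" "a \<in> A" "a' \<in> A" "c \<in> C" "c' \<in> C" "a + c = a' + c'"
  shows "a = a'" "c = c'"
proof -
  have A: "op_subgroup T A" and C: "op_subgroup T C" and i: "A \<inter> C = {0}"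
    using assms(1) by (auto simp: splits_def)
  have "a - a' = c' - c" using assms(6) by (simp add: algebra_simps)
  moreover have "a - a' \<in> A" "c' - c \<in> C"
    using op_subgroup_diff[OF A assms(2,3)] op_subgroup_diff[OF C assms(5,4)] .
  ultimately have "a - a' \<in> A \<inter> C" by simp
  then show "a = a'" using i by auto
  then show "c = c'" using assms(6) by simp
qed

lemma internal_sum_Un:
  assumes "internal_sum T J W A" "internal_sum T K W C" "J \<inter> K = {}" "splits T X A C"
  shows "internal_sum T (J \<union> K) W X"
proof -
  have J: "finite J" "finite K" using assms by (auto simp: internal_sum_def)
  have su: "sum u (J \<union> K) = sum u J + sum u K" for u :: "_ \<Rightarrow> 'e"
    using J assms(3) by (simp add: sum.union_disjoint)
  have A: "A = {sum u J | u. \<forall>j\<in>J. u j \<in> W j}" and C: "C = {sum u K | u. \<forall>j\<in>K. u j \<in> W j}"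
    and X: "X = {a + c | a c. a \<in> A \<and> c \<in> C}" and Az: "0 \<in> A" "0 \<in> C"
    using internal_sum_eq[OF assms(1)] internal_sum_eq[OF assms(2)] assms(4)
      op_subgroup_zero[OF op_subgroup_internal_sum[OF assms(1)]] op_subgroup_zero[OF op_subgroup_internal_sum[OF assms(2)]]
    unfolding splits_def by blast+
  have sub: "\<forall>j\<in>J \<union> K. op_subgroup T (W j)"
    using internal_sum_op_subgroup[OF assms(1)] internal_sum_op_subgroup[OF assms(2)] by blast
  show ?thesis unfolding internal_sum_def
  proof (intro conjI allI impI sub)
    show "finite (J \<union> K)" using J by simp
    show "X = {sum u (J \<union> K) | u. \<forall>j\<in>J \<union> K. u j \<in> W j}"
    proof
      show "{sum u (J \<union> K) | u. \<forall>j\<in>J \<union> K. u j \<in> W j} \<subseteq> X"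
        unfolding X A C su by blast
      show "X \<subseteq> {sum u (J \<union> K) | u. \<forall>j\<in>J \<union> K. u j \<in> W j}"
      proof
        fix x assume "x \<in> X"
        then obtain u w where uw: "x = sum u J + sum w K" "\<forall>j\<in>J. u j \<in> W j" "\<forall>j\<in>K. w j \<in> W j"
          unfolding X A C by blast
        let ?z = "\<lambda>j. if j \<in> J then u j else w j"
        have "sum ?z J = sum u J" by (intro sum.cong) auto
        moreover have "sum ?z K = sum w K" using assms(3) by (intro sum.cong) auto
        ultimately have "x = sum ?z (J \<union> K)" using uw su by simp
        moreover have "\<forall>j\<in>J \<union> K. ?z j \<in> W j" using uw by auto
        ultimately show "x \<in> {sum u (J \<union> K) | u. \<forall>j\<in>J \<union> K. u j \<in> W j}" by blast
      qed
    qed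
    fix u assume u: "(\<forall>j\<in>J \<union> K. u j \<in> W j) \<and> sum u (J \<union> K) = 0"
    then have "sum u J \<in> A" "sum u K \<in> C" unfolding A C by blast+
    then have "sum u J = 0" "sum u K = 0"
      using splits_unique[OF assms(4), of "sum u J" 0 "sum u K" 0] u su Az by auto
    then show "\<forall>j\<in>J \<union> K. u j = 0"
      using internal_sum_independent[OF assms(1), of u] internal_sum_independent[OF assms(2), of u] u by blast
  qed
qed

lemma internal_sum_singleton: "internal_sum T {j} W X \<longleftrightarrow> op_subgroup T (W j) \<and> X = W j"
proof -
  have "{sum u {j} | u. \<forall>i\<in>{j}. u i \<in> W i} = W j" by (auto intro: exI[of _ "\<lambda>_. _"])
  then show ?thesis by (auto simp: internal_sum_def)
qed

text \<open>
  Splitting off one summand reduces finite direct sums to sums of two subgroups, for which complements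
  and projections are available.
\<close>

lemma internal_sum_insert:
  assumes "j \<notin> J"
  shows "internal_sum T (insert j J) W X \<longleftrightarrow> (\<exists>Y. internal_sum T J W Y \<and> splits T X (W j) Y)"
proof
  assume d: "internal_sum T (insert j J) W X"
  define Y where "Y = {sum u J | u. \<forall>i\<in>J. u i \<in> W i}"
  have fin: "finite J" and W: "op_subgroup T (W j)" "\<forall>i\<in>J. op_subgroup T (W i)"
    and X: "X = {sum u (insert j J) | u. \<forall>i\<in>insert j J. u i \<in> W i}"
    and ind: "\<And>u. (\<forall>i\<in>insert j J. u i \<in> W i) \<Longrightarrow> sum u (insert j J) = 0 \<Longrightarrow> (\<forall>i\<in>insert j J. u i = 0)"
    using d by (auto simp: internal_sum_def)
  have ext: "\<exists>w. (\<forall>i\<in>insert j J. w i \<in> W i) \<and> sum w (insert j J) = a + sum u J \<and> w j = a \<and>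
      (\<forall>i\<in>J. w i = u i)" if "a \<in> W j" "\<forall>i\<in>J. u i \<in> W i" for a u
  proof -
    have "(\<Sum>i\<in>J. if i = j then a else u i) = sum u J" using assms by (intro sum.cong) auto
    then show ?thesis using that fin assms
      by (intro exI[of _ "\<lambda>i. if i = j then a else u i"]) auto
  qed
  have "internal_sum T J W Y" unfolding internal_sum_def
  proof (intro conjI allI impI)
    fix u assume u: "(\<forall>j\<in>J. u j \<in> W j) \<and> sum u J = 0"
    then obtain w where w: "\<forall>i\<in>insert j J. w i \<in> W i" "sum w (insert j J) = 0 + sum u J"
      "\<forall>i\<in>J. w i = u i" using ext[OF op_subgroup_zero[OF W(1)]] by blast
    then have "sum w (insert j J) = 0" using u by simp
    then show "\<forall>j\<in>J. u j = 0" using ind[OF w(1)] w(3) by simp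
  qed (use fin W Y_def in auto)
  moreover have "splits T X (W j) Y" unfolding splits_def
  proof (intro conjI)
    show "op_subgroup T Y" using op_subgroup_internal_sum[OF \<open>internal_sum T J W Y\<close>] .
    show "W j \<inter> Y = {0}"
    proof
      show "{0} \<subseteq> W j \<inter> Y"
        using op_subgroup_zero[OF W(1)] op_subgroup_zero[OF \<open>op_subgroup T Y\<close>] by simp
      show "W j \<inter> Y \<subseteq> {0}"
      proof
        fix x assume "x \<in> W j \<inter> Y"
        then obtain u where u: "x = sum u J" "\<forall>i\<in>J. u i \<in> W i" "x \<in> W j" by (auto simp: Y_def)
        obtain w where w: "\<forall>i\<in>insert j J. w i \<in> W i" "sum w (insert j J) = - x + sum u J"
            "w j = - x"
          using ext[OF op_subgroup_minus[OF W(1) u(3)] u(2)] by (elim exE conjE) (rule that)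
        then have "sum w (insert j J) = 0" using u(1) by simp
        then have "w j = 0" using ind[OF w(1)] by simp
        then show "x \<in> {0}" using w(3) by simp
      qed
    qed
    show "X = {a + c | a c. a \<in> W j \<and> c \<in> Y}"
    proof
      show "X \<subseteq> {a + c | a c. a \<in> W j \<and> c \<in> Y}"
        unfolding X Y_def using fin assms by auto
      show "{a + c | a c. a \<in> W j \<and> c \<in> Y} \<subseteq> X"
      proof
        fix x assume "x \<in> {a + c | a c. a \<in> W j \<and> c \<in> Y}"
        then obtain a u where "x = a + sum u J" "a \<in> W j" "\<forall>i\<in>J. u i \<in> W i" unfolding Y_def by blast
        moreover obtain w where "\<forall>i\<in>insert j J. w i \<in> W i" "sum w (insert j J) = a + sum u J"
          using ext[of a u] calculation(2,3) by metis
        ultimately show "x \<in> X" unfolding X by (intro CollectI exI[of _ w]) simp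
      qed
    qed
  qed (use W in auto)
  ultimately show "\<exists>Y. internal_sum T J W Y \<and> splits T X (W j) Y" by blast
next
  assume "\<exists>Y. internal_sum T J W Y \<and> splits T X (W j) Y"
  then obtain Y where Y: "internal_sum T J W Y" "splits T X (W j) Y" by blast
  then have "internal_sum T {j} W (W j)" unfolding internal_sum_singleton by (simp add: splits_def)
  from internal_sum_Un[OF this Y(1) _ Y(2)] show "internal_sum T (insert j J) W X" using assms by simp
qed

lemma internal_sum_reindex:
  assumes "inj_on h J"
  shows "internal_sum T (h ` J) W X \<longleftrightarrow> internal_sum T J (\<lambda>j. W (h j)) X"
proof -
  have s: "sum u (h ` J) = sum (\<lambda>j. u (h j)) J" for u :: "_ \<Rightarrow> 'e"
    using sum.reindex[OF assms, of u] by (simp add: comp_def)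
  have ex: "\<exists>w. (\<forall>j\<in>J. w (h j) = u j)" for u :: "_ \<Rightarrow> 'e"
    using assms by (intro exI[of _ "\<lambda>i. u (inv_into J h i)"]) auto
  have X: "{sum u (h ` J) | u. \<forall>i\<in>h ` J. u i \<in> W i} = {sum u J | u. \<forall>j\<in>J. u j \<in> W (h j)}"
  proof safe
    fix u assume "\<forall>i\<in>h ` J. u i \<in> W i"
    then show "\<exists>w. sum u (h ` J) = sum w J \<and> (\<forall>j\<in>J. w j \<in> W (h j))"
      by (intro exI[of _ "\<lambda>j. u (h j)"]) (auto simp: s)
  next
    fix u assume u: "\<forall>j\<in>J. u j \<in> W (h j)"
    obtain w where w: "\<forall>j\<in>J. w (h j) = u j" using ex by blast
    show "\<exists>w. sum u J = sum w (h ` J) \<and> (\<forall>i\<in>h ` J. w i \<in> W i)"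
    proof (intro exI conjI)
      show "sum u J = sum w (h ` J)" unfolding s by (rule sum.cong) (use w in auto)
    qed (use u w in auto)
  qed
  have I: "(\<forall>u. (\<forall>i\<in>h ` J. u i \<in> W i) \<and> sum u (h ` J) = 0 \<longrightarrow> (\<forall>i\<in>h ` J. u i = 0)) \<longleftrightarrow>
     (\<forall>u. (\<forall>j\<in>J. u j \<in> W (h j)) \<and> sum u J = 0 \<longrightarrow> (\<forall>j\<in>J. u j = 0))" (is "?L \<longleftrightarrow> ?R")
  proof
    assume L: ?L
    show ?R
    proof (intro allI impI)
      fix u assume u: "(\<forall>j\<in>J. u j \<in> W (h j)) \<and> sum u J = 0"
      obtain w where w: "\<forall>j\<in>J. w (h j) = u j" using ex by blast
      have "sum w (h ` J) = sum u J" unfolding s by (rule sum.cong) (use w in auto)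
      moreover have "\<forall>i\<in>h ` J. w i \<in> W i" using u w by simp
      ultimately have "\<forall>i\<in>h ` J. w i = 0" using L u by metis
      then show "\<forall>j\<in>J. u j = 0" using w by auto
    qed
  next
    assume R: ?R
    show ?L using R by (auto simp: s)
  qed
  show ?thesis unfolding internal_sum_def X I using assms by (auto simp: finite_image_iff)
qed

text \<open>
  Two equal nonzero summands would give the relation \<open>x + (- x) = 0\<close>.  So a decomposition into nonzero
  parts can be described by the set of its parts.
\<close>

lemma internal_sum_nonzero_inj:
  assumes d: "internal_sum T J W X" and nz: "\<And>j. j \<in> J \<Longrightarrow> W j \<noteq> {0}"
  shows "inj_on W J"
proof (rule inj_onI, rule ccontr)
  fix i j assume ij: "i \<in> J" "j \<in> J" "W i = W j" "i \<noteq> j"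
  have J: "finite J" "op_subgroup T (W i)" and Wz: "\<forall>j\<in>J. 0 \<in> W j"
    using d ij by (auto simp: internal_sum_def op_subgroup_zero)
  obtain x where x: "x \<in> W i" "x \<noteq> 0" using nz[OF ij(1)] op_subgroup_zero[OF J(2)] by auto
  define u where "u = (\<lambda>k. if k = i then x else if k = j then - x else 0)"
  have "sum u J = (\<Sum>k\<in>J. (if k = i then x else 0) + (if k = j then - x else 0))"
    using ij(4) by (intro sum.cong) (auto simp: u_def)
  also have "\<dots> = 0" using ij J by (simp add: sum.distrib)
  finally have "sum u J = 0" .
  moreover have "\<forall>k\<in>J. u k \<in> W k" using x ij Wz op_subgroup_minus[OF J(2)] by (auto simp: u_def)
  ultimately have "u i = 0" using d ij by (auto simp: internal_sum_def)
  then show False using x by (simp add: u_def)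
qed

section \<open>Uniqueness of the number of indecomposable summands\<close>

lemma bounded_mono_nat_stabilizes:
  fixes g :: "nat \<Rightarrow> nat"
  assumes "\<And>i j. i \<le> j \<Longrightarrow> g i \<le> g j" "\<And>i. g i \<le> N"
  shows "\<exists>n. \<forall>m\<ge>n. g m = g n"
proof -
  have f: "finite (range g)" using assms(2) by (auto intro: finite_subset[of _ "{..N}"])
  then have "Max (range g) \<in> range g" by (intro Max_in) auto
  then obtain n where n: "g n = Max (range g)" by (metis imageE)
  have "g m = g n" if "m \<ge> n" for m
    using assms(1)[OF that] n Max_ge[OF f, of "g m"] by simp
  then show ?thesis by blast
qed

text \<open>
  Fitting's lemma: for large \<open>n\<close> the kernels and the images of the powers of \<open>f\<close> have stabilized, and
  then \<open>U\<close> is the direct sum of the kernel and the image of \<open>f\<^sup>n\<close>.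
\<close>

lemma fitting:
  assumes U: "op_subgroup T U" and len: "finite_length T U" and ind: "indec T U"
    and f: "op_endo T U f"
  shows "bij_betw f U U \<or> (\<exists>n. \<forall>x\<in>U. (f ^^ n) x = 0)"
proof -
  obtain \<rho> :: "'e set \<Rightarrow> nat" where \<rho>: "\<And>V W. op_subgroup T V \<Longrightarrow> op_subgroup T W \<Longrightarrow> V \<subset> W \<Longrightarrow>
     W \<subseteq> U \<Longrightarrow> \<rho> V < \<rho> W"
    using len unfolding finite_length_def by blast
  have \<rho>_le: "\<rho> V \<le> \<rho> W" if "op_subgroup T V" "op_subgroup T W" "V \<subseteq> W" "W \<subseteq> U" for V W
    using \<rho>[OF that(1,2)] that by (cases "V = W") (auto intro: less_imp_le)
  define K where "K n = {x \<in> U. (f ^^ n) x = 0}" for n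
  define I where "I n = (f ^^ n) ` U" for n
  note fn = op_endo_funpow[OF f]
  have K: "op_subgroup T (K n)" and I: "op_subgroup T (I n)" and KU: "K n \<subseteq> U" and IU: "I n \<subseteq> U" for n
    using op_subgroup_kernel[OF fn U, of n] op_subgroup_image[OF fn U, of n] op_endo_closed[OF fn]
    by (auto simp: K_def I_def)
  have add: "(f ^^ (m + n)) x = (f ^^ m) ((f ^^ n) x)" for m n x by (simp add: funpow_add)
  have Kmono: "K i \<subseteq> K j" and Imono: "I j \<subseteq> I i" if ij: "i \<le> j" for i j
  proof -
    obtain k where k: "j = k + i" using ij le_Suc_ex[OF ij] by (auto simp: add.commute)
    show "K i \<subseteq> K j" using op_endo_zero[OF fn U, of k] by (auto simp: K_def k add)
    have "(f ^^ j) x = (f ^^ i) ((f ^^ k) x)" for x using add[of i k x] k by (simp add: add.commute)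
    then show "I j \<subseteq> I i" unfolding I_def using op_endo_closed[OF fn, of _ k] by auto
  qed
  obtain n1 where n1: "\<forall>m\<ge>n1. \<rho> (K m) = \<rho> (K n1)"
    using bounded_mono_nat_stabilizes[of "\<lambda>n. \<rho> (K n)" "\<rho> U"] \<rho>_le[OF K K Kmono KU] \<rho>_le[OF K U KU] by auto
  obtain n2 where n2: "\<forall>m\<ge>n2. \<rho> U - \<rho> (I m) = \<rho> U - \<rho> (I n2)"
    using bounded_mono_nat_stabilizes[of "\<lambda>n. \<rho> U - \<rho> (I n)" "\<rho> U"] \<rho>_le[OF I I Imono IU]
    by (auto simp: diff_le_mono2)
  \<comment> \<open>The successor makes \<open>n\<close> positive, so that a map is injective or surjective if its \<open>n\<close>-th power is.\<close>
  define n where "n = Suc (max n1 n2)"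
  have n: "n1 \<le> n" "n2 \<le> n" by (auto simp: n_def)
  have "\<rho> (K (n + n)) = \<rho> (K n)"
    using n1[rule_format, of "n + n"] n1[rule_format, of n] n by simp
  then have Kn: "K (n + n) = K n" using \<rho>[OF K[of n] K[of "n + n"] psubsetI[OF Kmono[OF le_add1[of n n]]] KU]
    by (rule_tac ccontr) simp
  have "\<rho> U - \<rho> (I (n + n)) = \<rho> U - \<rho> (I n)"
    using n2[rule_format, of "n + n"] n2[rule_format, of n] n by simp
  then have "\<rho> (I (n + n)) = \<rho> (I n)" using \<rho>_le[OF I U IU, of "n + n"] \<rho>_le[OF I U IU, of n] by simp
  then have In: "I (n + n) = I n" using \<rho>[OF I[of "n + n"] I[of n] psubsetI[OF Imono[OF le_add1[of n n]]] IU]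
    by (rule_tac ccontr) simp
  have "splits T U (K n) (I n)" unfolding splits_def
  proof (intro conjI K I)
    show "K n \<inter> I n = {0}"
    proof
      show "{0} \<subseteq> K n \<inter> I n" using op_subgroup_zero[OF K] op_subgroup_zero[OF I] by auto
      show "K n \<inter> I n \<subseteq> {0}"
      proof
        fix x assume "x \<in> K n \<inter> I n"
        then obtain y where y: "y \<in> U" "x = (f ^^ n) y" "(f ^^ n) x = 0" by (auto simp: K_def I_def)
        then have "y \<in> K (n + n)" by (auto simp: K_def add)
        then show "x \<in> {0}" using y Kn by (auto simp: K_def)
      qed
    qed
    show "U = {a + c | a c. a \<in> K n \<and> c \<in> I n}"
    proof
      show "{a + c | a c. a \<in> K n \<and> c \<in> I n} \<subseteq> U" using KU IU op_subgroup_add[OF U] by blast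
      show "U \<subseteq> {a + c | a c. a \<in> K n \<and> c \<in> I n}"
      proof
        fix x assume x: "x \<in> U"
        then have "(f ^^ n) x \<in> I (n + n)" using In by (auto simp: I_def)
        then obtain y where y: "y \<in> U" "(f ^^ n) x = (f ^^ n) ((f ^^ n) y)" by (auto simp: I_def add)
        have "(f ^^ n) y \<in> U" using op_endo_closed[OF fn y(1)] .
        then have "x - (f ^^ n) y \<in> K n"
          using x y op_endo_diff[OF fn U, of x "(f ^^ n) y"] op_subgroup_diff[OF U] by (auto simp: K_def)
        moreover have "(f ^^ n) y \<in> I n" using y by (auto simp: I_def)
        moreover have "x = (x - (f ^^ n) y) + (f ^^ n) y" by simp
        ultimately show "x \<in> {a + c | a c. a \<in> K n \<and> c \<in> I n}" by blast
      qed
    qed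
  qed
  then have sp: "splits T U (K n) (I n)" .
  then consider "K n = {0}" | "I n = {0}" using ind unfolding indec_def by blast
  then show ?thesis
  proof cases
    case 1
    have "I n = U" using sp 1 unfolding splits_def by auto
    have "f ` U = U"
    proof
      show "f ` U \<subseteq> U" using op_endo_closed[OF f] by auto
      show "U \<subseteq> f ` U"
      proof
        fix x assume "x \<in> U"
        then obtain y where y: "y \<in> U" "x = (f ^^ n) y" using \<open>I n = U\<close> by (auto simp: I_def)
        have "x = f ((f ^^ (max n1 n2)) y)" using y by (simp add: n_def)
        then show "x \<in> f ` U" using op_endo_closed[OF fn y(1)] by auto
      qed
    qed
    moreover have "inj_on f U"
    proof (rule inj_onI)
      fix x y assume xy: "x \<in> U" "y \<in> U" "f x = f y"
      then have d: "f (x - y) = 0" using op_endo_diff[OF f U] by simp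
      have "(f ^^ n) (x - y) = (f ^^ (max n1 n2)) (f (x - y))" by (simp add: n_def funpow_swap1)
      then have "x - y \<in> K n" using d op_endo_zero[OF fn U] op_subgroup_diff[OF U xy(1,2)] by (auto simp: K_def)
      then show "x = y" using 1 by auto
    qed
    ultimately show ?thesis by (auto simp: bij_betw_def)
  next
    case 2
    then show ?thesis unfolding I_def by (metis image_eqI singletonD)
  qed
qed

text \<open>
  The endomorphism ring of an indecomposable group of finite length is local: if a sum of two
  endomorphisms is invertible, then, after division by the sum, they are \<open>F\<close> and \<open>1 - F\<close>, and these
  cannot both be nilpotent.
\<close>

lemma bij_summand:
  assumes U: "op_subgroup T U" and len: "finite_length T U" and ind: "indec T U"
    and "finite J" and "\<And>j. j \<in> J \<Longrightarrow> op_endo T U (f j)"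
    and "bij_betw (\<lambda>x. \<Sum>j\<in>J. f j x) U U"
  shows "\<exists>j\<in>J. bij_betw (f j) U U"
  using assms(4-)
proof (induction J rule: finite_induct)
  case empty
  then have "U = {0}" using op_subgroup_zero[OF U] by (auto simp: bij_betw_def)
  then show ?case using ind by (auto simp: indec_def)
next
  case (insert i J)
  define g where "g = (\<lambda>x. \<Sum>j\<in>J. f j x)"
  define h where "h = (\<lambda>x. f i x + g x)"
  have g: "op_endo T U g"
    using insert.prems(1) unfolding op_endo_def g_def
    by (auto simp: sum.distrib op_sum intro!: op_subgroup_sum[OF U])
  have fi: "op_endo T U (f i)" using insert.prems(1) by auto
  have h: "op_endo T U h" unfolding op_endo_def h_def
    using op_endo_closed[OF fi] op_endo_closed[OF g] op_subgroup_add[OF U]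
    by (auto simp: op_endo_add[OF fi] op_endo_add[OF g] op_endo_op[OF fi] op_endo_op[OF g] op_add algebra_simps)
  have hb: "bij_betw h U U" using insert.prems(2) insert.hyps by (simp add: h_def g_def)
  define h' where "h' = inv_into U h"
  have h': "op_endo T U h'" unfolding h'_def by (rule op_endo_inv_into[OF h U hb])
  have h'h: "h' (h x) = x" and hh': "h (h' x) = x" if "x \<in> U" for x
    using that hb by (auto simp: h'_def bij_betw_def f_inv_into_f)
  define F where "F = (\<lambda>x. h' (f i x))"
  define G where "G = (\<lambda>x. h' (g x))"
  have F: "op_endo T U F" and G: "op_endo T U G"
    unfolding F_def G_def by (auto intro: op_endo_comp fi g h')
  have FG: "F x + G x = x" if "x \<in> U" for x
    using h'h[OF that] op_endo_add[OF h' op_endo_closed[OF fi that] op_endo_closed[OF g that]]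
    by (simp add: F_def G_def h_def)
  have bij_k: "bij_betw k U U" if "bij_betw (\<lambda>x. h' (k x)) U U" "op_endo T U k" for k
  proof -
    have "bij_betw (h \<circ> (\<lambda>x. h' (k x))) U U" using bij_betw_trans[OF that(1) hb] .
    moreover have "(h \<circ> (\<lambda>x. h' (k x))) x = k x" if "x \<in> U" for x
      using hh' op_endo_closed[OF \<open>op_endo T U k\<close> that] by simp
    ultimately show ?thesis using bij_betw_cong by blast
  qed
  have "bij_betw F U U \<or> bij_betw G U U"
  proof (rule ccontr)
    assume "\<not> ?thesis"
    then obtain n m where n: "\<forall>x\<in>U. (F ^^ n) x = 0" and m: "\<forall>x\<in>U. (G ^^ m) x = 0"
      using fitting[OF U len ind F] fitting[OF U len ind G] by blast
    have Ginj: "x = 0" if x: "x \<in> U" "G x = 0" for x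
    proof -
      have "F x = x" using FG[OF x(1)] x(2) by simp
      \<comment> \<open>A fixed point of the nilpotent map \<open>F\<close> is zero.\<close>
      then have "(F ^^ n) x = x" by (induction n) auto
      then show "x = 0" using n x by auto
    qed
    have "x = 0" if "x \<in> U" for x
    proof -
      have "\<forall>x\<in>U. (G ^^ k) x = 0 \<longrightarrow> x = 0" for k
      proof (induction k)
        case (Suc k)
        then show ?case using Ginj op_endo_closed[OF op_endo_funpow[OF G]] by auto
      qed auto
      then show ?thesis using m that by auto
    qed
    then have "U = {0}" using op_subgroup_zero[OF U] by auto
    then show False using ind by (auto simp: indec_def)
  qed
  then show ?case
  proof
    assume "bij_betw F U U"
    then show ?thesis using bij_k[of "f i"] fi by (auto simp: F_def)
  next
    assume "bij_betw G U U"
    then have "bij_betw g U U" using bij_k[of g] g by (auto simp: G_def)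
    then show ?thesis using insert by (auto simp: g_def)
  qed
qed

lemma finite_length_subset: "finite_length T X \<Longrightarrow> U \<subseteq> X \<Longrightarrow> finite_length T U"
  unfolding finite_length_def by (meson subset_trans)

text \<open>
  Let \<open>p\<close> be the projection to \<open>U\<close> along \<open>Y\<close> and \<open>q\<^sub>j\<close> the projection to \<open>W\<^sub>j\<close>.  On \<open>U\<close> the identity is
  the sum of the maps \<open>p \<circ> q\<^sub>j\<close>, so one of them is bijective.  For this \<open>j\<close> the group \<open>W\<^sub>j\<close> is the
  direct sum of \<open>q\<^sub>j U\<close> and \<open>W\<^sub>j \<inter> Y\<close>; as it is indecomposable and \<open>q\<^sub>j U\<close> is not zero, \<open>W\<^sub>j\<close> meets
  \<open>Y\<close> trivially and can take the place of \<open>U\<close>.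
\<close>

lemma exchange:
  assumes len: "finite_length T X" and s: "splits T X U Y" and ind: "indec T U"
    and d: "internal_sum T J W X" and indW: "\<And>j. j \<in> J \<Longrightarrow> indec T (W j)"
  shows "\<exists>j\<in>J. splits T X (W j) Y"
proof -
  have U: "op_subgroup T U" and Y: "op_subgroup T Y" and X: "X = {a + c | a c. a \<in> U \<and> c \<in> Y}"
    using s by (auto simp: splits_def)
  have J: "finite J" and W: "\<And>j. j \<in> J \<Longrightarrow> op_subgroup T (W j)"
    and XW: "X = {sum u J | u. \<forall>j\<in>J. u j \<in> W j}"
    using d by (auto simp: internal_sum_def)
  note XX = op_subgroup_splits[OF s]
  have "\<forall>x\<in>X. \<exists>a. a \<in> U \<and> x - a \<in> Y" unfolding X by force
  then obtain p where p: "\<And>x. x \<in> X \<Longrightarrow> p x \<in> U" "\<And>x. x \<in> X \<Longrightarrow> x - p x \<in> Y" by metis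
  have p_eq: "p x = a" if "x \<in> X" "a \<in> U" "x - a \<in> Y" for x a
    using splits_unique(1)[OF s p(1)[OF that(1)] that(2) p(2)[OF that(1)] that(3)] by simp
  have "\<forall>x\<in>X. \<exists>u. (\<forall>j\<in>J. u j \<in> W j) \<and> x = sum u J" unfolding XW by auto
  then obtain q where q: "\<And>x j. x \<in> X \<Longrightarrow> j \<in> J \<Longrightarrow> q x j \<in> W j" "\<And>x. x \<in> X \<Longrightarrow> x = sum (q x) J" by metis
  have q_eq: "q x j = u j" if "x \<in> X" "\<forall>j\<in>J. u j \<in> W j" "x = sum u J" "j \<in> J" for x u j
  proof -
    have "\<forall>j\<in>J. q x j - u j \<in> W j" using q(1)[OF that(1)] that(2) W op_subgroup_diff by blast
    moreover have "sum (\<lambda>j. q x j - u j) J = 0"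
      using q(2)[OF that(1)] that(3) by (simp add: sum_subtractf)
    ultimately have "\<forall>j\<in>J. q x j - u j = 0" by (rule internal_sum_independent[OF d])
    then show ?thesis using that(4) by simp
  qed
  note WX = internal_sum_summand_subset[OF d]
  have p_add: "p (x + y) = p x + p y" if "x \<in> X" "y \<in> X" for x y
  proof (rule p_eq)
    have "x + y - (p x + p y) = (x - p x) + (y - p y)" by simp
    then show "x + y - (p x + p y) \<in> Y"
      using op_subgroup_add[OF Y p(2)[OF that(1)] p(2)[OF that(2)]] by (simp only:)
  qed (use that p op_subgroup_add[OF U] op_subgroup_add[OF XX] in auto)
  have p_op: "p (t x) = t (p x)" if "t \<in> T" "x \<in> X" for t x
  proof (rule p_eq)
    have "t x - t (p x) = t (x - p x)" using op_diff[OF that(1)] by simp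
    then show "t x - t (p x) \<in> Y" using op_subgroup_op[OF Y that(1) p(2)[OF that(2)]] by (simp only:)
  qed (use that p op_subgroup_op[OF U] op_subgroup_op[OF XX] in auto)
  have q_add: "q (x + y) j = q x j + q y j" if "x \<in> X" "y \<in> X" "j \<in> J" for x y j
    by (rule q_eq) (use that q(1) op_subgroup_add[OF W] op_subgroup_add[OF XX] in
        \<open>auto simp: sum.distrib q(2)[symmetric]\<close>)
  have q_op: "q (t x) j = t (q x j)" if "t \<in> T" "x \<in> X" "j \<in> J" for t x j
  proof (rule q_eq)
    show "t x = (\<Sum>j\<in>J. t (q x j))" using op_sum[OF that(1), of "q x" J] q(2)[OF that(2)] by simp
  qed (use that q(1) op_subgroup_op[OF W] op_subgroup_op[OF XX] in auto)
  have UX: "U \<subseteq> X" and YX: "Y \<subseteq> X" using splits_subset[OF s] by auto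
  define f where "f j = (\<lambda>x. p (q x j))" for j
  have f: "op_endo T U (f j)" if j: "j \<in> J" for j
    unfolding op_endo_def f_def
  proof (intro conjI ballI)
    fix x y assume xy: "x \<in> U" "y \<in> U"
    then have x: "x \<in> X" "y \<in> X" using UX by auto
    then have qx: "q x j \<in> X" "q y j \<in> X" using q(1)[OF _ j] WX[OF j] by auto
    then show "p (q x j) \<in> U" by (simp add: p(1))
    show "p (q (x + y) j) = p (q x j) + p (q y j)" using q_add[OF x j] p_add[OF qx] by simp
  next
    fix t x assume t: "t \<in> T" and "x \<in> U"
    then have x: "x \<in> X" using UX by auto
    then have qx: "q x j \<in> X" using q(1)[OF _ j] WX[OF j] by auto
    show "p (q (t x) j) = t (p (q x j))" using q_op[OF t x j] p_op[OF t qx] by simp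
  qed
  have p_sum: "p (sum u K) = (\<Sum>j\<in>K. p (u j))" if "\<forall>j\<in>K. u j \<in> X" "finite K" for K and u :: "_ \<Rightarrow> 'e"
    using that(2,1)
  proof (induction K rule: finite_induct)
    case empty
    show ?case using p_eq[of 0 0] op_subgroup_zero[OF XX] op_subgroup_zero[OF U] op_subgroup_zero[OF Y] by simp
  next
    case (insert i K)
    then show ?case using p_add op_subgroup_sum[OF XX, of K u] by simp
  qed
  have "(\<Sum>j\<in>J. f j x) = x" if "x \<in> U" for x
  proof -
    have xX: "x \<in> X" using that UX by auto
    have "(\<Sum>j\<in>J. f j x) = p (sum (q x) J)"
      unfolding f_def using p_sum[of J "q x"] q(1)[OF xX] WX J by (metis subsetD)
    also have "\<dots> = p x" using q(2)[OF xX] by simp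
    also have "\<dots> = x" using p_eq[OF xX that] op_subgroup_zero[OF Y] by simp
    finally show ?thesis .
  qed
  then have "bij_betw (\<lambda>x. \<Sum>j\<in>J. f j x) U U"
    using bij_betw_cong[of U "\<lambda>x. \<Sum>j\<in>J. f j x" id U] by simp
  then obtain j where j: "j \<in> J" and b: "bij_betw (f j) U U"
    using bij_summand[OF U finite_length_subset[OF len UX] ind J, of f] f by blast
  have inj: "inj_on (f j) U" and im: "f j ` U = U" using b by (auto simp: bij_betw_def)
  have p0: "p x = 0 \<longleftrightarrow> x \<in> Y" if "x \<in> X" for x
    using p(2)[OF that] p_eq[OF that op_subgroup_zero[OF U]] by auto
  have p_diff: "p (x - y) = p x - p y" if "x \<in> X" "y \<in> X" for x y
    using p_add[of "x - y" y] that op_subgroup_diff[OF XX that] by (simp add: algebra_simps)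
  define V where "V = (\<lambda>x. q x j) ` U"
  have qWj: "q x j \<in> W j" if "x \<in> U" for x using q(1)[OF _ j] that UX by auto
  have V: "op_subgroup T V" unfolding op_subgroup_def V_def
  proof (intro conjI ballI)
    have "q 0 j = 0"
      using q_add[of 0 0 j] j op_subgroup_zero[OF XX] by simp
    then show "0 \<in> (\<lambda>x. q x j) ` U" using op_subgroup_zero[OF U] by force
  next
    fix x y assume "x \<in> (\<lambda>x. q x j) ` U" "y \<in> (\<lambda>x. q x j) ` U"
    then obtain a c where ac: "a \<in> U" "c \<in> U" "x = q a j" "y = q c j" by auto
    have "q (a - c + c) j = q (a - c) j + q c j"
      using ac UX op_subgroup_diff[OF U ac(1,2)] j by (intro q_add) auto
    then have "x - y = q (a - c) j" using ac by simp
    then show "x - y \<in> (\<lambda>x. q x j) ` U" using op_subgroup_diff[OF U ac(1,2)] by auto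
  next
    fix t x assume t: "t \<in> T" "x \<in> (\<lambda>x. q x j) ` U"
    then obtain a where "a \<in> U" "x = q a j" by auto
    then show "t x \<in> (\<lambda>x. q x j) ` U" using q_op[OF t(1) _ j] UX op_subgroup_op[OF U t(1)] by (metis imageI subsetD)
  qed
  have VW: "splits T (W j) V (W j \<inter> Y)" unfolding splits_def
  proof (intro conjI V op_subgroup_Int W[OF j] Y)
    show "V \<inter> (W j \<inter> Y) = {0}"
    proof
      show "{0} \<subseteq> V \<inter> (W j \<inter> Y)"
        using op_subgroup_zero[OF V] op_subgroup_zero[OF W[OF j]] op_subgroup_zero[OF Y] by auto
      show "V \<inter> (W j \<inter> Y) \<subseteq> {0}"
      proof
        fix x assume x: "x \<in> V \<inter> (W j \<inter> Y)"
        then obtain a where a: "a \<in> U" "x = q a j" by (auto simp: V_def)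
        have "f j a = 0" using x a p0 YX by (auto simp: f_def)
        moreover have "f j 0 = 0" using op_endo_zero[OF f[OF j] U] .
        ultimately have "a = 0" using inj a op_subgroup_zero[OF U] by (metis inj_onD)
        then show "x \<in> {0}" using a q_add[of 0 0 j] j op_subgroup_zero[OF XX] by simp
      qed
    qed
    show "W j = {a + c | a c. a \<in> V \<and> c \<in> W j \<inter> Y}"
    proof
      show "{a + c | a c. a \<in> V \<and> c \<in> W j \<inter> Y} \<subseteq> W j"
        using qWj op_subgroup_add[OF W[OF j]] by (auto simp: V_def)
      show "W j \<subseteq> {a + c | a c. a \<in> V \<and> c \<in> W j \<inter> Y}"
      proof
        fix x assume x: "x \<in> W j"
        then have xX: "x \<in> X" using WX[OF j] by auto
        then have "p x \<in> f j ` U" using im p(1) by simp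
        then obtain a where a: "a \<in> U" "p x = p (q a j)" by (auto simp: f_def)
        have qX: "q a j \<in> X" using qWj[OF a(1)] WX[OF j] by auto
        have "x - q a j \<in> Y" using p_diff[OF xX qX] a p0[OF op_subgroup_diff[OF XX xX qX]] by simp
        moreover have "x - q a j \<in> W j" using op_subgroup_diff[OF W[OF j] x qWj[OF a(1)]] .
        moreover have "x = q a j + (x - q a j)" by simp
        moreover have "q a j \<in> V" using a by (auto simp: V_def)
        ultimately show "x \<in> {a + c | a c. a \<in> V \<and> c \<in> W j \<inter> Y}" by blast
      qed
    qed
  qed
  have "V \<noteq> {0}"
  proof
    assume "V = {0}"
    then have "q a j = 0" if "a \<in> U" for a using that by (auto simp: V_def)
    then have "f j ` U \<subseteq> {p 0}" by (auto simp: f_def)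
    then have "U \<subseteq> {0}" using im p0[OF op_subgroup_zero[OF XX]] op_subgroup_zero[OF Y] by auto
    then show False using ind op_subgroup_zero[OF U] by (auto simp: indec_def)
  qed
  then have WY: "W j \<inter> Y = {0}" using VW indW[OF j] unfolding indec_def by blast
  have "splits T X (W j) Y" unfolding splits_def
  proof (intro conjI W[OF j] Y WY)
    show "X = {a + c | a c. a \<in> W j \<and> c \<in> Y}"
    proof
      show "{a + c | a c. a \<in> W j \<and> c \<in> Y} \<subseteq> X"
        using WX[OF j] YX op_subgroup_add[OF XX] by blast
      show "X \<subseteq> {a + c | a c. a \<in> W j \<and> c \<in> Y}"
      proof
        fix x assume xX: "x \<in> X"
        then have "p x \<in> f j ` U" using im p(1) by simp
        then obtain a where a: "a \<in> U" "p x = p (q a j)" by (auto simp: f_def)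
        have qX: "q a j \<in> X" using qWj[OF a(1)] WX[OF j] by auto
        have "x - q a j \<in> Y" using p_diff[OF xX qX] a p0[OF op_subgroup_diff[OF XX xX qX]] by simp
        moreover have "x = q a j + (x - q a j)" by simp
        ultimately show "x \<in> {a + c | a c. a \<in> W j \<and> c \<in> Y}" using qWj[OF a(1)] by blast
      qed
    qed
  qed
  then show ?thesis using j by blast
qed

definition indec_decomposition :: "'e set set \<Rightarrow> 'e set \<Rightarrow> bool" where
  "indec_decomposition \<U> X \<longleftrightarrow> internal_sum T \<U> (\<lambda>U. U) X \<and> (\<forall>U\<in>\<U>. indec T U)"

text \<open>
  A further part would be contained in the sum of the parts in \<open>\<U>\<close>, which is already everything.
\<close>

lemma indec_decomposition_subset_eq:
  assumes U: "indec_decomposition \<U> X" and W: "indec_decomposition \<W> X" and sub: "\<U> \<subseteq> \<W>"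
  shows "\<U> = \<W>"
proof (rule ccontr)
  assume "\<U> \<noteq> \<W>"
  then obtain V where V: "V \<in> \<W>" "V \<notin> \<U>" using sub by auto
  have "internal_sum T (insert V (\<W> - {V})) (\<lambda>U. U) X"
    using W V by (simp add: indec_decomposition_def insert_absorb)
  then obtain Y where Y: "internal_sum T (\<W> - {V}) (\<lambda>U. U) Y" "splits T X V Y"
    using internal_sum_insert[of V "\<W> - {V}" "\<lambda>U. U" X] by auto
  have "X \<subseteq> Y"
  proof
    fix x assume "x \<in> X"
    then obtain u where u: "x = sum u \<U>" "\<forall>j\<in>\<U>. u j \<in> j"
      using U internal_sum_memE[of T \<U> "\<lambda>U. U" X x] by (auto simp: indec_decomposition_def)
    let ?w = "\<lambda>j. if j \<in> \<U> then u j else 0"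
    have "sum ?w (\<W> - {V}) = sum u \<U>"
      using internal_sum_finite[OF Y(1)] sub V by (intro sum.mono_neutral_cong_right) auto
    moreover have "\<forall>j\<in>\<W> - {V}. ?w j \<in> j"
      using u op_subgroup_zero[OF internal_sum_op_subgroup[OF Y(1)]] by auto
    ultimately show "x \<in> Y" using internal_sum_memI[OF Y(1), of ?w] u by simp
  qed
  then have "V \<subseteq> V \<inter> Y" using splits_subset[OF Y(2)] by auto
  then have "V = {0}" using Y(2) by (auto simp: splits_def)
  then show False using W V by (auto simp: indec_decomposition_def indec_def)
qed

text \<open>
  Each part of \<open>\<U>\<close> that is not in \<open>\<W>\<close> is exchanged for a part of \<open>\<W>\<close>.  The new part is not yet
  present, since it meets the sum of the remaining parts trivially; so the number of parts is kept and
  after finitely many steps \<open>\<U> \<subseteq> \<W>\<close>.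
\<close>

theorem krull_schmidt_card:
  assumes len: "finite_length T X" and "indec_decomposition \<U> X" and W: "indec_decomposition \<W> X"
  shows "card \<U> = card \<W>"
  using assms(2)
proof (induction "card (\<U> - \<W>)" arbitrary: \<U> rule: less_induct)
  case less
  have fin: "finite \<U>" using less.prems by (auto simp: indec_decomposition_def internal_sum_def)
  show ?case
  proof (cases "\<U> \<subseteq> \<W>")
    case True
    then show ?thesis using indec_decomposition_subset_eq[OF less.prems W] by simp
  next
    case False
    then obtain U where U: "U \<in> \<U>" "U \<notin> \<W>" by auto
    have "internal_sum T (insert U (\<U> - {U})) (\<lambda>U. U) X"
      using less.prems U by (simp add: indec_decomposition_def insert_absorb)
    then obtain Y where Y: "internal_sum T (\<U> - {U}) (\<lambda>U. U) Y" "splits T X U Y"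
      using internal_sum_insert[of U "\<U> - {U}" "\<lambda>U. U" X] by auto
    have "indec T U" using less.prems U by (auto simp: indec_decomposition_def)
    then obtain V where V: "V \<in> \<W>" "splits T X V Y"
      using exchange[OF len Y(2), of \<W> "\<lambda>U. U"] W by (auto simp: indec_decomposition_def)
    have "V \<notin> \<U> - {U}"
    proof
      assume a: "V \<in> \<U> - {U}"
      have "V \<subseteq> Y" using internal_sum_summand_subset[OF Y(1) a] .
      then have "V = {0}" using V(2) unfolding splits_def by (simp add: Int_absorb2)
      then show False using V W by (auto simp: indec_decomposition_def indec_def)
    qed
    let ?U = "insert V (\<U> - {U})"
    have "indec_decomposition ?U X"
      using internal_sum_insert[OF \<open>V \<notin> \<U> - {U}\<close>, of "\<lambda>U. U" X] Y V W less.prems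
      by (auto simp: indec_decomposition_def)
    moreover have "card (?U - \<W>) < card (\<U> - \<W>)"
      using fin U V by (intro psubset_card_mono) auto
    ultimately have "card ?U = card \<W>" using less.hyps by blast
    moreover have "card ?U = card \<U>"
      using fin U \<open>V \<notin> \<U> - {U}\<close> card_Suc_Diff1[OF fin U(1)] by simp
    ultimately show ?thesis by simp
  qed
qed

lemma internal_sum_empty: "internal_sum T {} W X \<longleftrightarrow> X = {0}"
  by (auto simp: internal_sum_def)

lemma indec_decomposition_exists:
  assumes "finite_length T X" "op_subgroup T X"
  shows "\<exists>\<U>. indec_decomposition \<U> X"
proof -
  obtain \<rho> :: "'e set \<Rightarrow> nat" where \<rho>: "\<And>V W. op_subgroup T V \<Longrightarrow> op_subgroup T W \<Longrightarrow> V \<subset> W \<Longrightarrow>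
     W \<subseteq> X \<Longrightarrow> \<rho> V < \<rho> W"
    using assms(1) unfolding finite_length_def by blast
  have "\<exists>\<U>. indec_decomposition \<U> Y" if "op_subgroup T Y" "Y \<subseteq> X" for Y
    using that
  proof (induction "\<rho> Y" arbitrary: Y rule: less_induct)
    case less
    show ?case
    proof (cases "Y = {0} \<or> indec T Y")
      case True
      then show ?thesis
      proof
        assume "Y = {0}"
        then show ?thesis by (intro exI[of _ "{}"]) (auto simp: indec_decomposition_def internal_sum_empty)
      next
        assume "indec T Y"
        moreover have "internal_sum T {Y} (\<lambda>U. U) Y"
          unfolding internal_sum_singleton using less.prems by simp
        ultimately show ?thesis by (intro exI[of _ "{Y}"]) (auto simp: indec_decomposition_def)
      qed
    next
      case False
      then obtain A C where AC: "splits T Y A C" "A \<noteq> {0}" "C \<noteq> {0}" by (auto simp: indec_def)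
      have A: "op_subgroup T A" and C: "op_subgroup T C" using AC by (auto simp: splits_def)
      have "A \<noteq> Y" "C \<noteq> Y" using AC splits_subset[OF AC(1)] by (auto simp: splits_def)
      then have "A \<subset> Y" "C \<subset> Y" using splits_subset[OF AC(1)] by auto
      then obtain \<U> \<W> where UW: "indec_decomposition \<U> A" "indec_decomposition \<W> C"
        using less.hyps[OF \<rho>[OF A less.prems(1)] A] less.hyps[OF \<rho>[OF C less.prems(1)] C] less.prems
        by blast
      have "\<U> \<inter> \<W> = {}"
      proof (rule ccontr)
        assume "\<U> \<inter> \<W> \<noteq> {}"
        then obtain V where V: "V \<in> \<U>" "V \<in> \<W>" by auto
        have "V \<subseteq> A" "V \<subseteq> C"
          using UW internal_sum_summand_subset V unfolding indec_decomposition_def by fast+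
        then have "V \<subseteq> {0}" using AC(1) by (auto simp: splits_def)
        moreover have "0 \<in> V" using UW(1) V by (auto simp: indec_decomposition_def internal_sum_def op_subgroup_zero)
        ultimately have "V = {0}" by auto
        then show False using UW(1) V by (auto simp: indec_decomposition_def indec_def)
      qed
      then have "internal_sum T (\<U> \<union> \<W>) (\<lambda>U. U) Y"
        using UW AC(1) by (intro internal_sum_Un) (auto simp: indec_decomposition_def internal_sum_def)
      then show ?thesis using UW by (intro exI[of _ "\<U> \<union> \<W>"]) (auto simp: indec_decomposition_def)
    qed
  qed
  then show ?thesis using assms(2) by blast
qed

end

section \<open>Coordinate spaces and their operators\<close>

text \<open>
  Functions supported on a finite set \<open>B\<close> play the role of the vector space with basis \<open>B\<close>.  All
  coordinate spaces thus share one type and are ordered by inclusion.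
\<close>

definition funs_on :: "'b set \<Rightarrow> ('b \<Rightarrow> 'k::field) set" where
  "funs_on B = {f. \<forall>b. b \<notin> B \<longrightarrow> f b = 0}"

definition scal :: "'k::field \<Rightarrow> ('b \<Rightarrow> 'k) \<Rightarrow> 'b \<Rightarrow> 'k" where
  "scal c f = (\<lambda>b. c * f b)"

text \<open>
  \<open>v\<close> assigns to a basis element the vertex at which it lies.
\<close>

definition proj :: "('b \<Rightarrow> 'v) \<Rightarrow> 'v \<Rightarrow> ('b \<Rightarrow> 'k::field) \<Rightarrow> 'b \<Rightarrow> 'k" where
  "proj v i f = (\<lambda>b. if v b = i then f b else 0)"

definition mat_op :: "'b set \<Rightarrow> ('b \<Rightarrow> 'b \<Rightarrow> 'k::field) \<Rightarrow> ('b \<Rightarrow> 'k) \<Rightarrow> 'b \<Rightarrow> 'k" where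
  "mat_op B A f = (\<lambda>b'. if b' \<in> B then \<Sum>b\<in>B. A b' b * f b else 0)"

definition rep_ops ::
  "('v, 'a) pre_digraph \<Rightarrow> 'b set \<Rightarrow> ('b \<Rightarrow> 'v) \<Rightarrow> ('a \<Rightarrow> 'b \<Rightarrow> 'b \<Rightarrow> 'k::field) \<Rightarrow>
   (('b \<Rightarrow> 'k) \<Rightarrow> 'b \<Rightarrow> 'k) set" where
  "rep_ops Q B v a = range scal \<union> proj v ` verts Q \<union> (\<lambda>\<alpha>. mat_op B (a \<alpha>)) ` arcs Q"

lemma funs_on_zero [simp]: "0 \<in> funs_on B"
  and funs_on_add: "f \<in> funs_on B \<Longrightarrow> g \<in> funs_on B \<Longrightarrow> f + g \<in> funs_on B"
  and funs_on_diff: "f \<in> funs_on B \<Longrightarrow> g \<in> funs_on B \<Longrightarrow> f - g \<in> funs_on B"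
  and funs_on_scal: "f \<in> funs_on B \<Longrightarrow> scal c f \<in> funs_on B"
  and funs_on_proj: "f \<in> funs_on B \<Longrightarrow> proj v i f \<in> funs_on {b \<in> B. v b = i}"
  and funs_on_mat_op: "mat_op B A f \<in> funs_on B"
  and funs_on_mono: "B \<subseteq> C \<Longrightarrow> funs_on B \<subseteq> funs_on C"
  by (auto simp: funs_on_def scal_def proj_def mat_op_def)

lemma scal_add: "scal c (f + g) = scal c f + scal c g"
  and scal_scal: "scal c (scal d f) = scal (c * d) f"
  and scal_one [simp]: "scal 1 f = f"
  and scal_add_left: "scal (c + d) f = scal c f + scal d f"
  and scal_zero [simp]: "scal c 0 = 0" "scal 0 f = 0"
  and scal_uminus: "scal (- 1) f = - f"
  by (auto simp: scal_def algebra_simps)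

lemma proj_add: "proj v i (f + g) = proj v i f + proj v i g"
  and proj_scal: "proj v i (scal c f) = scal c (proj v i f)"
  and proj_zero [simp]: "proj v i 0 = 0"
  and proj_diff: "proj v i (f - g) = proj v i f - proj v i g"
  and proj_proj: "proj v i (proj v j f) = (if i = j then proj v i f else 0)"
  by (auto simp: proj_def scal_def)

lemma proj_id: "f \<in> funs_on {b \<in> B. v b = i} \<Longrightarrow> proj v i f = f"
  and proj_other: "f \<in> funs_on {b \<in> B. v b = i} \<Longrightarrow> j \<noteq> i \<Longrightarrow> proj v j f = 0"
  by (auto simp: funs_on_def proj_def fun_eq_iff)

lemma sum_fun_apply: "(sum F J) b = (\<Sum>j\<in>J. F j (b :: 'b) :: 'k::field)"
  by (induction J rule: infinite_finite_induct) auto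

lemma proj_sum: "proj v i (sum F J) = (\<Sum>j\<in>J. proj v i (F j))"
  by (auto simp: proj_def fun_eq_iff sum_fun_apply)

lemma scal_sum: "scal c (sum F J) = (\<Sum>j\<in>J. scal c (F j))"
  by (auto simp: scal_def fun_eq_iff sum_fun_apply sum_distrib_left)

lemma mat_op_add: "mat_op B A (f + g) = mat_op B A f + mat_op B A g"
  by (auto simp: mat_op_def fun_eq_iff algebra_simps sum.distrib)

lemma mat_op_scal: "mat_op B A (scal c f) = scal c (mat_op B A f)"
  by (auto simp: mat_op_def scal_def fun_eq_iff algebra_simps sum_distrib_left)

lemma mat_op_zero [simp]: "mat_op B A 0 = 0"
  by (auto simp: mat_op_def fun_eq_iff)

lemma operators_rep_ops: "operators (rep_ops Q B v a)"
  by unfold_locales (auto simp: rep_ops_def scal_add proj_add mat_op_add)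

interpretation fun_vs: vector_space scal
  by unfold_locales (auto simp: scal_add scal_add_left scal_scal)

text \<open>
  The rank is the dimension; it is strictly monotone on subspaces of the span of a finite set.
\<close>

lemma finite_length_funs_on:
  fixes T :: "(('b \<Rightarrow> 'k::field) \<Rightarrow> 'b \<Rightarrow> 'k) set"
  assumes "range scal \<subseteq> T" "finite B"
  shows "finite_length T (funs_on B)"
  unfolding finite_length_def
proof (intro exI[of _ fun_vs.dim] allI impI, elim conjE)
  fix U W :: "('b \<Rightarrow> 'k) set"
  assume U: "op_subgroup T U" and W: "op_subgroup T W" and UW: "U \<subset> W" and WB: "W \<subseteq> funs_on B"
  have sub: "fun_vs.subspace S" if "op_subgroup T S" for S
    using that assms(1) op_subgroup_zero[OF that] op_subgroup_add[OF that] op_subgroup_op[OF that]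
    unfolding fun_vs.subspace_def by blast
  define D where "D = (\<lambda>b b'. if b' = b then 1 else 0 :: 'k) ` B"
  have "funs_on B \<subseteq> fun_vs.span D"
  proof
    fix f :: "'b \<Rightarrow> 'k" assume f: "f \<in> funs_on B"
    have "f = (\<Sum>b\<in>B. scal (f b) (\<lambda>b'. if b' = b then 1 else 0))"
    proof
      fix b'
      have "(\<Sum>b\<in>B. scal (f b) (\<lambda>b'. if b' = b then 1 else 0)) b' = (\<Sum>b\<in>B. if b' = b then f b else 0)"
        unfolding sum_fun_apply by (intro sum.cong) (auto simp: scal_def)
      then show "f b' = (\<Sum>b\<in>B. scal (f b) (\<lambda>b'. if b' = b then 1 else 0)) b'"
        using f assms(2) by (auto simp: funs_on_def)
    qed
    also have "\<dots> \<in> fun_vs.span D"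
      by (intro fun_vs.span_sum fun_vs.span_scale fun_vs.span_base) (auto simp: D_def)
    finally show "f \<in> fun_vs.span D" .
  qed
  obtain b where b: "b \<subseteq> U" "fun_vs.independent b" "U \<subseteq> fun_vs.span b" "card b = fun_vs.dim U"
    using fun_vs.basis_exists by blast
  obtain c where c: "c \<subseteq> W" "fun_vs.independent c" "W \<subseteq> fun_vs.span c" "card c = fun_vs.dim W"
    using fun_vs.basis_exists by blast
  have fin: "finite c"
    using fun_vs.independent_span_bound[of D c] c WB \<open>funs_on B \<subseteq> fun_vs.span D\<close> assms(2)
    by (auto simp: D_def)
  obtain w where w: "w \<in> W" "w \<notin> U" using UW by auto
  have "fun_vs.span b \<subseteq> U" using fun_vs.span_minimal[OF b(1) sub[OF U]] .
  then have "w \<notin> fun_vs.span b" using w by auto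
  then have ind: "fun_vs.independent (insert w b)" using b(2) by (rule fun_vs.independent_insertI)
  then have "finite (insert w b) \<and> card (insert w b) \<le> card c"
    using fun_vs.independent_span_bound[OF fin ind] b(1) c(3) w(1) UW by auto
  moreover have "w \<notin> b" using b(1) w by auto
  ultimately show "fun_vs.dim U < fun_vs.dim W" using b c by auto
qed

lemma subspace_iff:
  assumes "vectorspace (class_ring :: 'k::field ring) X"
  shows "VectorSpace.subspace class_ring U X \<longleftrightarrow> U \<subseteq> carrier X \<and> \<zero>\<^bsub>X\<^esub> \<in> U \<and>
    (\<forall>x\<in>U. \<forall>y\<in>U. x \<oplus>\<^bsub>X\<^esub> y \<in> U) \<and> (\<forall>c. \<forall>x\<in>U. c \<odot>\<^bsub>X\<^esub> x \<in> U)"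
  using assms
  by (auto simp: VectorSpace.subspace_def submodule_def vectorspace_def)

section \<open>Subrepresentations as subgroups with operators\<close>

text \<open>
  A representation \<open>V\<close> whose spaces are embedded by \<open>\<phi>\<close> into coordinate spaces, compatibly with the
  arrows.  The embeddings need not be onto, so that a subrepresentation is again an instance with the
  same \<open>\<phi>\<close>; this is what makes the indecomposability of summands accessible.
\<close>

locale embedded_rep =
  fixes Q :: "('v, 'a) pre_digraph"
    and V :: "('k::field, 'x, 'v, 'a) rep"
    and B :: "'b set" and v :: "'b \<Rightarrow> 'v" and a :: "'a \<Rightarrow> 'b \<Rightarrow> 'b \<Rightarrow> 'k"
    and \<phi> :: "'v \<Rightarrow> 'x \<Rightarrow> 'b \<Rightarrow> 'k"
  assumes wf: "wf_digraph Q"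
    and rep: "is_rep Q V"
    and finB: "finite B" and vB: "v ` B \<subseteq> verts Q"
    and inj: "i \<in> verts Q \<Longrightarrow> inj_on (\<phi> i) (carrier (space V i))"
    and into: "i \<in> verts Q \<Longrightarrow> x \<in> carrier (space V i) \<Longrightarrow> \<phi> i x \<in> funs_on {b \<in> B. v b = i}"
    and hom_add: "i \<in> verts Q \<Longrightarrow> x \<in> carrier (space V i) \<Longrightarrow> y \<in> carrier (space V i) \<Longrightarrow>
      \<phi> i (x \<oplus>\<^bsub>space V i\<^esub> y) = \<phi> i x + \<phi> i y"
    and hom_smult: "i \<in> verts Q \<Longrightarrow> x \<in> carrier (space V i) \<Longrightarrow>
      \<phi> i (c \<odot>\<^bsub>space V i\<^esub> x) = scal c (\<phi> i x)"
    and hom_mor: "\<alpha> \<in> arcs Q \<Longrightarrow> x \<in> carrier (space V (tail Q \<alpha>)) \<Longrightarrow>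
      \<phi> (head Q \<alpha>) (mor V \<alpha> x) = mat_op B (a \<alpha>) (\<phi> (tail Q \<alpha>) x)"
    and mat_supp: "\<alpha> \<in> arcs Q \<Longrightarrow> b \<in> B \<Longrightarrow> b' \<in> B \<Longrightarrow> a \<alpha> b' b \<noteq> 0 \<Longrightarrow>
      v b = tail Q \<alpha> \<and> v b' = head Q \<alpha>"
begin

abbreviation T where "T \<equiv> rep_ops Q B v a"

sublocale operators T by (rule operators_rep_ops)

text \<open>
  The sum of the images of the \<open>U\<^sub>i\<close>, as a subspace of the functions on \<open>B\<close>; it corresponds to the
  submodule of the module that is identified with the representation.
\<close>

definition total_funs :: "('v \<Rightarrow> 'x set) \<Rightarrow> ('b \<Rightarrow> 'k) set" where
  "total_funs U = {f \<in> funs_on B. \<forall>i\<in>verts Q. proj v i f \<in> \<phi> i ` U i}"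

definition components :: "('b \<Rightarrow> 'k) set \<Rightarrow> 'v \<Rightarrow> 'x set" where
  "components S i = {x \<in> carrier (space V i). \<phi> i x \<in> S}"

abbreviation whole :: "'v \<Rightarrow> 'x set" where "whole \<equiv> \<lambda>i. carrier (space V i)"

lemma vs: "i \<in> verts Q \<Longrightarrow> vectorspace class_ring (space V i)"
  using rep by (auto simp: is_rep_def)

lemma ends: "\<alpha> \<in> arcs Q \<Longrightarrow> tail Q \<alpha> \<in> verts Q" "\<alpha> \<in> arcs Q \<Longrightarrow> head Q \<alpha> \<in> verts Q"
  using wf by (auto simp: wf_digraph_def)

lemma mor_closed: "\<alpha> \<in> arcs Q \<Longrightarrow> x \<in> whole (tail Q \<alpha>) \<Longrightarrow> mor V \<alpha> x \<in> whole (head Q \<alpha>)"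
  using rep by (auto simp: is_rep_def linear_map_def mod_hom_def mod_hom_axioms_def LinearCombinations.module_hom_def)

lemma closed:
  assumes "i \<in> verts Q"
  shows "\<zero>\<^bsub>space V i\<^esub> \<in> whole i"
    and "x \<in> whole i \<Longrightarrow> y \<in> whole i \<Longrightarrow> x \<oplus>\<^bsub>space V i\<^esub> y \<in> whole i"
    and "x \<in> whole i \<Longrightarrow> c \<odot>\<^bsub>space V i\<^esub> x \<in> whole i"
proof -
  interpret X: vectorspace class_ring "space V i" by (rule vs[OF assms])
  show "\<zero>\<^bsub>space V i\<^esub> \<in> whole i" "x \<in> whole i \<Longrightarrow> y \<in> whole i \<Longrightarrow> x \<oplus>\<^bsub>space V i\<^esub> y \<in> whole i"
    "x \<in> whole i \<Longrightarrow> c \<odot>\<^bsub>space V i\<^esub> x \<in> whole i" by simp_all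
qed

lemma hom_zero: "i \<in> verts Q \<Longrightarrow> \<phi> i \<zero>\<^bsub>space V i\<^esub> = 0"
proof -
  assume i: "i \<in> verts Q"
  interpret X: vectorspace class_ring "space V i" by (rule vs[OF i])
  have "\<phi> i (\<zero>\<^bsub>space V i\<^esub> \<oplus>\<^bsub>space V i\<^esub> \<zero>\<^bsub>space V i\<^esub>) = \<phi> i \<zero>\<^bsub>space V i\<^esub> + \<phi> i \<zero>\<^bsub>space V i\<^esub>"
    by (rule hom_add[OF i]) simp_all
  then show ?thesis by simp
qed

lemma hom_finsum:
  assumes "i \<in> verts Q" "finite J" "\<forall>j\<in>J. u j \<in> whole i"
  shows "finsum (space V i) u J \<in> whole i" "\<phi> i (finsum (space V i) u J) = (\<Sum>j\<in>J. \<phi> i (u j))"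
proof -
  interpret X: vectorspace class_ring "space V i" by (rule vs[OF assms(1)])
  show "finsum (space V i) u J \<in> whole i" using assms(3) by (intro X.finsum_closed) auto
  show "\<phi> i (finsum (space V i) u J) = (\<Sum>j\<in>J. \<phi> i (u j))"
    using assms(2,3)
  proof (induction J rule: finite_induct)
    case empty
    then show ?case by (simp add: hom_zero[OF assms(1)])
  next
    case (insert j J)
    then have "finsum (space V i) u (insert j J) = u j \<oplus>\<^bsub>space V i\<^esub> finsum (space V i) u J"
      by (intro X.finsum_insert) auto
    moreover have "finsum (space V i) u J \<in> whole i" using insert by (intro X.finsum_closed) auto
    ultimately show ?case using insert hom_add[OF assms(1)] by simp
  qed
qed

lemma subrep_iff:
  "subrep Q U V \<longleftrightarrow> (\<forall>i\<in>verts Q. U i \<subseteq> whole i \<and> \<zero>\<^bsub>space V i\<^esub> \<in> U i \<and>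
    (\<forall>x\<in>U i. \<forall>y\<in>U i. x \<oplus>\<^bsub>space V i\<^esub> y \<in> U i) \<and> (\<forall>c. \<forall>x\<in>U i. c \<odot>\<^bsub>space V i\<^esub> x \<in> U i)) \<and>
    (\<forall>\<alpha>\<in>arcs Q. \<forall>x\<in>U (tail Q \<alpha>). mor V \<alpha> x \<in> U (head Q \<alpha>))"
  unfolding subrep_def using subspace_iff[OF vs] by (auto simp: image_subset_iff)

lemma subrep_whole: "subrep Q whole V"
  unfolding subrep_iff using closed mor_closed by auto

lemma funs_on_eqI:
  assumes "f \<in> funs_on B" "g \<in> funs_on B" "\<And>i. i \<in> verts Q \<Longrightarrow> proj v i f = proj v i g"
  shows "f = g"
proof
  fix b
  show "f b = g b"
  proof (cases "b \<in> B")
    case True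
    then have "proj v (v b) f b = proj v (v b) g b" using assms(3) vB by (metis image_subset_iff)
    then show ?thesis by (simp add: proj_def)
  qed (use assms in \<open>auto simp: funs_on_def\<close>)
qed

lemma subrep_minus:
  assumes "subrep Q U V" "i \<in> verts Q" "f \<in> \<phi> i ` U i" "g \<in> \<phi> i ` U i"
  shows "f - g \<in> \<phi> i ` U i"
proof -
  obtain x y where xy: "x \<in> U i" "y \<in> U i" "f = \<phi> i x" "g = \<phi> i y" using assms by blast
  let ?y = "(- 1) \<odot>\<^bsub>space V i\<^esub> y"
  have m: "x \<in> whole i" "y \<in> whole i" "?y \<in> whole i" "x \<oplus>\<^bsub>space V i\<^esub> ?y \<in> U i"
    using assms xy unfolding subrep_iff by blast+
  have "\<phi> i (x \<oplus>\<^bsub>space V i\<^esub> ?y) = f - g"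
    using hom_add[OF assms(2) m(1,3)] hom_smult[OF assms(2) m(2)] xy by (simp add: scal_uminus)
  then show ?thesis using m(4) by (metis imageI)
qed

lemma mat_zero: "\<alpha> \<in> arcs Q \<Longrightarrow> b \<in> B \<Longrightarrow> b' \<in> B \<Longrightarrow> v b \<noteq> tail Q \<alpha> \<Longrightarrow> a \<alpha> b' b = 0"
  "\<alpha> \<in> arcs Q \<Longrightarrow> b \<in> B \<Longrightarrow> b' \<in> B \<Longrightarrow> v b' \<noteq> head Q \<alpha> \<Longrightarrow> a \<alpha> b' b = 0"
  using mat_supp by blast+

text \<open>
  An arrow sees only the part of a function at its tail and has values only at its head.
\<close>

lemma mat_op_proj:
  assumes "\<alpha> \<in> arcs Q"
  shows "mat_op B (a \<alpha>) (proj v (tail Q \<alpha>) f) = mat_op B (a \<alpha>) f"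
proof
  fix b'
  show "mat_op B (a \<alpha>) (proj v (tail Q \<alpha>) f) b' = mat_op B (a \<alpha>) f b'"
    unfolding mat_op_def proj_def by (auto intro!: sum.cong simp: mat_zero[OF assms])
qed

lemma proj_mat_op:
  assumes "\<alpha> \<in> arcs Q"
  shows "proj v i (mat_op B (a \<alpha>) f) = (if i = head Q \<alpha> then mat_op B (a \<alpha>) f else 0)"
proof
  fix b'
  show "proj v i (mat_op B (a \<alpha>) f) b' = (if i = head Q \<alpha> then mat_op B (a \<alpha>) f else 0) b'"
    unfolding mat_op_def proj_def by (auto intro!: sum.neutral simp: mat_zero[OF assms])
qed

lemma op_subgroup_total_funs:
  assumes U: "subrep Q U V"
  shows "op_subgroup T (total_funs U)"
proof -
  have z: "0 \<in> \<phi> i ` U i" if "i \<in> verts Q" for i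
    using U that hom_zero[OF that] unfolding subrep_iff by (metis imageI)
  have sc: "scal c f \<in> \<phi> i ` U i" if i: "i \<in> verts Q" and f: "f \<in> \<phi> i ` U i" for i f c
  proof -
    obtain x where x: "x \<in> U i" "f = \<phi> i x" using f by blast
    then have "c \<odot>\<^bsub>space V i\<^esub> x \<in> U i" "x \<in> whole i" using U i unfolding subrep_iff by blast+
    then show ?thesis using hom_smult[OF i, of x c] x by (metis imageI)
  qed
  have mo: "mat_op B (a \<alpha>) f \<in> total_funs U" if \<alpha>: "\<alpha> \<in> arcs Q" and f: "f \<in> total_funs U" for \<alpha> f
  proof -
    have "proj v (tail Q \<alpha>) f \<in> \<phi> (tail Q \<alpha>) ` U (tail Q \<alpha>)" using f ends[OF \<alpha>] by (auto simp: total_funs_def)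
    then obtain x where x: "x \<in> U (tail Q \<alpha>)" "proj v (tail Q \<alpha>) f = \<phi> (tail Q \<alpha>) x" by auto
    have "x \<in> whole (tail Q \<alpha>)" using x U ends[OF \<alpha>] unfolding subrep_iff by blast
    then have "mat_op B (a \<alpha>) f = \<phi> (head Q \<alpha>) (mor V \<alpha> x)"
      using hom_mor[OF \<alpha>] mat_op_proj[OF \<alpha>, of f] x(2) by simp
    moreover have "mor V \<alpha> x \<in> U (head Q \<alpha>)" using U \<alpha> x unfolding subrep_iff by blast
    ultimately have "mat_op B (a \<alpha>) f \<in> \<phi> (head Q \<alpha>) ` U (head Q \<alpha>)" by simp
    then show ?thesis using z by (auto simp: total_funs_def funs_on_mat_op proj_mat_op[OF \<alpha>])
  qed
  show ?thesis unfolding op_subgroup_def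
  proof (intro conjI ballI)
    show "0 \<in> total_funs U" using z by (auto simp: total_funs_def)
  next
    fix f g assume "f \<in> total_funs U" "g \<in> total_funs U"
    then show "f - g \<in> total_funs U" using subrep_minus[OF U] by (auto simp: total_funs_def funs_on_diff proj_diff)
  next
    fix t f assume t: "t \<in> T" and f: "f \<in> total_funs U"
    then consider c where "t = scal c" | i where "i \<in> verts Q" "t = proj v i" |
      \<alpha> where "\<alpha> \<in> arcs Q" "t = mat_op B (a \<alpha>)" by (auto simp: rep_ops_def)
    then show "t f \<in> total_funs U"
    proof cases
      case 1
      then show ?thesis using f sc by (auto simp: total_funs_def funs_on_scal proj_scal)
    next
      case 2
      have "funs_on {b \<in> B. v b = i} \<subseteq> funs_on B" by (rule funs_on_mono) auto
      then show ?thesis using 2 f z funs_on_proj[of f B v i] by (auto simp: total_funs_def proj_proj)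
    next
      case 3
      then show ?thesis using mo f by simp
    qed
  qed
qed

lemma total_funs_mono: "(\<And>i. i \<in> verts Q \<Longrightarrow> U i \<subseteq> W i) \<Longrightarrow> total_funs U \<subseteq> total_funs W"
  unfolding total_funs_def by blast

lemma phi_in_total_funs:
  assumes U: "subrep Q U V" and i: "i \<in> verts Q" and x: "x \<in> whole i"
  shows "\<phi> i x \<in> total_funs U \<longleftrightarrow> x \<in> U i"
proof
  assume "\<phi> i x \<in> total_funs U"
  then have "proj v i (\<phi> i x) \<in> \<phi> i ` U i" using i by (auto simp: total_funs_def)
  then have "\<phi> i x \<in> \<phi> i ` U i" using proj_id[OF into[OF i x]] by simp
  then obtain y where "y \<in> U i" "\<phi> i x = \<phi> i y" by auto
  moreover from this have "y \<in> whole i" using U i unfolding subrep_iff by blast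
  ultimately show "x \<in> U i" using inj[OF i] x by (metis inj_onD)
next
  assume xU: "x \<in> U i"
  have "funs_on {b \<in> B. v b = i} \<subseteq> funs_on B" by (rule funs_on_mono) auto
  then have "\<phi> i x \<in> funs_on B" using into[OF i x] by auto
  moreover have "proj v j (\<phi> i x) \<in> \<phi> j ` U j" if j: "j \<in> verts Q" for j
  proof (cases "j = i")
    case True
    then show ?thesis using xU proj_id[OF into[OF i x]] by auto
  next
    case False
    then show ?thesis using proj_other[OF into[OF i x]] hom_zero[OF j] U j
      unfolding subrep_iff by (metis imageI)
  qed
  ultimately show "\<phi> i x \<in> total_funs U" by (auto simp: total_funs_def)
qed

lemma subrep_components:
  assumes S: "op_subgroup T S"
  shows "subrep Q (components S) V"
proof -
  have "scal c f \<in> S" if "f \<in> S" for c f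
    using op_subgroup_op[OF S _ that, of "scal c"] by (auto simp: rep_ops_def)
  moreover have "mat_op B (a \<alpha>) f \<in> S" if "f \<in> S" "\<alpha> \<in> arcs Q" for \<alpha> f
    using op_subgroup_op[OF S _ that(1), of "mat_op B (a \<alpha>)"] that(2) by (auto simp: rep_ops_def)
  ultimately show ?thesis unfolding subrep_iff components_def
    using op_subgroup_zero[OF S] op_subgroup_add[OF S]
    by (auto simp: closed hom_zero hom_add hom_smult hom_mor mor_closed ends)
qed

text \<open>
  A subgroup that is closed under the projections to the vertices is the sum of its parts at the
  vertices, so it comes from a family of subspaces.
\<close>

lemma total_funs_components:
  assumes S: "op_subgroup T S" and sub: "S \<subseteq> total_funs whole"
  shows "total_funs (components S) = S"
proof
  have pr: "proj v i f \<in> S" if "f \<in> S" "i \<in> verts Q" for i f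
    using op_subgroup_op[OF S _ that(1), of "proj v i"] that(2) by (auto simp: rep_ops_def)
  show "S \<subseteq> total_funs (components S)"
  proof
    fix f assume f: "f \<in> S"
    have "proj v i f \<in> \<phi> i ` components S i" if i: "i \<in> verts Q" for i
    proof -
      obtain x where "x \<in> whole i" "proj v i f = \<phi> i x" using f sub i by (auto simp: total_funs_def)
      then show ?thesis using pr[OF f i] by (auto simp: components_def)
    qed
    then show "f \<in> total_funs (components S)" using f sub by (auto simp: total_funs_def)
  qed
  show "total_funs (components S) \<subseteq> S"
  proof
    fix f assume f: "f \<in> total_funs (components S)"
    then have fB: "f \<in> funs_on B" by (auto simp: total_funs_def)
    have "f = (\<Sum>i\<in>v ` B. proj v i f)"
    proof
      fix b
      have "(\<Sum>i\<in>v ` B. proj v i f) b = (\<Sum>i\<in>v ` B. if v b = i then f b else 0)"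
        by (simp add: sum_fun_apply proj_def)
      also have "\<dots> = f b" using finB fB by (auto simp: funs_on_def)
      finally show "f b = (\<Sum>i\<in>v ` B. proj v i f) b" by simp
    qed
    moreover have "(\<Sum>i\<in>v ` B. proj v i f) \<in> S"
    proof (rule op_subgroup_sum[OF S])
      fix i assume "i \<in> v ` B"
      then have "proj v i f \<in> \<phi> i ` components S i" using f vB by (auto simp: total_funs_def)
      then show "proj v i f \<in> S" by (auto simp: components_def)
    qed
    ultimately show "f \<in> S" by simp
  qed
qed

lemma total_funs_zero:
  assumes U: "subrep Q U V"
  shows "total_funs U = {0} \<longleftrightarrow> (\<forall>i\<in>verts Q. U i = {\<zero>\<^bsub>space V i\<^esub>})"
proof
  assume t: "total_funs U = {0}"
  show "\<forall>i\<in>verts Q. U i = {\<zero>\<^bsub>space V i\<^esub>}"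
  proof
    fix i assume i: "i \<in> verts Q"
    have "U i \<subseteq> {\<zero>\<^bsub>space V i\<^esub>}"
    proof
      fix x assume x: "x \<in> U i"
      have xw: "x \<in> whole i" using U i x unfolding subrep_iff by blast
      have "\<phi> i x \<in> {0}" using phi_in_total_funs[OF U i xw] x unfolding t by (rule iffD2)
      then have "\<phi> i x = \<phi> i \<zero>\<^bsub>space V i\<^esub>" using hom_zero[OF i] by simp
      then have "x = \<zero>\<^bsub>space V i\<^esub>" by (rule inj_onD[OF inj[OF i] _ xw closed(1)[OF i]])
      then show "x \<in> {\<zero>\<^bsub>space V i\<^esub>}" by simp
    qed
    moreover have "\<zero>\<^bsub>space V i\<^esub> \<in> U i" using U i unfolding subrep_iff by blast
    ultimately show "U i = {\<zero>\<^bsub>space V i\<^esub>}" by blast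
  qed
next
  assume z: "\<forall>i\<in>verts Q. U i = {\<zero>\<^bsub>space V i\<^esub>}"
  have "f = 0" if f: "f \<in> total_funs U" for f
  proof (rule funs_on_eqI)
    show "f \<in> funs_on B" using f unfolding total_funs_def by blast
    fix i assume i: "i \<in> verts Q"
    then have "proj v i f \<in> \<phi> i ` U i" using f unfolding total_funs_def by blast
    moreover have "U i = {\<zero>\<^bsub>space V i\<^esub>}" using z i by (rule bspec)
    ultimately show "proj v i f = proj v i 0" using hom_zero[OF i] by simp
  qed simp
  then show "total_funs U = {0}" using op_subgroup_zero[OF op_subgroup_total_funs[OF U]] by blast
qed

end

context embedded_rep begin

text \<open>
  A decomposition at every vertex is the same as a decomposition of the sum over all vertices: families
  of summands at the vertices are assembled to one function, and a function is taken apart by the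
  projections.
\<close>

lemma is_direct_sum_iff:
  "is_direct_sum Q V m U \<longleftrightarrow>
   (\<forall>j<m. subrep Q (U j) V) \<and> internal_sum T {..<m} (\<lambda>j. total_funs (U j)) (total_funs whole)"
proof (cases "\<forall>j<m. subrep Q (U j) V")
  case False
  then show ?thesis by (auto simp: is_direct_sum_def)
next
  case True
  then have sub: "\<And>j. j < m \<Longrightarrow> subrep Q (U j) V" by blast
  have UW: "x \<in> whole i" if "j < m" "i \<in> verts Q" "x \<in> U j i" for i j x
    using sub[OF that(1)] that unfolding subrep_iff by blast
  let ?E = "\<forall>i\<in>verts Q. \<forall>x\<in>whole i. \<exists>!u. u \<in> (\<Pi>\<^sub>E j\<in>{..<m}. U j i) \<and> finsum (space V i) u {..<m} = x"
  have "?E \<longleftrightarrow> internal_sum T {..<m} (\<lambda>j. total_funs (U j)) (total_funs whole)"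
  proof
    assume E: ?E
    show "internal_sum T {..<m} (\<lambda>j. total_funs (U j)) (total_funs whole)" unfolding internal_sum_def
    proof (intro conjI allI impI)
      show "\<forall>j\<in>{..<m}. op_subgroup T (total_funs (U j))" using op_subgroup_total_funs[OF sub] by simp
      show "total_funs whole = {sum w {..<m} | w. \<forall>j\<in>{..<m}. w j \<in> total_funs (U j)}"
      proof
        show "{sum w {..<m} | w. \<forall>j\<in>{..<m}. w j \<in> total_funs (U j)} \<subseteq> total_funs whole"
        proof
          fix f assume "f \<in> {sum w {..<m} | w. \<forall>j\<in>{..<m}. w j \<in> total_funs (U j)}"
          then obtain w where w: "f = sum w {..<m}" "\<forall>j\<in>{..<m}. w j \<in> total_funs (U j)" by blast
          have "w j \<in> total_funs whole" if "j \<in> {..<m}" for j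
            using w(2) that total_funs_mono[of "U j" whole] UW[of j] by blast
          then show "f \<in> total_funs whole"
            unfolding w(1) by (rule op_subgroup_sum[OF op_subgroup_total_funs[OF subrep_whole]])
        qed
        show "total_funs whole \<subseteq> {sum w {..<m} | w. \<forall>j\<in>{..<m}. w j \<in> total_funs (U j)}"
        proof
          fix f assume f: "f \<in> total_funs whole"
          have "\<forall>i\<in>verts Q. \<exists>u. (\<forall>j<m. u j \<in> U j i) \<and> proj v i f = (\<Sum>j<m. \<phi> i (u j))"
          proof
            fix i assume i: "i \<in> verts Q"
            then obtain x where x: "x \<in> whole i" "proj v i f = \<phi> i x" using f by (auto simp: total_funs_def)
            then obtain u where u: "u \<in> (\<Pi>\<^sub>E j\<in>{..<m}. U j i)" "finsum (space V i) u {..<m} = x"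
              using E i by blast
            have "\<forall>j<m. u j \<in> U j i" using u(1) by auto
            then show "\<exists>u. (\<forall>j<m. u j \<in> U j i) \<and> proj v i f = (\<Sum>j<m. \<phi> i (u j))"
              using x u(2) hom_finsum(2)[OF i, of "{..<m}" u] UW[OF _ i] by (intro exI[of _ u]) auto
          qed
          then obtain u where u: "\<And>i j. i \<in> verts Q \<Longrightarrow> j < m \<Longrightarrow> u i j \<in> U j i"
            "\<And>i. i \<in> verts Q \<Longrightarrow> proj v i f = (\<Sum>j<m. \<phi> i (u i j))" by metis
          \<comment> \<open>The parts chosen at the single vertices are assembled to one function.\<close>
          define w where "w j = (\<lambda>b. if b \<in> B then \<phi> (v b) (u (v b) j) b else 0)" for j
          have pw: "proj v i (w j) = \<phi> i (u i j)" if "j < m" "i \<in> verts Q" for i j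
          proof -
            have "\<phi> i (u i j) \<in> funs_on {b \<in> B. v b = i}" using into UW u(1) that by blast
            then show ?thesis by (auto simp: proj_def w_def funs_on_def fun_eq_iff)
          qed
          have "w j \<in> total_funs (U j)" if "j < m" for j
            using pw[OF that] u(1)[OF _ that] by (auto simp: total_funs_def funs_on_def w_def)
          moreover have "f = sum w {..<m}"
          proof (rule funs_on_eqI)
            show "f \<in> funs_on B" using f by (auto simp: total_funs_def)
            show "sum w {..<m} \<in> funs_on B" by (auto simp: funs_on_def sum_fun_apply w_def)
            show "proj v i f = proj v i (sum w {..<m})" if i: "i \<in> verts Q" for i
              unfolding proj_sum using pw[OF _ i] u(2)[OF i] by simp
          qed
          ultimately show "f \<in> {sum w {..<m} | w. \<forall>j\<in>{..<m}. w j \<in> total_funs (U j)}" by blast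
        qed
      qed
      fix w assume w: "(\<forall>j\<in>{..<m}. w j \<in> total_funs (U j)) \<and> sum w {..<m} = 0"
      show "\<forall>j\<in>{..<m}. w j = 0"
      proof
        fix j assume j: "j \<in> {..<m}"
        have "proj v i (w j) = 0" if i: "i \<in> verts Q" for i
        proof -
          have "\<forall>j\<in>{..<m}. \<exists>x. x \<in> U j i \<and> proj v i (w j) = \<phi> i x"
            using w i by (auto simp: total_funs_def)
          then obtain u where u: "\<And>j. j \<in> {..<m} \<Longrightarrow> u j \<in> U j i" "\<And>j. j \<in> {..<m} \<Longrightarrow> proj v i (w j) = \<phi> i (u j)"
            by metis
          define u' where "u' = restrict u {..<m}"
          have u': "u' \<in> (\<Pi>\<^sub>E j\<in>{..<m}. U j i)" using u(1) by (auto simp: u'_def)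
          have "\<phi> i (finsum (space V i) u' {..<m}) = (\<Sum>j<m. \<phi> i (u' j))"
            using UW[OF _ i] u(1) by (intro hom_finsum(2)[OF i]) (auto simp: u'_def)
          also have "\<dots> = (\<Sum>j<m. proj v i (w j))" using u(2) by (simp add: u'_def)
          also have "\<dots> = 0" using w by (simp flip: proj_sum)
          finally have s: "\<phi> i (finsum (space V i) u' {..<m}) = 0" .
          have "finsum (space V i) u' {..<m} \<in> whole i"
            using UW[OF _ i] u(1) by (intro hom_finsum(1)[OF i]) (auto simp: u'_def)
          then have s': "finsum (space V i) u' {..<m} = \<zero>\<^bsub>space V i\<^esub>"
            using s hom_zero[OF i] inj[OF i] closed(1)[OF i] by (metis inj_onD)
          \<comment> \<open>The zero family is another decomposition of the zero vector.\<close>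
          define z where "z = (\<lambda>j\<in>{..<m}. \<zero>\<^bsub>space V i\<^esub>)"
          have z: "z \<in> (\<Pi>\<^sub>E j\<in>{..<m}. U j i)"
            using sub i unfolding z_def subrep_iff by auto
          have z0: "\<forall>j\<in>{..<m}. z j \<in> whole i" using closed(1)[OF i] by (simp add: z_def)
          note zw = hom_finsum(1)[OF i finite_lessThan z0]
          have "\<phi> i (finsum (space V i) z {..<m}) = (\<Sum>j<m. \<phi> i (z j))"
            by (rule hom_finsum(2)[OF i finite_lessThan z0])
          then have "\<phi> i (finsum (space V i) z {..<m}) = 0" by (simp add: z_def hom_zero[OF i])
          then have "finsum (space V i) z {..<m} = \<zero>\<^bsub>space V i\<^esub>"
            using zw hom_zero[OF i] inj[OF i] closed(1)[OF i] by (metis inj_onD)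
          then have "u' = z" using E i closed(1)[OF i] u' s' z by blast
          then have "u j = \<zero>\<^bsub>space V i\<^esub>" using j by (metis restrict_apply' u'_def z_def)
          then show ?thesis using u(2)[OF j] hom_zero[OF i] by simp
        qed
        moreover have "w j \<in> funs_on B" using w j by (auto simp: total_funs_def)
        ultimately show "w j = 0" by (rule_tac funs_on_eqI) simp_all
      qed
    qed simp
  next
    assume D: "internal_sum T {..<m} (\<lambda>j. total_funs (U j)) (total_funs whole)"
    show ?E
    proof (intro ballI)
      fix i x assume i: "i \<in> verts Q" and x: "x \<in> whole i"
      have "\<phi> i x \<in> total_funs whole" using phi_in_total_funs[OF subrep_whole i x] x by simp
      then obtain w where w: "\<phi> i x = sum w {..<m}" "\<forall>j\<in>{..<m}. w j \<in> total_funs (U j)"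
        by (rule internal_sum_memE[OF D])
      have "\<forall>j\<in>{..<m}. \<exists>y. y \<in> U j i \<and> proj v i (w j) = \<phi> i y"
        using w i by (auto simp: total_funs_def)
      then obtain u where u: "\<And>j. j \<in> {..<m} \<Longrightarrow> u j \<in> U j i" "\<And>j. j \<in> {..<m} \<Longrightarrow> proj v i (w j) = \<phi> i (u j)"
        by metis
      define u' where "u' = restrict u {..<m}"
      have u': "u' \<in> (\<Pi>\<^sub>E j\<in>{..<m}. U j i)" using u(1) by (auto simp: u'_def)
      have "\<phi> i (finsum (space V i) u' {..<m}) = (\<Sum>j<m. \<phi> i (u' j))"
        using UW[OF _ i] u(1) by (intro hom_finsum(2)[OF i]) (auto simp: u'_def)
      also have "\<dots> = (\<Sum>j<m. proj v i (w j))" using u(2) by (simp add: u'_def)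
      also have "\<dots> = proj v i (\<phi> i x)" by (simp add: w(1) proj_sum)
      also have "\<dots> = \<phi> i x" by (rule proj_id[OF into[OF i x]])
      finally have s: "\<phi> i (finsum (space V i) u' {..<m}) = \<phi> i x" .
      have "finsum (space V i) u' {..<m} \<in> whole i"
        using UW[OF _ i] u(1) by (intro hom_finsum(1)[OF i]) (auto simp: u'_def)
      then have fx: "finsum (space V i) u' {..<m} = x" using s inj[OF i] x by (metis inj_onD)
      show "\<exists>!u. u \<in> (\<Pi>\<^sub>E j\<in>{..<m}. U j i) \<and> finsum (space V i) u {..<m} = x"
      proof (rule ex1I[of _ u'])
        show "u' \<in> (\<Pi>\<^sub>E j\<in>{..<m}. U j i) \<and> finsum (space V i) u' {..<m} = x" using u' fx by simp
        fix y assume y: "y \<in> (\<Pi>\<^sub>E j\<in>{..<m}. U j i) \<and> finsum (space V i) y {..<m} = x"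
        then have yU: "\<And>j. j < m \<Longrightarrow> y j \<in> U j i" by auto
        have u'U: "\<And>j. j < m \<Longrightarrow> u' j \<in> U j i" using u' by auto
        have "(\<Sum>j<m. \<phi> i (y j)) = \<phi> i (finsum (space V i) y {..<m})"
          using UW[OF _ i] yU by (intro hom_finsum(2)[OF i, symmetric]) auto
        moreover have "(\<Sum>j<m. \<phi> i (u' j)) = \<phi> i (finsum (space V i) u' {..<m})"
          using UW[OF _ i] u'U by (intro hom_finsum(2)[OF i, symmetric]) auto
        ultimately have "(\<Sum>j<m. \<phi> i (y j) - \<phi> i (u' j)) = 0"
          using y fx by (simp add: sum_subtractf)
        moreover have "\<forall>j\<in>{..<m}. \<phi> i (y j) - \<phi> i (u' j) \<in> total_funs (U j)"
        proof
          fix j assume j: "j \<in> {..<m}"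
          have "\<phi> i (y j) \<in> total_funs (U j)" "\<phi> i (u' j) \<in> total_funs (U j)"
            using phi_in_total_funs[OF sub i UW[OF _ i]] yU u'U j by auto
          then show "\<phi> i (y j) - \<phi> i (u' j) \<in> total_funs (U j)"
            using op_subgroup_diff[OF op_subgroup_total_funs[OF sub]] j by simp
        qed
        ultimately have 0: "\<forall>j\<in>{..<m}. \<phi> i (y j) - \<phi> i (u' j) = 0"
          using internal_sum_independent[OF D, of "\<lambda>j. \<phi> i (y j) - \<phi> i (u' j)"] by blast
        have "y j = u' j" if "j < m" for j
        proof -
          have "\<phi> i (y j) = \<phi> i (u' j)" using 0 that by auto
          then show ?thesis using inj[OF i] UW[OF that i yU[OF that]] UW[OF that i u'U[OF that]]
            by (metis inj_onD)
        qed
        then show "y = u'" using y u' by (intro PiE_ext[of y "{..<m}" "\<lambda>j. U j i"]) auto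
      qed
    qed
  qed
  then show ?thesis using True by (simp add: is_direct_sum_def)
qed

lemma zero_rep_restrict: "subrep Q U V \<Longrightarrow> zero_rep Q (restrict_rep V U) \<longleftrightarrow> total_funs U = {0}"
  by (simp add: total_funs_zero zero_rep_def restrict_rep_def)

lemma internal_sum_two: "internal_sum T {..<2} W X \<longleftrightarrow> splits T X (W 0) (W (Suc 0))"
proof -
  have e: "{..<2} = insert 0 {Suc 0}" by auto
  show ?thesis unfolding e by (subst internal_sum_insert) (auto simp: internal_sum_singleton splits_def)
qed

lemma indecomposable_iff: "indecomposable Q V \<longleftrightarrow> indec T (total_funs whole)"
proof -
  have z: "zero_rep Q V \<longleftrightarrow> total_funs whole = {0}"
    using total_funs_zero[OF subrep_whole] by (simp add: zero_rep_def)
  show ?thesis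
  proof
    assume I: "indecomposable Q V"
    show "indec T (total_funs whole)" unfolding indec_def
    proof (intro conjI allI impI)
      show "total_funs whole \<noteq> {0}" using I z by (simp add: indecomposable_def)
      fix A C assume s: "splits T (total_funs whole) A C"
      then have A: "op_subgroup T A" and C: "op_subgroup T C" by (auto simp: splits_def)
      note tf = total_funs_components[OF A splits_subset(1)[OF s]] total_funs_components[OF C splits_subset(2)[OF s]]
      define U where "U j = (if j = (0::nat) then components A else components C)" for j
      have "is_direct_sum Q V 2 U" unfolding is_direct_sum_iff internal_sum_two
        using s subrep_components[OF A] subrep_components[OF C] by (auto simp: U_def tf)
      then have "zero_rep Q (restrict_rep V (U 0)) \<or> zero_rep Q (restrict_rep V (U 1))"
        using I by (simp add: indecomposable_def)
      then show "A = {0} \<or> C = {0}"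
        using subrep_components[OF A] subrep_components[OF C] by (simp add: U_def zero_rep_restrict tf)
    qed
  next
    assume I: "indec T (total_funs whole)"
    show "indecomposable Q V" unfolding indecomposable_def
    proof (intro conjI allI impI)
      show "\<not> zero_rep Q V" using I z by (simp add: indec_def)
      fix U assume "is_direct_sum Q V 2 U"
      then have U: "subrep Q (U 0) V" "subrep Q (U 1) V" "splits T (total_funs whole) (total_funs (U 0)) (total_funs (U (Suc 0)))"
        unfolding is_direct_sum_iff internal_sum_two by auto
      then show "zero_rep Q (restrict_rep V (U 0)) \<or> zero_rep Q (restrict_rep V (U 1))"
        using I by (auto simp: indec_def zero_rep_restrict)
    qed
  qed
qed

lemma is_rep_restrict:
  assumes Y: "subrep Q Y V"
  shows "is_rep Q (restrict_rep V Y)"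
proof -
  have vsY: "vectorspace class_ring ((space V i)\<lparr>carrier := Y i\<rparr>)" if i: "i \<in> verts Q" for i
    using vectorspace.subspace_is_vs[OF vs[OF i]] Y i by (auto simp: subrep_def)
  show ?thesis unfolding is_rep_def
  proof (intro conjI ballI)
    show "vectorspace class_ring (space (restrict_rep V Y) i)" if "i \<in> verts Q" for i
      using vsY[OF that] by (simp add: restrict_rep_def)
    fix \<alpha> assume \<alpha>: "\<alpha> \<in> arcs Q"
    have Ysub: "Y (tail Q \<alpha>) \<subseteq> whole (tail Q \<alpha>)" and Ym: "\<forall>x\<in>Y (tail Q \<alpha>). mor V \<alpha> x \<in> Y (head Q \<alpha>)"
      using Y \<alpha> ends[OF \<alpha>] unfolding subrep_iff by auto
    have "linear_map class_ring (space V (tail Q \<alpha>)) (space V (head Q \<alpha>)) (mor V \<alpha>)"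
      using rep \<alpha> by (simp add: is_rep_def)
    then show "linear_map class_ring (space (restrict_rep V Y) (tail Q \<alpha>))
       (space (restrict_rep V Y) (head Q \<alpha>)) (mor (restrict_rep V Y) \<alpha>)"
      using vsY[OF ends(1)[OF \<alpha>]] vsY[OF ends(2)[OF \<alpha>]] Ysub Ym
      by (auto simp: linear_map_def mod_hom_def mod_hom_axioms_def LinearCombinations.module_hom_def vectorspace_def
          restrict_rep_def subset_iff)
  qed
qed

lemma embedded_restrict:
  assumes Y: "subrep Q Y V"
  shows "embedded_rep Q (restrict_rep V Y) B v a \<phi>"
proof
  have YV: "x \<in> whole i" if "i \<in> verts Q" "x \<in> Y i" for i x
    using Y that unfolding subrep_iff by blast
  show "is_rep Q (restrict_rep V Y)" by (rule is_rep_restrict[OF Y])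
  show "inj_on (\<phi> i) (carrier (space (restrict_rep V Y) i))" if "i \<in> verts Q" for i
    using inj_on_subset[OF inj[OF that], of "Y i"] YV[OF that] by (auto simp: restrict_rep_def)
  show "\<phi> i x \<in> funs_on {b \<in> B. v b = i}"
    if "i \<in> verts Q" "x \<in> carrier (space (restrict_rep V Y) i)" for i x
    using into[OF that(1) YV[OF that(1)]] that(2) by (simp add: restrict_rep_def)
  show "\<phi> i (x \<oplus>\<^bsub>space (restrict_rep V Y) i\<^esub> y) = \<phi> i x + \<phi> i y"
    if "i \<in> verts Q" "x \<in> carrier (space (restrict_rep V Y) i)"
      "y \<in> carrier (space (restrict_rep V Y) i)" for i x y
    using hom_add[OF that(1) YV[OF that(1)] YV[OF that(1)]] that(2,3) by (simp add: restrict_rep_def)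
  show "\<phi> i (c \<odot>\<^bsub>space (restrict_rep V Y) i\<^esub> x) = scal c (\<phi> i x)"
    if "i \<in> verts Q" "x \<in> carrier (space (restrict_rep V Y) i)" for i x c
    using hom_smult[OF that(1) YV[OF that(1)]] that(2) by (simp add: restrict_rep_def)
  show "\<phi> (head Q \<alpha>) (mor (restrict_rep V Y) \<alpha> x) = mat_op B (a \<alpha>) (\<phi> (tail Q \<alpha>) x)"
    if "\<alpha> \<in> arcs Q" "x \<in> carrier (space (restrict_rep V Y) (tail Q \<alpha>))" for \<alpha> x
    using hom_mor[OF that(1) YV[OF ends(1)[OF that(1)]]] that(2) by (simp add: restrict_rep_def)
qed (use wf ends finB vB mat_supp in auto)

lemma indecomposable_restrict:
  assumes Y: "subrep Q Y V"
  shows "indecomposable Q (restrict_rep V Y) \<longleftrightarrow> indec T (total_funs Y)"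
proof -
  interpret R: embedded_rep Q "restrict_rep V Y" B v a \<phi> by (rule embedded_restrict[OF Y])
  have "R.total_funs R.whole = total_funs Y" unfolding R.total_funs_def total_funs_def by (simp add: restrict_rep_def)
  then show ?thesis using R.indecomposable_iff by simp
qed

lemma total_funs_whole_subset: "total_funs whole \<subseteq> funs_on B"
  by (auto simp: total_funs_def)

lemma finite_length_total_funs: "finite_length T (total_funs whole)"
  by (rule finite_length_subset[OF finite_length_funs_on[OF _ finB] total_funs_whole_subset]) (auto simp: rep_ops_def)

text \<open>
  Indecomposable decompositions of the representation and of its total space correspond to each other,
  and the number of parts of the latter is unique by Krull--Schmidt.
\<close>

lemma num_summands_eq:
  assumes \<U>: "indec_decomposition \<U> (total_funs whole)"
  shows "num_summands Q V = card \<U>"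
  unfolding num_summands_def
proof (rule the_equality)
  have fin: "finite \<U>" using \<U> by (auto simp: indec_decomposition_def internal_sum_finite)
  then obtain h where h: "bij_betw h {..<card \<U>} \<U>"
    using ex_bij_betw_nat_finite[of \<U>] by (auto simp: atLeast0LessThan)
  define U where "U j = components (h j)" for j
  have hj: "h j \<in> \<U>" if "j < card \<U>" for j using h that by (auto simp: bij_betw_def)
  have os: "op_subgroup T S" if "S \<in> \<U>" for S
    using \<U> that internal_sum_op_subgroup unfolding indec_decomposition_def by fastforce
  have sb: "S \<subseteq> total_funs whole" if "S \<in> \<U>" for S
    using \<U> internal_sum_summand_subset[of T \<U> "\<lambda>U. U", OF _ that]
    by (simp add: indec_decomposition_def)
  have tU: "total_funs (U j) = h j" if "j < card \<U>" for j
    unfolding U_def using total_funs_components os sb hj[OF that] by blast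
  have sU: "subrep Q (U j) V" if "j < card \<U>" for j
    unfolding U_def using subrep_components os hj[OF that] by blast
  have inj_h: "inj_on h {..<card \<U>}" and im_h: "h ` {..<card \<U>} = \<U>"
    using h by (auto simp: bij_betw_def)
  have "internal_sum T {..<card \<U>} h (total_funs whole)"
    using internal_sum_reindex[OF inj_h, of "\<lambda>U. U" "total_funs whole"] \<U> im_h by (simp add: indec_decomposition_def)
  then have "internal_sum T {..<card \<U>} (\<lambda>j. total_funs (U j)) (total_funs whole)"
    using internal_sum_cong[of "{..<card \<U>}" "\<lambda>j. total_funs (U j)" h] tU by simp
  then have "is_direct_sum Q V (card \<U>) U" unfolding is_direct_sum_iff using sU by simp
  moreover have "indecomposable Q (restrict_rep V (U j))" if "j < card \<U>" for j
    unfolding indecomposable_restrict[OF sU[OF that]] tU[OF that]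
    using \<U> hj[OF that] by (simp add: indec_decomposition_def)
  ultimately show "\<exists>U. is_direct_sum Q V (card \<U>) U \<and> (\<forall>j<card \<U>. indecomposable Q (restrict_rep V (U j)))"
    by blast
next
  fix m assume "\<exists>U. is_direct_sum Q V m U \<and> (\<forall>j<m. indecomposable Q (restrict_rep V (U j)))"
  then obtain U where U: "\<And>j. j < m \<Longrightarrow> subrep Q (U j) V"
    "internal_sum T {..<m} (\<lambda>j. total_funs (U j)) (total_funs whole)" "\<And>j. j < m \<Longrightarrow> indecomposable Q (restrict_rep V (U j))"
    unfolding is_direct_sum_iff by blast
  have ind: "indec T (total_funs (U j))" if "j < m" for j
    using U(3)[OF that] indecomposable_restrict[OF U(1)[OF that]] by simp
  then have inj_t: "inj_on (\<lambda>j. total_funs (U j)) {..<m}"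
    by (intro internal_sum_nonzero_inj[OF U(2)]) (auto simp: indec_def)
  have "indec_decomposition ((\<lambda>j. total_funs (U j)) ` {..<m}) (total_funs whole)"
    unfolding indec_decomposition_def internal_sum_reindex[OF inj_t] using U(2) ind by auto
  then have "card ((\<lambda>j. total_funs (U j)) ` {..<m}) = card \<U>"
    using krull_schmidt_card[OF finite_length_total_funs _ \<U>] by blast
  then show "m = card \<U>" using card_image[OF inj_t] by simp
qed

end

section \<open>Vector spaces with coordinates\<close>

definition delta :: "'b \<Rightarrow> 'b \<Rightarrow> 'k::field" where
  "delta b = (\<lambda>b'. if b' = b then 1 else 0)"

text \<open>
  A vector space given by a linear bijection to a coordinate space.  The vector space axioms are
  inherited from the functions; this is how the tensor products, which are defined by cosets, are seen to
  be vector spaces.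
\<close>

locale coord_space =
  fixes X :: "('k::field, 'x) module" and C :: "'b set" and \<phi> :: "'x \<Rightarrow> 'b \<Rightarrow> 'k"
  assumes fin: "finite C"
    and bij: "bij_betw \<phi> (carrier X) (funs_on C)"
    and zero_closed: "\<zero>\<^bsub>X\<^esub> \<in> carrier X"
    and add_closed: "x \<in> carrier X \<Longrightarrow> y \<in> carrier X \<Longrightarrow> x \<oplus>\<^bsub>X\<^esub> y \<in> carrier X"
    and smult_closed: "x \<in> carrier X \<Longrightarrow> c \<odot>\<^bsub>X\<^esub> x \<in> carrier X"
    and hom_zero: "\<phi> \<zero>\<^bsub>X\<^esub> = 0"
    and hom_add: "x \<in> carrier X \<Longrightarrow> y \<in> carrier X \<Longrightarrow> \<phi> (x \<oplus>\<^bsub>X\<^esub> y) = \<phi> x + \<phi> y"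
    and hom_smult: "x \<in> carrier X \<Longrightarrow> \<phi> (c \<odot>\<^bsub>X\<^esub> x) = scal c (\<phi> x)"
begin

lemma inj: "x \<in> carrier X \<Longrightarrow> y \<in> carrier X \<Longrightarrow> \<phi> x = \<phi> y \<longleftrightarrow> x = y"
  using bij by (auto simp: bij_betw_def inj_on_def)

lemma into: "x \<in> carrier X \<Longrightarrow> \<phi> x \<in> funs_on C"
  using bij by (auto simp: bij_betw_def)

definition elem :: "('b \<Rightarrow> 'k) \<Rightarrow> 'x" where
  "elem f = inv_into (carrier X) \<phi> f"

lemma elem: "f \<in> funs_on C \<Longrightarrow> elem f \<in> carrier X" "f \<in> funs_on C \<Longrightarrow> \<phi> (elem f) = f"
  using bij unfolding elem_def bij_betw_def by (auto intro: inv_into_into f_inv_into_f)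

lemma delta_funs: "b \<in> C \<Longrightarrow> (delta b :: 'b \<Rightarrow> 'k) \<in> funs_on C"
  by (auto simp: funs_on_def delta_def)

text \<open>
  A map \<open>G\<close> that is linear modulo \<open>N\<close> is determined modulo \<open>N\<close> by its values on the basis; \<open>H c x\<close> stands
  for the multiple of \<open>G x\<close> by \<open>c\<close>.  With \<open>N = {0}\<close> this is the matrix of a linear map, and with the
  tensor relations for \<open>N\<close> it expands a generator \<open>x \<otimes> y\<close> in one factor.
\<close>

lemma expansion:
  fixes G :: "'x \<Rightarrow> 'd::ab_group_add" and H :: "'k \<Rightarrow> 'x \<Rightarrow> 'd"
  assumes N: "0 \<in> N" "\<And>f g. f \<in> N \<Longrightarrow> g \<in> N \<Longrightarrow> f + g \<in> N"
    and add: "\<And>x y. x \<in> carrier X \<Longrightarrow> y \<in> carrier X \<Longrightarrow> G (x \<oplus>\<^bsub>X\<^esub> y) - G x - G y \<in> N"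
    and smult: "\<And>c x. x \<in> carrier X \<Longrightarrow> G (c \<odot>\<^bsub>X\<^esub> x) - H c x \<in> N"
    and H0: "\<And>x. H 0 x = 0"
    and x: "x \<in> carrier X"
  shows "G x - (\<Sum>b\<in>C. H (\<phi> x b) (elem (delta b))) \<in> N"
proof -
  have "G x - (\<Sum>b\<in>D. H (\<phi> x b) (elem (delta b))) \<in> N"
    if "finite D" "D \<subseteq> C" "x \<in> carrier X" "\<phi> x \<in> funs_on D" for D x
    using that
  proof (induction D arbitrary: x rule: finite_induct)
    case empty
    have "\<phi> x = \<phi> (0 \<odot>\<^bsub>X\<^esub> x)" using empty by (auto simp: hom_smult funs_on_def fun_eq_iff)
    then have "0 \<odot>\<^bsub>X\<^esub> x = x" using inj[of x "0 \<odot>\<^bsub>X\<^esub> x"] smult_closed empty by simp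
    then show ?case using smult[OF empty(2), of 0] H0 by simp
  next
    case (insert d D)
    define f where "f = (\<lambda>b. if b = d then 0 else \<phi> x b)"
    have fD: "f \<in> funs_on D" using insert.prems by (auto simp: f_def funs_on_def)
    then have fC: "f \<in> funs_on C" using funs_on_mono[of D C] insert.prems by auto
    define x' where "x' = elem f"
    have x': "x' \<in> carrier X" "\<phi> x' = f" unfolding x'_def using elem[OF fC] by auto
    have "(delta d :: 'b \<Rightarrow> 'k) \<in> funs_on C" using insert.prems by (intro delta_funs) simp
    then have d: "elem (delta d) \<in> carrier X" "\<phi> (elem (delta d)) = delta d" using elem by auto
    define z where "z = \<phi> x d \<odot>\<^bsub>X\<^esub> elem (delta d)"
    have z: "z \<in> carrier X" "\<phi> z = scal (\<phi> x d) (delta d)"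
      using smult_closed d hom_smult[OF d(1)] by (simp_all add: z_def)
    have "\<phi> x = f + scal (\<phi> x d) (delta d)"
      by (auto simp: f_def scal_def fun_eq_iff delta_def)
    then have "\<phi> (x' \<oplus>\<^bsub>X\<^esub> z) = \<phi> x" using hom_add[OF x'(1) z(1)] x'(2) z(2) by simp
    then have xz: "x' \<oplus>\<^bsub>X\<^esub> z = x"
      using inj[OF add_closed[OF x'(1) z(1)] insert.prems(2)] by simp
    have 1: "G x - G x' - G z \<in> N" using add[OF x'(1) z(1)] xz by simp
    have 2: "G z - H (\<phi> x d) (elem (delta d)) \<in> N" unfolding z_def by (rule smult[OF d(1)])
    have 3: "G x' - (\<Sum>b\<in>D. H (\<phi> x' b) (elem (delta b))) \<in> N"
      using insert.IH[of x'] insert.prems x' fD by auto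
    have 4: "(\<Sum>b\<in>D. H (\<phi> x' b) (elem (delta b))) = (\<Sum>b\<in>D. H (\<phi> x b) (elem (delta b)))"
      using insert.hyps by (intro sum.cong) (auto simp: x' f_def)
    show ?case
      using N(2)[OF N(2)[OF 1 2] 3[unfolded 4]] insert.hyps by (simp add: algebra_simps)
  qed
  from this[OF fin subset_refl x into[OF x]] show ?thesis .
qed

lemma vs: "vectorspace class_ring X"
proof (rule vs_criteria)
  show "field (class_ring :: 'k ring)" by (rule class_field)
  show "\<forall>x\<in>carrier X. \<exists>y\<in>carrier X. x \<oplus>\<^bsub>X\<^esub> y = \<zero>\<^bsub>X\<^esub>"
  proof
    fix x assume x: "x \<in> carrier X"
    have m: "(- 1) \<odot>\<^bsub>X\<^esub> x \<in> carrier X" using smult_closed[OF x] .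
    have "x \<oplus>\<^bsub>X\<^esub> ((- 1) \<odot>\<^bsub>X\<^esub> x) = \<zero>\<^bsub>X\<^esub>"
      using inj[OF add_closed[OF x m] zero_closed] by (simp only: hom_add[OF x m] hom_smult[OF x] hom_zero scal_uminus) simp
    then show "\<exists>y\<in>carrier X. x \<oplus>\<^bsub>X\<^esub> y = \<zero>\<^bsub>X\<^esub>" using m by blast
  qed
  note c = add_closed smult_closed zero_closed
  show "\<forall>v w. v \<in> carrier X \<and> w \<in> carrier X \<longrightarrow> v \<oplus>\<^bsub>X\<^esub> w = w \<oplus>\<^bsub>X\<^esub> v"
    by (auto simp: c hom_add add.commute simp flip: inj)
  show "\<forall>v w x. v \<in> carrier X \<and> w \<in> carrier X \<and> x \<in> carrier X \<longrightarrow>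
    v \<oplus>\<^bsub>X\<^esub> w \<oplus>\<^bsub>X\<^esub> x = v \<oplus>\<^bsub>X\<^esub> (w \<oplus>\<^bsub>X\<^esub> x)"
    by (auto simp: c hom_add add.assoc simp flip: inj)
  show "\<forall>v\<in>carrier X. v \<oplus>\<^bsub>X\<^esub> \<zero>\<^bsub>X\<^esub> = v"
    by (auto simp: c hom_add hom_zero simp flip: inj)
  show "\<forall>a b v. a \<in> carrier class_ring \<and> b \<in> carrier class_ring \<and> v \<in> carrier X \<longrightarrow>
    (a \<otimes>\<^bsub>class_ring\<^esub> b) \<odot>\<^bsub>X\<^esub> v = a \<odot>\<^bsub>X\<^esub> (b \<odot>\<^bsub>X\<^esub> v)"
    by (auto simp: c hom_smult scal_scal simp flip: inj)
  show "\<forall>v\<in>carrier X. \<one>\<^bsub>class_ring\<^esub> \<odot>\<^bsub>X\<^esub> v = v"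
    by (auto simp: c hom_smult simp flip: inj)
  show "\<forall>a b v. a \<in> carrier class_ring \<and> b \<in> carrier class_ring \<and> v \<in> carrier X \<longrightarrow>
    (a \<oplus>\<^bsub>class_ring\<^esub> b) \<odot>\<^bsub>X\<^esub> v = a \<odot>\<^bsub>X\<^esub> v \<oplus>\<^bsub>X\<^esub> b \<odot>\<^bsub>X\<^esub> v"
    by (auto simp: c hom_smult hom_add scal_add_left simp flip: inj)
  show "\<forall>a v w. a \<in> carrier class_ring \<and> v \<in> carrier X \<and> w \<in> carrier X \<longrightarrow>
    a \<odot>\<^bsub>X\<^esub> (v \<oplus>\<^bsub>X\<^esub> w) = a \<odot>\<^bsub>X\<^esub> v \<oplus>\<^bsub>X\<^esub> a \<odot>\<^bsub>X\<^esub> w"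
    by (auto simp: c hom_smult hom_add scal_add simp flip: inj)
qed (auto simp: zero_closed add_closed smult_closed)

end

section \<open>Tensor products in coordinates\<close>

text \<open>
  The linear extension of \<open>h\<close> to the free space, with values in coordinate functions.
\<close>

definition lin_ext :: "('p \<Rightarrow> 'b \<Rightarrow> 'k::field) \<Rightarrow> ('p \<Rightarrow>\<^sub>0 'k) \<Rightarrow> 'b \<Rightarrow> 'k" where
  "lin_ext h f = (\<Sum>p\<in>Poly_Mapping.keys f. scal (Poly_Mapping.lookup f p) (h p))"

abbreviation pscal :: "'k::field \<Rightarrow> ('p \<Rightarrow>\<^sub>0 'k) \<Rightarrow> 'p \<Rightarrow>\<^sub>0 'k" where
  "pscal c \<equiv> Poly_Mapping.map ((*) c)"

lemma lookup_pscal: "Poly_Mapping.lookup (pscal c f) p = c * Poly_Mapping.lookup f p"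
  by (simp add: Poly_Mapping.map.rep_eq when_def)

lemma keys_pscal: "Poly_Mapping.keys (pscal c f) \<subseteq> Poly_Mapping.keys f"
  by (auto simp: in_keys_iff lookup_pscal)

lemma pscal_add: "pscal c (f + g) = pscal c f + pscal c g"
  and pscal_diff: "pscal c (f - g) = pscal c f - pscal c g"
  and pscal_pscal: "pscal c (pscal d f) = pscal (c * d) f"
  and pscal_add_left: "pscal (c + d) f = pscal c f + pscal d f"
  and pscal_one: "pscal 1 f = f"
  and pscal_uminus: "pscal (- 1) f = - f"
  by (rule poly_mapping_eqI, simp add: lookup_pscal lookup_add lookup_minus algebra_simps)+

lemma pscal_sum: "pscal c (sum F J) = (\<Sum>j\<in>J. pscal c (F j))"
  by (rule poly_mapping_eqI) (simp add: lookup_pscal lookup_sum sum_distrib_left)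

lemma lin_ext_superset:
  assumes "finite S" "Poly_Mapping.keys f \<subseteq> S"
  shows "lin_ext h f = (\<Sum>p\<in>S. scal (Poly_Mapping.lookup f p) (h p))"
  unfolding lin_ext_def using assms by (intro sum.mono_neutral_left) (auto simp: in_keys_iff)

lemma lin_ext_zero: "lin_ext h 0 = 0"
  by (simp add: lin_ext_def)

lemma lin_ext_add: "lin_ext h (f + g) = lin_ext h f + lin_ext h g"
proof -
  let ?S = "Poly_Mapping.keys f \<union> Poly_Mapping.keys g"
  have "lin_ext h (f + g) = (\<Sum>p\<in>?S. scal (Poly_Mapping.lookup (f + g) p) (h p))"
    using keys_add[of f g] by (intro lin_ext_superset) auto
  also have "\<dots> = (\<Sum>p\<in>?S. scal (Poly_Mapping.lookup f p) (h p)) + (\<Sum>p\<in>?S. scal (Poly_Mapping.lookup g p) (h p))"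
    by (simp only: lookup_add scal_add_left sum.distrib)
  also have "\<dots> = lin_ext h f + lin_ext h g"
    using lin_ext_superset[of ?S f h] lin_ext_superset[of ?S g h] by simp
  finally show ?thesis .
qed

lemma lin_ext_pscal: "lin_ext h (pscal c f) = scal c (lin_ext h f)"
proof -
  have "lin_ext h (pscal c f) = (\<Sum>p\<in>Poly_Mapping.keys f. scal (Poly_Mapping.lookup (pscal c f) p) (h p))"
    by (rule lin_ext_superset) (auto simp: keys_pscal)
  also have "\<dots> = scal c (lin_ext h f)"
    unfolding lin_ext_def by (simp only: lookup_pscal scal_sum scal_scal)
  finally show ?thesis .
qed

lemma lin_ext_minus: "lin_ext h (f - g) = lin_ext h f - lin_ext h g"
  using lin_ext_add[of h f "- g"] lin_ext_pscal[of h "- 1" g] unfolding pscal_uminus scal_uminus by simp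

lemma lin_ext_single: "lin_ext h (Poly_Mapping.single p c) = scal c (h p)"
proof -
  have "lin_ext h (Poly_Mapping.single p c) = (\<Sum>q\<in>{p}. scal (Poly_Mapping.lookup (Poly_Mapping.single p c) q) (h q))"
    by (rule lin_ext_superset) auto
  then show ?thesis by simp
qed

lemma lin_ext_basis_vec: "lin_ext h (basis_vec p) = h p"
  by (simp add: basis_vec_def lin_ext_single)

lemma lin_ext_sum: "lin_ext h (sum F J) = (\<Sum>j\<in>J. lin_ext h (F j))"
  by (induction J rule: infinite_finite_induct) (simp_all only: sum.infinite sum.empty sum.insert lin_ext_zero lin_ext_add not_False_eq_True)

lemma lin_ext_free_extend: "lin_ext h (free_extend g f) = lin_ext (\<lambda>p. lin_ext h (g p)) f"
  unfolding free_extend_def lin_ext_sum lin_ext_pscal by (simp add: lin_ext_def)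

lemma lin_ext_cong: "(\<And>p. p \<in> Poly_Mapping.keys f \<Longrightarrow> h p = h' p) \<Longrightarrow> lin_ext h f = lin_ext h' f"
  unfolding lin_ext_def by (rule sum.cong) auto

lemma lin_ext_linear_image:
  fixes h :: "'p \<Rightarrow> 'b \<Rightarrow> 'k::field" and L :: "('b \<Rightarrow> 'k) \<Rightarrow> 'c \<Rightarrow> 'k"
  assumes "\<And>f g. L (f + g) = L f + L g" "\<And>c f. L (scal c f) = scal c (L f)"
  shows "lin_ext (\<lambda>p. L (h p)) f = L (lin_ext h f)"
proof -
  have L0: "L 0 = 0" using assms(1)[of 0 0] by simp
  have "L (sum F J) = (\<Sum>j\<in>J. L (F j))" for F and J :: "'p set"
    by (induction J rule: infinite_finite_induct) (simp_all only: sum.infinite sum.empty sum.insert L0 assms(1) not_False_eq_True)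
  then show ?thesis by (simp add: lin_ext_def assms(2))
qed

lemma keys_free_extend:
  assumes "\<And>p. p \<in> Poly_Mapping.keys f \<Longrightarrow> Poly_Mapping.keys (g p) \<subseteq> S"
  shows "Poly_Mapping.keys (free_extend g f) \<subseteq> S"
proof
  fix q assume "q \<in> Poly_Mapping.keys (free_extend g f)"
  then have "(\<Sum>p\<in>Poly_Mapping.keys f. Poly_Mapping.lookup f p * Poly_Mapping.lookup (g p) q) \<noteq> 0"
    by (simp add: in_keys_iff free_extend_def lookup_sum lookup_pscal)
  then obtain p where p: "p \<in> Poly_Mapping.keys f" "Poly_Mapping.lookup (g p) q \<noteq> 0"
    by (metis (no_types, lifting) mult_zero_right sum.neutral)
  then have "q \<in> Poly_Mapping.keys (g p)" by (simp only: in_keys_iff not_False_eq_True)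
  then show "q \<in> S" using assms[OF p(1)] by blast
qed

lemma poly_mapping_sum_single:
  "(\<Sum>p\<in>Poly_Mapping.keys f. Poly_Mapping.single p (Poly_Mapping.lookup f p)) = f"
  by (rule poly_mapping_eqI) (auto simp: lookup_sum lookup_single when_def in_keys_iff)

lemma vs_free_space: "vectorspace class_ring (free_space B :: ('k::field, 'p \<Rightarrow>\<^sub>0 'k) module)"
proof (rule vs_criteria)
  show "field (class_ring :: 'k ring)" by (rule class_field)
  show "\<forall>x\<in>carrier (free_space B). \<exists>y\<in>carrier (free_space B :: ('k, 'p \<Rightarrow>\<^sub>0 'k) module).
    x \<oplus>\<^bsub>free_space B\<^esub> y = \<zero>\<^bsub>free_space B\<^esub>"
  proof
    fix x assume "x \<in> carrier (free_space B :: ('k, 'p \<Rightarrow>\<^sub>0 'k) module)"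
    then show "\<exists>y\<in>carrier (free_space B :: ('k, 'p \<Rightarrow>\<^sub>0 'k) module).
      x \<oplus>\<^bsub>free_space B\<^esub> y = \<zero>\<^bsub>free_space B\<^esub>"
      by (intro bexI[of _ "- x"]) (auto simp: free_space_def)
  qed
  show "\<forall>f g. f \<in> carrier (free_space B) \<and> g \<in> carrier (free_space B) \<longrightarrow>
    f \<oplus>\<^bsub>free_space B\<^esub> g \<in> carrier (free_space B :: ('k, 'p \<Rightarrow>\<^sub>0 'k) module)"
    using keys_add by (fastforce simp: free_space_def)
  show "\<forall>c f. c \<in> carrier class_ring \<and> f \<in> carrier (free_space B) \<longrightarrow>
    c \<odot>\<^bsub>free_space B\<^esub> f \<in> carrier (free_space B :: ('k, 'p \<Rightarrow>\<^sub>0 'k) module)"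
    using keys_pscal by (fastforce simp: free_space_def)
qed (simp_all add: free_space_def pscal_add pscal_pscal pscal_add_left pscal_one add.commute add.assoc)

text \<open>
  Coordinates of \<open>x \<otimes> y\<close>.  The basis of an iterated tensor product is indexed by lists; the entry of the
  factor that is tensored on last comes first.
\<close>

definition tens :: "('c list \<Rightarrow> 'k::field) \<Rightarrow> ('c \<Rightarrow> 'k) \<Rightarrow> 'c list \<Rightarrow> 'k" where
  "tens f g l = (case l of [] \<Rightarrow> 0 | y # xs \<Rightarrow> f xs * g y)"

definition tens_index :: "'c list set \<Rightarrow> 'c set \<Rightarrow> 'c list set" where
  "tens_index B C = {y # xs | y xs. y \<in> C \<and> xs \<in> B}"

definition tens_eval ::
  "('x \<Rightarrow> 'c list \<Rightarrow> 'k::field) \<Rightarrow> ('y \<Rightarrow> 'c \<Rightarrow> 'k) \<Rightarrow> ('x \<times> 'y \<Rightarrow>\<^sub>0 'k) \<Rightarrow> 'c list \<Rightarrow> 'k" where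
  "tens_eval \<phi> \<psi> = lin_ext (\<lambda>(x, y). tens (\<phi> x) (\<psi> y))"

text \<open>
  The evaluation of any representative; it is constant on the cosets of the tensor relations.
\<close>

definition tens_coord ::
  "('x \<Rightarrow> 'c list \<Rightarrow> 'k::field) \<Rightarrow> ('y \<Rightarrow> 'c \<Rightarrow> 'k) \<Rightarrow> ('x \<times> 'y \<Rightarrow>\<^sub>0 'k) set \<Rightarrow> 'c list \<Rightarrow> 'k" where
  "tens_coord \<phi> \<psi> A = tens_eval \<phi> \<psi> (SOME f. f \<in> A)"

lemma tens_add_left: "tens (f + f') g = tens f g + tens f' g"
  and tens_add_right: "tens f (g + g') = tens f g + tens f g'"
  and tens_scal_left: "tens (scal c f) g = scal c (tens f g)"
  and tens_scal_right: "tens f (scal c g) = scal c (tens f g)"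
  by (auto simp: tens_def scal_def fun_eq_iff algebra_simps split: list.split)

lemma tens_funs_on: "f \<in> funs_on B \<Longrightarrow> g \<in> funs_on C \<Longrightarrow> tens f g \<in> funs_on (tens_index B C)"
  by (auto simp: tens_def funs_on_def tens_index_def split: list.split)

lemma finite_tens_index: "finite B \<Longrightarrow> finite C \<Longrightarrow> finite (tens_index B C)"
proof -
  assume "finite B" "finite C"
  moreover have "tens_index B C = (\<lambda>(y, xs). y # xs) ` (C \<times> B)" by (auto simp: tens_index_def)
  ultimately show ?thesis by simp
qed

locale tensor_coords =
  V: coord_space V B \<phi> + W: coord_space W C \<psi>
  for V :: "('k::field, 'x) module" and B :: "'c list set" and \<phi>
    and W :: "('k, 'y) module" and C :: "'c set" and \<psi>
begin

abbreviation F where "F \<equiv> tensor_free V W"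
abbreviation N where "N \<equiv> tensor_null V W"
abbreviation ev where "ev \<equiv> tens_eval \<phi> \<psi>"

lemma F_simps: "carrier F = {f. Poly_Mapping.keys f \<subseteq> carrier V \<times> carrier W}"
  "\<zero>\<^bsub>F\<^esub> = 0" "f \<oplus>\<^bsub>F\<^esub> g = f + g" "c \<odot>\<^bsub>F\<^esub> f = pscal c f"
  by (auto simp: tensor_free_def free_space_def)

sublocale F: vectorspace class_ring F
  unfolding tensor_free_def by (rule vs_free_space)

lemma F_closed: "f \<in> carrier F \<Longrightarrow> g \<in> carrier F \<Longrightarrow> f + g \<in> carrier F"
  "f \<in> carrier F \<Longrightarrow> g \<in> carrier F \<Longrightarrow> f - g \<in> carrier F"
  "f \<in> carrier F \<Longrightarrow> pscal c f \<in> carrier F"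
  "x \<in> carrier V \<Longrightarrow> y \<in> carrier W \<Longrightarrow> Poly_Mapping.single (x, y) c \<in> carrier F"
  using keys_add[of f g] keys_diff[of f g] keys_pscal[of c f] by (auto simp: F_simps)

lemma ev_linear: "ev (f + g) = ev f + ev g" "ev (f - g) = ev f - ev g" "ev (pscal c f) = scal c (ev f)"
  "ev (sum G J) = (\<Sum>j\<in>J. ev (G j))" "ev 0 = 0"
  "ev (Poly_Mapping.single (x, y) c) = scal c (tens (\<phi> x) (\<psi> y))"
  by (simp_all add: tens_eval_def lin_ext_add lin_ext_minus lin_ext_pscal lin_ext_sum lin_ext_zero lin_ext_single)

lemma ev_funs_on:
  assumes "f \<in> carrier F"
  shows "ev f \<in> funs_on (tens_index B C)"
proof -
  have "(case p of (x, y) \<Rightarrow> tens (\<phi> x) (\<psi> y)) \<in> funs_on (tens_index B C)" if "p \<in> Poly_Mapping.keys f" for p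
    using assms that by (auto simp: F_simps intro!: tens_funs_on V.into W.into)
  then show ?thesis unfolding tens_eval_def lin_ext_def
    by (intro op_subgroup_sum[of "{}"] funs_on_scal) (auto simp: op_subgroup_def funs_on_diff)
qed

lemma rel_subset: "tensor_relations V W \<subseteq> {f \<in> carrier F. ev f = 0}"
proof
  fix f assume "f \<in> tensor_relations V W"
  then consider
    x x' y where "x \<in> carrier V" "x' \<in> carrier V" "y \<in> carrier W"
      "f = basis_vec (x \<oplus>\<^bsub>V\<^esub> x', y) - basis_vec (x, y) - basis_vec (x', y)" |
    x y y' where "x \<in> carrier V" "y \<in> carrier W" "y' \<in> carrier W"
      "f = basis_vec (x, y \<oplus>\<^bsub>W\<^esub> y') - basis_vec (x, y) - basis_vec (x, y')" |
    c x y where "x \<in> carrier V" "y \<in> carrier W"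
      "f = basis_vec (c \<odot>\<^bsub>V\<^esub> x, y) - Poly_Mapping.single (x, y) c" |
    c x y where "x \<in> carrier V" "y \<in> carrier W"
      "f = basis_vec (x, c \<odot>\<^bsub>W\<^esub> y) - Poly_Mapping.single (x, y) c"
    unfolding tensor_relations_def by blast
  then show "f \<in> {f \<in> carrier F. ev f = 0}"
    by cases (simp_all add: basis_vec_def F_closed ev_linear V.add_closed V.smult_closed W.add_closed
      W.smult_closed V.hom_add V.hom_smult W.hom_add W.hom_smult tens_add_left tens_add_right
      tens_scal_left tens_scal_right)
qed

lemma null_submodule: "submodule class_ring N F"
  unfolding tensor_null_def using rel_subset by (intro F.span_is_submodule) auto

lemma null_ev:
  assumes "f \<in> N"
  shows "f \<in> carrier F" "ev f = 0"
proof -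
  have "submodule class_ring {f \<in> carrier F. ev f = 0} F"
    using F.module_axioms F_closed by (auto simp: submodule_def F_simps ev_linear)
  then have "N \<subseteq> {f \<in> carrier F. ev f = 0}"
    unfolding tensor_null_def using rel_subset by (intro F.span_is_subset)
  then show "f \<in> carrier F" "ev f = 0" using assms by auto
qed

lemma null_closed: "0 \<in> N" "f \<in> N \<Longrightarrow> g \<in> N \<Longrightarrow> f + g \<in> N" "f \<in> N \<Longrightarrow> pscal c f \<in> N"
  using null_submodule unfolding submodule_def F_simps by auto

lemma null_sum: "(\<And>j. j \<in> J \<Longrightarrow> G j \<in> N) \<Longrightarrow> sum G J \<in> N"
  by (induction J rule: infinite_finite_induct) (simp_all add: null_closed)

lemma rel_null: "f \<in> tensor_relations V W \<Longrightarrow> f \<in> N"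
  unfolding tensor_null_def using F.in_own_span[of "tensor_relations V W"] rel_subset by auto

lemma null_rels:
  "x \<in> carrier V \<Longrightarrow> x' \<in> carrier V \<Longrightarrow> y \<in> carrier W \<Longrightarrow>
     basis_vec (x \<oplus>\<^bsub>V\<^esub> x', y) - basis_vec (x, y) - basis_vec (x', y) \<in> N"
  "x \<in> carrier V \<Longrightarrow> y \<in> carrier W \<Longrightarrow> y' \<in> carrier W \<Longrightarrow>
     basis_vec (x, y \<oplus>\<^bsub>W\<^esub> y') - basis_vec (x, y) - basis_vec (x, y') \<in> N"
  "x \<in> carrier V \<Longrightarrow> y \<in> carrier W \<Longrightarrow> basis_vec (c \<odot>\<^bsub>V\<^esub> x, y) - Poly_Mapping.single (x, y) c \<in> N"
  "x \<in> carrier V \<Longrightarrow> y \<in> carrier W \<Longrightarrow> basis_vec (x, c \<odot>\<^bsub>W\<^esub> y) - Poly_Mapping.single (x, y) c \<in> N"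
  by (rule rel_null; unfold tensor_relations_def; blast)+

definition \<beta> :: "'c list \<Rightarrow> 'x" where "\<beta> b = V.elem (delta b)"

definition \<gamma> :: "'c \<Rightarrow> 'y" where "\<gamma> b = W.elem (delta b)"

lemma \<beta>: "b \<in> B \<Longrightarrow> \<beta> b \<in> carrier V" "b \<in> B \<Longrightarrow> \<phi> (\<beta> b) = delta b"
  unfolding \<beta>_def using V.elem V.delta_funs by auto

lemma \<gamma>: "b \<in> C \<Longrightarrow> \<gamma> b \<in> carrier W" "b \<in> C \<Longrightarrow> \<psi> (\<gamma> b) = delta b"
  unfolding \<gamma>_def using W.elem W.delta_funs by auto

text \<open>
  The combination of the generators \<open>\<beta> b \<otimes> \<gamma> c\<close> with prescribed coordinates.
\<close>

definition tensor_section :: "('c list \<Rightarrow> 'k) \<Rightarrow> ('x \<times> 'y \<Rightarrow>\<^sub>0 'k)" where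
  "tensor_section r = (\<Sum>b\<in>B. \<Sum>c\<in>C. Poly_Mapping.single (\<beta> b, \<gamma> c) (r (c # b)))"

lemma tensor_section_linear: "tensor_section (r + s) = tensor_section r + tensor_section s" "tensor_section (scal k r) = pscal k (tensor_section r)"
  unfolding tensor_section_def pscal_sum by (simp_all add: single_add sum.distrib scal_def)

text \<open>
  Modulo the tensor relations \<open>x \<otimes> y\<close> is first expanded in \<open>x\<close> and then in \<open>y\<close>.
\<close>

lemma tensor_section_basis:
  assumes x: "x \<in> carrier V" and y: "y \<in> carrier W"
  shows "basis_vec (x, y) - tensor_section (tens (\<phi> x) (\<psi> y)) \<in> N"
proof -
  have 1: "basis_vec (x, y) - (\<Sum>b\<in>B. Poly_Mapping.single (\<beta> b, y) (\<phi> x b)) \<in> N"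
    unfolding \<beta>_def
    by (rule V.expansion[where G = "\<lambda>x. basis_vec (x, y)" and H = "\<lambda>c x. Poly_Mapping.single (x, y) c"])
       (use null_closed null_rels x y in auto)
  have 2: "Poly_Mapping.single (\<beta> b, y) (\<phi> x b) -
    (\<Sum>c\<in>C. Poly_Mapping.single (\<beta> b, \<gamma> c) (\<phi> x b * \<psi> y c)) \<in> N" if b: "b \<in> B" for b
  proof -
    have "pscal (\<phi> x b) (basis_vec (\<beta> b, y) - (\<Sum>c\<in>C. Poly_Mapping.single (\<beta> b, \<gamma> c) (\<psi> y c))) \<in> N"
      unfolding \<gamma>_def
      by (intro null_closed(3) W.expansion[where G = "\<lambda>y. basis_vec (\<beta> b, y)"
            and H = "\<lambda>c y. Poly_Mapping.single (\<beta> b, y) c"])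
         (use null_closed null_rels \<beta>(1)[OF b] y in auto)
    then show ?thesis by (simp add: pscal_diff pscal_sum basis_vec_def)
  qed
  have "(\<Sum>b\<in>B. Poly_Mapping.single (\<beta> b, y) (\<phi> x b) -
    (\<Sum>c\<in>C. Poly_Mapping.single (\<beta> b, \<gamma> c) (\<phi> x b * \<psi> y c))) \<in> N"
    using 2 by (rule null_sum)
  then have "(\<Sum>b\<in>B. Poly_Mapping.single (\<beta> b, y) (\<phi> x b)) - tensor_section (tens (\<phi> x) (\<psi> y)) \<in> N"
    by (simp add: sum_subtractf tensor_section_def tens_def)
  then show ?thesis using null_closed(2)[OF 1] by fastforce
qed

lemma tensor_section_ev:
  assumes "f \<in> carrier F"
  shows "f - tensor_section (ev f) \<in> N"
proof -
  let ?h = "\<lambda>p. pscal (Poly_Mapping.lookup f p) (basis_vec p - tensor_section (case p of (x, y) \<Rightarrow> tens (\<phi> x) (\<psi> y)))"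
  have sec_sum: "tensor_section (sum G J) = (\<Sum>j\<in>J. tensor_section (G j))" for G and J :: "('x \<times> 'y) set"
    by (induction J rule: infinite_finite_induct)
       (simp_all only: sum.infinite sum.empty sum.insert tensor_section_linear not_False_eq_True,
        simp_all add: tensor_section_def)
  have "?h p \<in> N" if "p \<in> Poly_Mapping.keys f" for p
    using assms that by (auto simp: F_simps intro!: null_closed(3) tensor_section_basis)
  then have "sum ?h (Poly_Mapping.keys f) \<in> N" by (rule null_sum)
  moreover have "sum ?h (Poly_Mapping.keys f) = f - tensor_section (ev f)"
  proof -
    have "sum ?h (Poly_Mapping.keys f) =
      (\<Sum>p\<in>Poly_Mapping.keys f. Poly_Mapping.single p (Poly_Mapping.lookup f p)) -
      (\<Sum>p\<in>Poly_Mapping.keys f. tensor_section (scal (Poly_Mapping.lookup f p) (case p of (x, y) \<Rightarrow> tens (\<phi> x) (\<psi> y))))"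
      by (simp add: pscal_diff basis_vec_def sum_subtractf tensor_section_linear)
    then show ?thesis unfolding poly_mapping_sum_single tens_eval_def lin_ext_def sec_sum .
  qed
  ultimately show ?thesis by simp
qed

text \<open>
  The relations vanish under the evaluation.  Conversely every element of the free space agrees, modulo
  the relations, with the section of its coordinates, which is zero if the coordinates are.
\<close>

lemma null_iff: "f \<in> N \<longleftrightarrow> f \<in> carrier F \<and> ev f = 0"
proof
  assume f: "f \<in> carrier F \<and> ev f = 0"
  then have "f - tensor_section 0 \<in> N" using tensor_section_ev[of f] by simp
  then show "f \<in> N" by (simp add: tensor_section_def)
qed (use null_ev in blast)

lemma F_sum: "(\<And>j. j \<in> J \<Longrightarrow> G j \<in> carrier F) \<Longrightarrow> sum G J \<in> carrier F"
  by (induction J rule: infinite_finite_induct) (simp_all add: F_closed(1), simp_all add: F_simps)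

lemma tensor_section_closed: "tensor_section r \<in> carrier F"
  unfolding tensor_section_def
  by (intro F_sum F_closed \<beta> \<gamma>)

lemma ev_tensor_section:
  assumes "r \<in> funs_on (tens_index B C)"
  shows "ev (tensor_section r) = r"
proof
  fix l
  have "ev (tensor_section r) l = (\<Sum>b\<in>B. \<Sum>c\<in>C. scal (r (c # b)) (tens (\<phi> (\<beta> b)) (\<psi> (\<gamma> c))) l)"
    by (simp add: tensor_section_def ev_linear sum_fun_apply)
  also have "\<dots> = (\<Sum>b\<in>B. \<Sum>c\<in>C. if l = c # b then r l else 0)"
    by (intro sum.cong refl) (auto simp: \<beta> \<gamma> delta_def tens_def scal_def split: list.split)
  also have "\<dots> = r l"
  proof (cases l)
    case Nil
    then show ?thesis using assms by (auto simp: funs_on_def tens_index_def)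
  next
    case (Cons y xs)
    have "(\<Sum>b\<in>B. \<Sum>c\<in>C. if l = c # b then r l else 0) =
      (\<Sum>b\<in>B. if xs = b then (\<Sum>c\<in>C. if y = c then r l else 0) else 0)"
      by (intro sum.cong refl) (auto simp: Cons)
    also have "\<dots> = r l"
      using assms V.fin W.fin by (auto simp: funs_on_def tens_index_def Cons)
    finally show ?thesis .
  qed
  finally show "ev (tensor_section r) l = r l" .
qed

text \<open>
  The cosets of the tensor relations are the fibres of the evaluation, so that the quotient is computed
  on coordinates.
\<close>

definition fibre :: "('c list \<Rightarrow> 'k) \<Rightarrow> ('x \<times> 'y \<Rightarrow>\<^sub>0 'k) set" where
  "fibre r = {f \<in> carrier F. ev f = r}"

lemma coset_eq: "f \<in> carrier F \<Longrightarrow> N +>\<^bsub>F\<^esub> f = fibre (ev f)"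
proof -
  assume f: "f \<in> carrier F"
  show ?thesis
  proof
    show "N +>\<^bsub>F\<^esub> f \<subseteq> fibre (ev f)"
      using f F_closed by (auto simp: a_r_coset_def' F_simps(3) null_iff fibre_def ev_linear)
    show "fibre (ev f) \<subseteq> N +>\<^bsub>F\<^esub> f"
    proof
      fix g assume g: "g \<in> fibre (ev f)"
      then have "g - f \<in> N" using f F_closed by (auto simp: null_iff fibre_def ev_linear)
      moreover have "g = (g - f) + f" by simp
      ultimately show "g \<in> N +>\<^bsub>F\<^esub> f" unfolding a_r_coset_def' F_simps(3) by blast
    qed
  qed
qed

lemma tensor_section_fibre: "r \<in> funs_on (tens_index B C) \<Longrightarrow> tensor_section r \<in> fibre r"
  by (simp add: fibre_def tensor_section_closed ev_tensor_section)

lemma carrier_tensor: "carrier (tensor_space V W) = fibre ` funs_on (tens_index B C)"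
proof -
  have "carrier (tensor_space V W) = (\<lambda>f. fibre (ev f)) ` carrier F"
    by (auto simp: tensor_space_def quotient_space_def A_RCOSETS_def' coset_eq)
  also have "\<dots> = fibre ` funs_on (tens_index B C)"
    using ev_funs_on tensor_section_closed ev_tensor_section by (auto simp: image_iff) metis
  finally show ?thesis .
qed

lemma tens_coord_fibre: "r \<in> funs_on (tens_index B C) \<Longrightarrow> tens_coord \<phi> \<psi> (fibre r) = r"
  unfolding tens_coord_def using someI[of "\<lambda>f. f \<in> fibre r", OF tensor_section_fibre] by (auto simp: fibre_def)

lemma tensor_add:
  assumes "r \<in> funs_on (tens_index B C)" "s \<in> funs_on (tens_index B C)"
  shows "fibre r \<oplus>\<^bsub>tensor_space V W\<^esub> fibre s = fibre (r + s)"
proof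
  show "fibre r \<oplus>\<^bsub>tensor_space V W\<^esub> fibre s \<subseteq> fibre (r + s)"
    using F_closed by (auto simp: tensor_space_def quotient_space_def set_add_def' F_simps(3) fibre_def ev_linear)
  show "fibre (r + s) \<subseteq> fibre r \<oplus>\<^bsub>tensor_space V W\<^esub> fibre s"
  proof
    fix f assume f: "f \<in> fibre (r + s)"
    have "f - tensor_section s \<in> fibre r" using f tensor_section_fibre[OF assms(2)] F_closed by (auto simp: fibre_def ev_linear)
    moreover have "f = (f - tensor_section s) + tensor_section s" by simp
    ultimately show "f \<in> fibre r \<oplus>\<^bsub>tensor_space V W\<^esub> fibre s"
      using tensor_section_fibre[OF assms(2)]
      by (simp add: tensor_space_def quotient_space_def set_add_def' F_simps(3))
         (intro bexI[of _ "f - tensor_section s"] bexI[of _ "tensor_section s"], simp_all)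
  qed
qed

lemma tensor_smult:
  assumes "r \<in> funs_on (tens_index B C)"
  shows "c \<odot>\<^bsub>tensor_space V W\<^esub> fibre r = fibre (scal c r)"
proof -
  have "N +>\<^bsub>F\<^esub> (c \<odot>\<^bsub>F\<^esub> f) = fibre (scal c r)" if "f \<in> fibre r" for f
    using that coset_eq[of "pscal c f"] F_closed by (auto simp: fibre_def F_simps(4) ev_linear)
  then show ?thesis
    using tensor_section_fibre[OF assms] by (auto simp: tensor_space_def quotient_space_def)
qed

lemma tensor_zero: "\<zero>\<^bsub>tensor_space V W\<^esub> = fibre 0"
  by (auto simp: tensor_space_def quotient_space_def fibre_def null_iff)

lemma coord_space_tensor: "coord_space (tensor_space V W) (tens_index B C) (tens_coord \<phi> \<psi>)"
proof
  show "finite (tens_index B C)" using V.fin W.fin by (rule finite_tens_index)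
  show "bij_betw (tens_coord \<phi> \<psi>) (carrier (tensor_space V W)) (funs_on (tens_index B C))"
    unfolding carrier_tensor
    by (rule bij_betw_byWitness[where f' = fibre]) (auto simp: tens_coord_fibre)
qed (auto simp: carrier_tensor tensor_zero tensor_add tensor_smult tens_coord_fibre funs_on_add funs_on_scal)

lemma tens_coord_eq:
  assumes "A \<in> carrier (tensor_space V W)" "f \<in> A"
  shows "tens_coord \<phi> \<psi> A = ev f" "f \<in> carrier F"
proof -
  obtain r where r: "A = fibre r" "r \<in> funs_on (tens_index B C)" using assms(1) by (auto simp: carrier_tensor)
  then show "f \<in> carrier F" using assms(2) by (simp add: fibre_def)
  have "ev f = r" using assms(2) r by (simp add: fibre_def)
  then show "tens_coord \<phi> \<psi> A = ev f" using r by (simp add: tens_coord_fibre)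
qed

lemma carrier_tensor_iff:
  assumes "A \<in> carrier (tensor_space V W)"
  shows "A = fibre (tens_coord \<phi> \<psi> A)" "tens_coord \<phi> \<psi> A \<in> funs_on (tens_index B C)"
  using assms by (auto simp: carrier_tensor tens_coord_fibre)

end

text \<open>
  If \<open>h\<close> acts on the coordinates of the generators by the linear map \<open>L\<close>, then so does the induced map
  on all elements; in particular it does not depend on representatives.
\<close>

lemma tensor_induced_coords:
  assumes 1: "tensor_coords V B \<phi> W C \<psi>" and 2: "tensor_coords V' B' \<phi>' W' C' \<psi>'"
    and L: "\<And>f g. L (f + g) = L f + L g" "\<And>c f. L (scal c f) = scal c (L f)"
    and h: "\<And>x y. x \<in> carrier V \<Longrightarrow> y \<in> carrier W \<Longrightarrow> h (x, y) \<in> carrier (tensor_free V' W')"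
    and ev: "\<And>x y. x \<in> carrier V \<Longrightarrow> y \<in> carrier W \<Longrightarrow>
      tens_eval \<phi>' \<psi>' (h (x, y)) = L (tens (\<phi> x) (\<psi> y))"
    and A: "A \<in> carrier (tensor_space V W)"
  shows "tensor_induced V' W' h A \<in> carrier (tensor_space V' W')"
    and "tens_coord \<phi>' \<psi>' (tensor_induced V' W' h A) = L (tens_coord \<phi> \<psi> A)"
proof -
  interpret P: tensor_coords V B \<phi> W C \<psi> by (rule 1)
  interpret R: tensor_coords V' B' \<phi>' W' C' \<psi>' by (rule 2)
  have fe: "free_extend h f \<in> carrier R.F" "R.ev (free_extend h f) = L (tens_coord \<phi> \<psi> A)"
    if "f \<in> A" for f
  proof -
    have f: "f \<in> carrier P.F" "P.ev f = tens_coord \<phi> \<psi> A" using P.tens_coord_eq[OF A that] by auto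
    show "free_extend h f \<in> carrier R.F"
      using f h unfolding P.F_simps R.F_simps by (auto intro!: keys_free_extend)
    have "R.ev (free_extend h f) = lin_ext (\<lambda>p. tens_eval \<phi>' \<psi>' (h p)) f"
      unfolding tens_eval_def by (rule lin_ext_free_extend)
    also have "\<dots> = lin_ext (\<lambda>p. L (case p of (x, y) \<Rightarrow> tens (\<phi> x) (\<psi> y))) f"
      using f(1) ev unfolding P.F_simps by (intro lin_ext_cong) auto
    also have "\<dots> = L (P.ev f)" unfolding tens_eval_def by (rule lin_ext_linear_image[OF L])
    finally show "R.ev (free_extend h f) = L (tens_coord \<phi> \<psi> A)" using f(2) by simp
  qed
  have ne: "A \<noteq> {}" using P.carrier_tensor_iff[OF A] P.tensor_section_fibre by auto
  have co: "R.N +>\<^bsub>R.F\<^esub> free_extend h f = R.fibre (L (tens_coord \<phi> \<psi> A))" if "f \<in> A" for f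
    using R.coset_eq[OF fe(1)[OF that]] fe(2)[OF that] by simp
  have eq: "tensor_induced V' W' h A = R.fibre (L (tens_coord \<phi> \<psi> A))"
    unfolding tensor_induced_def using co ne by auto
  obtain f where "f \<in> A" using ne by auto
  then have m: "L (tens_coord \<phi> \<psi> A) \<in> funs_on (tens_index B' C')" using fe R.ev_funs_on by metis
  show "tensor_induced V' W' h A \<in> carrier (tensor_space V' W')"
    unfolding eq R.carrier_tensor using m by blast
  show "tens_coord \<phi>' \<psi>' (tensor_induced V' W' h A) = L (tens_coord \<phi> \<psi> A)"
    unfolding eq by (rule R.tens_coord_fibre[OF m])
qed

section \<open>Representations with a basis\<close>

text \<open>
  Embeddings that are onto amount to a basis at every vertex, indexed by the elements of \<open>B\<close> that lie
  there.
\<close>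

locale coord_rep = embedded_rep Q V B v a \<phi>
  for Q :: "('v, 'a) pre_digraph" and V :: "('k::field, 'x, 'v, 'a) rep"
    and B :: "'b set" and v :: "'b \<Rightarrow> 'v" and a :: "'a \<Rightarrow> 'b \<Rightarrow> 'b \<Rightarrow> 'k"
    and \<phi> :: "'v \<Rightarrow> 'x \<Rightarrow> 'b \<Rightarrow> 'k" +
  assumes surj: "i \<in> verts Q \<Longrightarrow> \<phi> i ` carrier (space V i) = funs_on {b \<in> B. v b = i}"
begin

lemma total_funs_whole: "total_funs whole = funs_on B"
proof
  show "funs_on B \<subseteq> total_funs whole"
  proof
    fix f :: "'b \<Rightarrow> 'k" assume "f \<in> funs_on B"
    then show "f \<in> total_funs whole" unfolding total_funs_def using funs_on_proj[of f B v] surj by simp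
  qed
qed (rule total_funs_whole_subset)

lemma coord_space_vertex:
  assumes i: "i \<in> verts Q"
  shows "coord_space (space V i) {b \<in> B. v b = i} (\<phi> i)"
proof
  show "bij_betw (\<phi> i) (carrier (space V i)) (funs_on {b \<in> B. v b = i})"
    using inj[OF i] surj[OF i] by (simp add: bij_betw_def)
qed (use i finB closed hom_zero hom_add hom_smult in auto)

end

lemma linear_map_by_coords:
  assumes "coord_space X C \<phi>" and "coord_space Y D \<psi>"
    and f: "\<And>x. x \<in> carrier X \<Longrightarrow> f x \<in> carrier Y"
    and coords: "\<And>x. x \<in> carrier X \<Longrightarrow> \<psi> (f x) = L (\<phi> x)"
    and L: "\<And>g h. L (g + h) = L g + L h" "\<And>c g. L (scal c g) = scal c (L g)"
  shows "linear_map class_ring X Y f"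
proof -
  interpret X: coord_space X C \<phi> by (rule assms(1))
  interpret Y: coord_space Y D \<psi> by (rule assms(2))
  have "f (x \<oplus>\<^bsub>X\<^esub> y) = f x \<oplus>\<^bsub>Y\<^esub> f y" if "x \<in> carrier X" "y \<in> carrier X" for x y
    using that Y.inj[of "f (x \<oplus>\<^bsub>X\<^esub> y)" "f x \<oplus>\<^bsub>Y\<^esub> f y"]
    by (simp add: f coords X.add_closed Y.add_closed X.hom_add Y.hom_add L)
  moreover have "f (c \<odot>\<^bsub>X\<^esub> x) = c \<odot>\<^bsub>Y\<^esub> f x" if "x \<in> carrier X" for c x
    using that Y.inj[of "f (c \<odot>\<^bsub>X\<^esub> x)" "c \<odot>\<^bsub>Y\<^esub> f x"]
    by (simp add: f coords X.smult_closed Y.smult_closed X.hom_smult Y.hom_smult L)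
  ultimately have "f \<in> LinearCombinations.module_hom class_ring X Y"
    using f by (auto simp: LinearCombinations.module_hom_def)
  then show ?thesis
    using X.vs Y.vs by (simp add: linear_map_def mod_hom_def mod_hom_axioms_def vectorspace_def)
qed

text \<open>
  The structure maps are linear because in coordinates they are given by matrices.
\<close>

lemma coord_repI:
  fixes W :: "('k::field, 'x, 'v, 'a) rep" and Q :: "('v, 'a) pre_digraph"
  assumes wf: "wf_digraph Q" and fin: "finite B" and vB: "v ` B \<subseteq> verts Q"
    and cs: "\<And>i. i \<in> verts Q \<Longrightarrow> coord_space (space W i) {b \<in> B. v b = i} (\<phi> i)"
    and mor: "\<And>\<alpha> x. \<alpha> \<in> arcs Q \<Longrightarrow> x \<in> carrier (space W (tail Q \<alpha>)) \<Longrightarrow>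
      mor W \<alpha> x \<in> carrier (space W (head Q \<alpha>)) \<and>
      \<phi> (head Q \<alpha>) (mor W \<alpha> x) = mat_op B (a \<alpha>) (\<phi> (tail Q \<alpha>) x)"
    and supp: "\<And>\<alpha> b b'. \<alpha> \<in> arcs Q \<Longrightarrow> b \<in> B \<Longrightarrow> b' \<in> B \<Longrightarrow> a \<alpha> b' b \<noteq> 0 \<Longrightarrow>
      v b = tail Q \<alpha> \<and> v b' = head Q \<alpha>"
  shows "coord_rep Q W B v a \<phi>"
proof
  have ends: "tail Q \<alpha> \<in> verts Q" "head Q \<alpha> \<in> verts Q" if "\<alpha> \<in> arcs Q" for \<alpha>
    using wf that by (auto simp: wf_digraph_def)
  show "\<And>e. e \<in> arcs Q \<Longrightarrow> tail Q e \<in> verts Q" "\<And>e. e \<in> arcs Q \<Longrightarrow> head Q e \<in> verts Q"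
    by (fact ends)+
  show "is_rep Q W" unfolding is_rep_def
  proof (intro conjI ballI)
    fix i assume "i \<in> verts Q"
    then show "vectorspace class_ring (space W i)" by (rule coord_space.vs[OF cs])
  next
    fix \<alpha> assume \<alpha>: "\<alpha> \<in> arcs Q"
    show "linear_map class_ring (space W (tail Q \<alpha>)) (space W (head Q \<alpha>)) (mor W \<alpha>)"
      by (rule linear_map_by_coords[OF cs[OF ends(1)[OF \<alpha>]] cs[OF ends(2)[OF \<alpha>]],
            where L = "mat_op B (a \<alpha>)"])
         (use mor[OF \<alpha>] in \<open>auto simp: mat_op_add mat_op_scal\<close>)
  qed
  show "\<phi> i ` carrier (space W i) = funs_on {b \<in> B. v b = i}" if "i \<in> verts Q" for i
    using coord_space.bij[OF cs[OF that]] by (simp add: bij_betw_def)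
  show "inj_on (\<phi> i) (carrier (space W i))" if "i \<in> verts Q" for i
    using coord_space.bij[OF cs[OF that]] by (simp add: bij_betw_def)
  show "\<phi> i x \<in> funs_on {b \<in> B. v b = i}" if "i \<in> verts Q" "x \<in> carrier (space W i)" for i x
    using coord_space.into[OF cs[OF that(1)] that(2)] .
  show "\<phi> i (x \<oplus>\<^bsub>space W i\<^esub> y) = \<phi> i x + \<phi> i y"
    if "i \<in> verts Q" "x \<in> carrier (space W i)" "y \<in> carrier (space W i)" for i x y
    using coord_space.hom_add[OF cs[OF that(1)] that(2,3)] .
  show "\<phi> i (c \<odot>\<^bsub>space W i\<^esub> x) = scal c (\<phi> i x)"
    if "i \<in> verts Q" "x \<in> carrier (space W i)" for i x c
    using coord_space.hom_smult[OF cs[OF that(1)] that(2)] .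
qed (use assms in auto)

text \<open>
  The basis is tagged with \<open>i\<close> so that bases of different spaces can be united disjointly.
\<close>

lemma ex_coord_space:
  fixes X :: "('k::field, 'x) module" and i :: 'i
  assumes "vectorspace class_ring X" and "vectorspace.fin_dim class_ring X"
  shows "\<exists>(A :: 'x set) \<phi>. card A = vectorspace.dim class_ring X \<and> coord_space X ({i} \<times> A) \<phi>"
proof -
  interpret X: vectorspace class_ring X by (rule assms(1))
  obtain A where A: "finite A" "X.basis A" using X.finite_basis_exists[OF assms(2)] by blast
  have AX: "A \<subseteq> carrier X" using A by (simp add: X.basis_def)
  have ex1: "\<exists>!c. c \<in> A \<rightarrow>\<^sub>E UNIV \<and> X.lincomb c A = x" if "x \<in> carrier X" for x
    using X.basis_criterion[OF A(1) AX] A(2) that by simp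
  define co where "co x = (THE c. c \<in> A \<rightarrow>\<^sub>E (UNIV :: 'k set) \<and> X.lincomb c A = x)" for x
  have co: "co x \<in> A \<rightarrow>\<^sub>E UNIV" "X.lincomb (co x) A = x" if "x \<in> carrier X" for x
    using theI'[OF ex1[OF that]] by (auto simp: co_def)
  have co_eq: "co x = restrict c A" if "X.lincomb c A = x" for x c
  proof -
    have "X.lincomb (restrict c A) A = X.lincomb c A"
      using AX by (intro X.lincomb_cong) auto
    moreover have "X.lincomb c A \<in> carrier X" using AX by (intro X.lincomb_closed) auto
    ultimately show ?thesis unfolding co_def using ex1[of x] that by (intro the1_equality) auto
  qed
  define \<phi> where "\<phi> x = (\<lambda>(k, y). if k = i \<and> y \<in> A then co x y else 0)" for x
  have "coord_space X ({i} \<times> A) \<phi>"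
  proof
    show "finite ({i} \<times> A)" using A by simp
    show "\<zero>\<^bsub>X\<^esub> \<in> carrier X" by simp
    show "x \<oplus>\<^bsub>X\<^esub> y \<in> carrier X" if "x \<in> carrier X" "y \<in> carrier X" for x y using that by simp
    show sc: "c \<odot>\<^bsub>X\<^esub> x \<in> carrier X" if "x \<in> carrier X" for c x using that by simp
    show add: "\<phi> (x \<oplus>\<^bsub>X\<^esub> y) = \<phi> x + \<phi> y" if xy: "x \<in> carrier X" "y \<in> carrier X" for x y
    proof -
      have "X.lincomb (\<lambda>z. co x z \<oplus>\<^bsub>class_ring\<^esub> co y z) A = x \<oplus>\<^bsub>X\<^esub> y"
        using X.lincomb_sum[OF A(1) AX, of "co x" "co y"] co xy by auto
      then have "co (x \<oplus>\<^bsub>X\<^esub> y) = restrict (\<lambda>z. co x z \<oplus>\<^bsub>class_ring\<^esub> co y z) A" by (rule co_eq)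
      then show ?thesis by (auto simp: \<phi>_def fun_eq_iff)
    qed
    show smul: "\<phi> (c \<odot>\<^bsub>X\<^esub> x) = scal c (\<phi> x)" if x: "x \<in> carrier X" for c x
    proof -
      have "X.lincomb (\<lambda>z. c \<otimes>\<^bsub>class_ring\<^esub> co x z) A = c \<odot>\<^bsub>X\<^esub> x"
        using X.lincomb_smult[OF AX, of "co x" c] co x by auto
      then have "co (c \<odot>\<^bsub>X\<^esub> x) = restrict (\<lambda>z. c \<otimes>\<^bsub>class_ring\<^esub> co x z) A" by (rule co_eq)
      then show ?thesis by (auto simp: \<phi>_def fun_eq_iff scal_def)
    qed
    have "\<phi> (\<zero>\<^bsub>X\<^esub> \<oplus>\<^bsub>X\<^esub> \<zero>\<^bsub>X\<^esub>) = \<phi> \<zero>\<^bsub>X\<^esub> + \<phi> \<zero>\<^bsub>X\<^esub>" by (rule add) simp_all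
    then show "\<phi> \<zero>\<^bsub>X\<^esub> = 0" by simp
    show "bij_betw \<phi> (carrier X) (funs_on ({i} \<times> A))" unfolding bij_betw_def
    proof
      show "inj_on \<phi> (carrier X)"
      proof (rule inj_onI)
        fix x y assume xy: "x \<in> carrier X" "y \<in> carrier X" "\<phi> x = \<phi> y"
        have "co x z = co y z" if "z \<in> A" for z
          using fun_cong[OF xy(3), of "(i, z)"] that by (simp add: \<phi>_def)
        then have "co x = co y" by (intro PiE_ext[OF co(1)[OF xy(1)] co(1)[OF xy(2)]])
        then have "X.lincomb (co x) A = X.lincomb (co y) A" by (rule arg_cong)
        then show "x = y" unfolding co(2)[OF xy(1)] co(2)[OF xy(2)] .
      qed
      show "\<phi> ` carrier X = funs_on ({i} \<times> A)"
      proof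
        show "\<phi> ` carrier X \<subseteq> funs_on ({i} \<times> A)" by (auto simp: \<phi>_def funs_on_def)
        show "funs_on ({i} \<times> A) \<subseteq> \<phi> ` carrier X"
        proof
          fix f :: "'i \<times> 'x \<Rightarrow> 'k" assume f: "f \<in> funs_on ({i} \<times> A)"
          let ?x = "X.lincomb (\<lambda>y. f (i, y)) A"
          have "co ?x = restrict (\<lambda>y. f (i, y)) A" by (rule co_eq) simp
          then have "\<phi> ?x = f" using f by (auto simp: \<phi>_def funs_on_def fun_eq_iff)
          moreover have "?x \<in> carrier X" using AX by (intro X.lincomb_closed) auto
          ultimately show "f \<in> \<phi> ` carrier X" by (rule image_eqI[OF sym])
        qed
      qed
    qed
  qed
  moreover have "card A = X.dim" using X.dim_basis[OF A] by simp
  ultimately show ?thesis by (intro exI[of _ A] exI[of _ \<phi>] conjI)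
qed

lemma ex_coord_rep:
  fixes Q :: "('v, 'a) pre_digraph" and M :: "('k::field, 'x, 'v, 'a) rep"
  assumes wf: "wf_digraph Q" and fin: "finite (verts Q)" and rep: "is_rep Q M"
    and fd: "finite_dimensional Q M"
  shows "\<exists>(C :: ('v \<times> 'x) set) c \<psi>. coord_rep Q M C fst c \<psi> \<and>
    (\<forall>k\<in>verts Q. card {b \<in> C. fst b = k} = dim_at M k)"
proof -
  have "\<forall>i\<in>verts Q. \<exists>(A :: 'x set) \<phi>. card A = dim_at M i \<and> coord_space (space M i) ({i} \<times> A) \<phi>"
  proof
    fix i assume "i \<in> verts Q"
    then show "\<exists>(A :: 'x set) \<phi>. card A = dim_at M i \<and> coord_space (space M i) ({i} \<times> A) \<phi>"
      unfolding dim_at_def using rep fd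
      by (intro ex_coord_space) (simp_all add: is_rep_def finite_dimensional_def)
  qed
  from bchoice[OF this] obtain A :: "'v \<Rightarrow> 'x set" where
    "\<forall>i\<in>verts Q. \<exists>\<phi>. card (A i) = dim_at M i \<and> coord_space (space M i) ({i} \<times> A i) \<phi>" by blast
  from bchoice[OF this] obtain \<psi> where A': "\<forall>i\<in>verts Q. card (A i) = dim_at M i \<and>
    coord_space (space M i) ({i} \<times> A i) (\<psi> i)" by blast
  have A: "card (A i) = dim_at M i" "coord_space (space M i) ({i} \<times> A i) (\<psi> i)"
    if "i \<in> verts Q" for i using A' that by auto
  define C where "C = Sigma (verts Q) A"
  have Ci: "{b \<in> C. fst b = i} = {i} \<times> A i" if "i \<in> verts Q" for i
    using that by (auto simp: C_def)
  define c where "c \<alpha> b' b = (if fst b = tail Q \<alpha> \<and> fst b' = head Q \<alpha>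
    then \<psi> (head Q \<alpha>) (mor M \<alpha> (coord_space.elem (space M (tail Q \<alpha>)) (\<psi> (tail Q \<alpha>)) (delta b))) b'
    else 0)" for \<alpha> b' b
  have finA: "finite (A i)" if "i \<in> verts Q" for i
    using coord_space.fin[OF A(2)[OF that]] by (auto simp: finite_cartesian_product_iff)
  have finC: "finite C" unfolding C_def using fin finA by blast
  have cs: "coord_space (space M i) {b \<in> C. fst b = i} (\<psi> i)" if "i \<in> verts Q" for i
    using A(2)[OF that] Ci[OF that] by simp
  have "coord_rep Q M C fst c \<psi>"
  proof (rule coord_repI[OF wf finC _ cs])
    fix \<alpha> x assume \<alpha>: "\<alpha> \<in> arcs Q" and x: "x \<in> carrier (space M (tail Q \<alpha>))"
    have e: "tail Q \<alpha> \<in> verts Q" "head Q \<alpha> \<in> verts Q" using wf \<alpha> by (auto simp: wf_digraph_def)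
    interpret X: coord_space "space M (tail Q \<alpha>)" "{b \<in> C. fst b = tail Q \<alpha>}" "\<psi> (tail Q \<alpha>)" by (rule cs[OF e(1)])
    interpret Y: coord_space "space M (head Q \<alpha>)" "{b \<in> C. fst b = head Q \<alpha>}" "\<psi> (head Q \<alpha>)" by (rule cs[OF e(2)])
    have lm: "linear_map class_ring (space M (tail Q \<alpha>)) (space M (head Q \<alpha>)) (mor M \<alpha>)"
      using rep \<alpha> by (simp add: is_rep_def)
    then have hom: "mor M \<alpha> \<in> LinearCombinations.module_hom class_ring (space M (tail Q \<alpha>)) (space M (head Q \<alpha>))"
      by (simp add: linear_map_def mod_hom_def mod_hom_axioms_def)
    have mc: "mor M \<alpha> x \<in> carrier (space M (head Q \<alpha>))" if "x \<in> carrier (space M (tail Q \<alpha>))" for x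
      using hom that by (auto simp: LinearCombinations.module_hom_def)
    let ?L = "\<lambda>x. \<psi> (head Q \<alpha>) (mor M \<alpha> x)"
    have "?L x - (\<Sum>b\<in>{b \<in> C. fst b = tail Q \<alpha>}. scal (\<psi> (tail Q \<alpha>) x b) (?L (X.elem (delta b)))) \<in> {0}"
    proof (rule X.expansion[where G = ?L and H = "\<lambda>c x. scal c (?L x)"])
      show "?L (x \<oplus>\<^bsub>space M (tail Q \<alpha>)\<^esub> y) - ?L x - ?L y \<in> {0}"
        if "x \<in> carrier (space M (tail Q \<alpha>))" "y \<in> carrier (space M (tail Q \<alpha>))" for x y
        using that hom Y.hom_add[OF mc mc] by (simp add: LinearCombinations.module_hom_def)
      show "?L (k \<odot>\<^bsub>space M (tail Q \<alpha>)\<^esub> x) - scal k (?L x) \<in> {0}"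
        if "x \<in> carrier (space M (tail Q \<alpha>))" for k x
        using that hom Y.hom_smult[OF mc] by (simp add: LinearCombinations.module_hom_def)
    qed (use x in auto)
    then have L: "?L x = (\<Sum>b\<in>{b \<in> C. fst b = tail Q \<alpha>}. scal (\<psi> (tail Q \<alpha>) x b) (?L (X.elem (delta b))))"
      by simp
    have "?L x b' = mat_op C (c \<alpha>) (\<psi> (tail Q \<alpha>) x) b'" for b'
    proof (cases "b' \<in> C \<and> fst b' = head Q \<alpha>")
      case True
      have "?L x b' = (\<Sum>b\<in>{b \<in> C. fst b = tail Q \<alpha>}. \<psi> (tail Q \<alpha>) x b * ?L (X.elem (delta b)) b')"
        by (subst L) (simp add: sum_fun_apply scal_def)
      also have "\<dots> = (\<Sum>b\<in>C. c \<alpha> b' b * \<psi> (tail Q \<alpha>) x b)"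
        using finC True by (intro sum.mono_neutral_cong_left) (auto simp: c_def)
      finally show ?thesis using True by (simp add: mat_op_def)
    next
      case False
      then have "b' \<notin> {b \<in> C. fst b = head Q \<alpha>}" by blast
      then have "?L x b' = 0" using Y.into[OF mc[OF x]] unfolding funs_on_def by blast
      then show ?thesis using False by (auto simp: mat_op_def c_def)
    qed
    then show "mor M \<alpha> x \<in> carrier (space M (head Q \<alpha>)) \<and>
      ?L x = mat_op C (c \<alpha>) (\<psi> (tail Q \<alpha>) x)" using mc[OF x] by blast
  next
    fix \<alpha> b b' assume "c \<alpha> b' b \<noteq> 0"
    then show "fst b = tail Q \<alpha> \<and> fst b' = head Q \<alpha>" by (simp add: c_def split: if_splits)
  qed (auto simp: C_def)
  moreover have "card {b \<in> C. fst b = k} = dim_at M k" if "k \<in> verts Q" for k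
    using Ci[OF that] A(1)[OF that] by (simp add: card_cartesian_product)
  ultimately show ?thesis by blast
qed

lemma coord_rep_iso:
  assumes 1: "coord_rep Q V B v a \<phi>" and 2: "coord_rep Q W B v a \<phi>'"
  shows "rep_iso Q V W"
proof -
  interpret V: coord_rep Q V B v a \<phi> by (rule 1)
  interpret W: coord_rep Q W B v a \<phi>' by (rule 2)
  define \<theta> where "\<theta> i x = coord_space.elem (space W i) (\<phi>' i) (\<phi> i x)" for i x
  have \<theta>: "\<theta> i x \<in> carrier (space W i)" "\<phi>' i (\<theta> i x) = \<phi> i x"
    if "i \<in> verts Q" "x \<in> carrier (space V i)" for i x
    unfolding \<theta>_def using coord_space.elem[OF W.coord_space_vertex[OF that(1)] V.into[OF that]] by auto
  have eqI: "y = y'" if "i \<in> verts Q" "y \<in> carrier (space W i)" "y' \<in> carrier (space W i)" "\<phi>' i y = \<phi>' i y'" for i y y'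
    using inj_onD[OF W.inj[OF that(1)] that(4,2,3)] .
  show ?thesis unfolding rep_iso_def
  proof (intro exI[of _ \<theta>] conjI ballI)
    fix i assume i: "i \<in> verts Q"
    show "linear_map class_ring (space V i) (space W i) (\<theta> i)"
      by (rule linear_map_by_coords[OF V.coord_space_vertex[OF i] W.coord_space_vertex[OF i],
            where L = "\<lambda>f. f"]) (use \<theta>[OF i] in auto)
    show "bij_betw (\<theta> i) (carrier (space V i)) (carrier (space W i))" unfolding bij_betw_def
    proof
      show "inj_on (\<theta> i) (carrier (space V i))"
        using \<theta>(2)[OF i] V.inj[OF i] by (metis (no_types, lifting) inj_onD inj_onI)
      show "\<theta> i ` carrier (space V i) = carrier (space W i)"
      proof
        show "\<theta> i ` carrier (space V i) \<subseteq> carrier (space W i)" using \<theta>(1)[OF i] by blast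
        show "carrier (space W i) \<subseteq> \<theta> i ` carrier (space V i)"
        proof
          fix y assume y: "y \<in> carrier (space W i)"
          then have "\<phi>' i y \<in> \<phi> i ` carrier (space V i)" using V.surj[OF i] W.into[OF i y] by simp
          then obtain x where x: "x \<in> carrier (space V i)" "\<phi>' i y = \<phi> i x" by blast
          then have "y = \<theta> i x" using \<theta>[OF i x(1)] y by (intro eqI[OF i]) auto
          then show "y \<in> \<theta> i ` carrier (space V i)" using x by blast
        qed
      qed
    qed
  next
    fix \<alpha> x assume \<alpha>: "\<alpha> \<in> arcs Q" and x: "x \<in> carrier (space V (tail Q \<alpha>))"
    note e = V.ends[OF \<alpha>]
    show "\<theta> (head Q \<alpha>) (mor V \<alpha> x) = mor W \<alpha> (\<theta> (tail Q \<alpha>) x)"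
      by (rule eqI[OF e(2)])
         (simp_all add: \<theta> e V.mor_closed[OF \<alpha>] W.mor_closed[OF \<alpha>] x V.hom_mor[OF \<alpha>] W.hom_mor[OF \<alpha>])
  qed
qed

lemma coord_rep_transfer:
  assumes 1: "coord_rep Q V B v a \<phi>" and W: "is_rep Q W" and iso: "rep_iso Q V W"
  shows "\<exists>\<phi>'. coord_rep Q W B v a \<phi>'"
proof -
  interpret V: coord_rep Q V B v a \<phi> by (rule 1)
  obtain \<theta> where \<theta>: "\<And>i. i \<in> verts Q \<Longrightarrow> linear_map class_ring (space V i) (space W i) (\<theta> i)"
      "\<And>i. i \<in> verts Q \<Longrightarrow> bij_betw (\<theta> i) (carrier (space V i)) (carrier (space W i))"
      "\<And>\<alpha> x. \<alpha> \<in> arcs Q \<Longrightarrow> x \<in> carrier (space V (tail Q \<alpha>)) \<Longrightarrow>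
        \<theta> (head Q \<alpha>) (mor V \<alpha> x) = mor W \<alpha> (\<theta> (tail Q \<alpha>) x)"
    using iso unfolding rep_iso_def by blast
  define \<theta>' where "\<theta>' i = inv_into (carrier (space V i)) (\<theta> i)" for i
  have \<theta>': "\<theta>' i y \<in> carrier (space V i)" "\<theta> i (\<theta>' i y) = y"
    if "i \<in> verts Q" "y \<in> carrier (space W i)" for i y
    using \<theta>(2)[OF that(1)] that(2) unfolding \<theta>'_def bij_betw_def
    by (auto intro: inv_into_into f_inv_into_f)
  have \<theta>'\<theta>: "\<theta>' i (\<theta> i x) = x" if "i \<in> verts Q" "x \<in> carrier (space V i)" for i x
    using \<theta>(2)[OF that(1)] that(2) unfolding \<theta>'_def bij_betw_def by (auto intro: inv_into_f_f)
  have "coord_rep Q W B v a (\<lambda>i y. \<phi> i (\<theta>' i y))"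
  proof (rule coord_repI[OF V.wf V.finB V.vB])
    fix i assume i: "i \<in> verts Q"
    interpret X: coord_space "space V i" "{b \<in> B. v b = i}" "\<phi> i" by (rule V.coord_space_vertex[OF i])
    interpret WI: vectorspace class_ring "space W i" using W i by (simp add: is_rep_def)
    have hom: "\<theta> i \<in> LinearCombinations.module_hom class_ring (space V i) (space W i)"
      using \<theta>(1)[OF i] by (simp add: linear_map_def mod_hom_def mod_hom_axioms_def)
    have ad: "\<theta>' i (x \<oplus>\<^bsub>space W i\<^esub> y) = \<theta>' i x \<oplus>\<^bsub>space V i\<^esub> \<theta>' i y"
      if "x \<in> carrier (space W i)" "y \<in> carrier (space W i)" for x y
    proof -
      have "\<theta> i (\<theta>' i x \<oplus>\<^bsub>space V i\<^esub> \<theta>' i y) = x \<oplus>\<^bsub>space W i\<^esub> y"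
        using hom \<theta>'[OF i that(1)] \<theta>'[OF i that(2)] by (auto simp: LinearCombinations.module_hom_def)
      then show ?thesis using \<theta>'\<theta>[OF i X.add_closed[OF \<theta>'(1)[OF i that(1)] \<theta>'(1)[OF i that(2)]]] by simp
    qed
    have sm: "\<theta>' i (c \<odot>\<^bsub>space W i\<^esub> x) = c \<odot>\<^bsub>space V i\<^esub> \<theta>' i x" if "x \<in> carrier (space W i)" for c x
    proof -
      have "\<theta> i (c \<odot>\<^bsub>space V i\<^esub> \<theta>' i x) = c \<odot>\<^bsub>space W i\<^esub> x"
        using hom \<theta>'[OF i that] by (auto simp: LinearCombinations.module_hom_def)
      then show ?thesis using \<theta>'\<theta>[OF i X.smult_closed[OF \<theta>'(1)[OF i that]]] by (metis)
    qed
    show "coord_space (space W i) {b \<in> B. v b = i} (\<lambda>y. \<phi> i (\<theta>' i y))"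
    proof
      have "bij_betw (\<theta>' i) (carrier (space W i)) (carrier (space V i))"
        unfolding \<theta>'_def by (rule bij_betw_inv_into[OF \<theta>(2)[OF i]])
      from bij_betw_trans[OF this X.bij]
      show "bij_betw (\<lambda>y. \<phi> i (\<theta>' i y)) (carrier (space W i)) (funs_on {b \<in> B. v b = i})"
        by (simp add: comp_def)
      have "\<theta>' i (\<zero>\<^bsub>space W i\<^esub> \<oplus>\<^bsub>space W i\<^esub> \<zero>\<^bsub>space W i\<^esub>) = \<theta>' i \<zero>\<^bsub>space W i\<^esub> \<oplus>\<^bsub>space V i\<^esub> \<theta>' i \<zero>\<^bsub>space W i\<^esub>"
        by (rule ad) simp_all
      then have "\<phi> i (\<theta>' i \<zero>\<^bsub>space W i\<^esub>) = \<phi> i (\<theta>' i \<zero>\<^bsub>space W i\<^esub>) + \<phi> i (\<theta>' i \<zero>\<^bsub>space W i\<^esub>)"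
        using X.hom_add[OF \<theta>'(1)[OF i WI.zero_closed] \<theta>'(1)[OF i WI.zero_closed]] by simp
      then show "\<phi> i (\<theta>' i \<zero>\<^bsub>space W i\<^esub>) = 0" by simp
    qed (use X.fin X.hom_add X.hom_smult \<theta>'(1)[OF i] ad sm in auto)
  next
    fix \<alpha> y assume \<alpha>: "\<alpha> \<in> arcs Q" and y: "y \<in> carrier (space W (tail Q \<alpha>))"
    note e = V.ends[OF \<alpha>]
    let ?x = "\<theta>' (tail Q \<alpha>) y"
    have x: "?x \<in> carrier (space V (tail Q \<alpha>))" "\<theta> (tail Q \<alpha>) ?x = y" using \<theta>'[OF e(1) y] by auto
    have m: "mor W \<alpha> y = \<theta> (head Q \<alpha>) (mor V \<alpha> ?x)" using \<theta>(3)[OF \<alpha> x(1)] x(2) by simp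
    have mx: "mor V \<alpha> ?x \<in> carrier (space V (head Q \<alpha>))" by (rule V.mor_closed[OF \<alpha> x(1)])
    have "mor W \<alpha> y \<in> carrier (space W (head Q \<alpha>))"
      unfolding m using \<theta>(2)[OF e(2)] mx by (auto simp: bij_betw_def)
    moreover have "\<theta>' (head Q \<alpha>) (mor W \<alpha> y) = mor V \<alpha> ?x" unfolding m by (rule \<theta>'\<theta>[OF e(2) mx])
    ultimately show "mor W \<alpha> y \<in> carrier (space W (head Q \<alpha>)) \<and>
      \<phi> (head Q \<alpha>) (\<theta>' (head Q \<alpha>) (mor W \<alpha> y)) = mat_op B (a \<alpha>) (\<phi> (tail Q \<alpha>) ?x)"
      using V.hom_mor[OF \<alpha> x(1)] by simp
  qed (use V.mat_supp in auto)
  then show ?thesis by blast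
qed

text \<open>
  An enumeration of the index set turns column vectors into functions on it.
\<close>

lemma coord_space_vec:
  fixes C :: "'b set"
  assumes "finite C"
  shows "\<exists>\<phi>. coord_space (module_vec TYPE('k::field) (card C)) C \<phi>"
proof -
  obtain h where h: "bij_betw h {..<card C} C"
    using ex_bij_betw_nat_finite[OF assms] by (auto simp: atLeast0LessThan)
  define g where "g = inv_into {..<card C} h"
  have g: "g b < card C" "h (g b) = b" if "b \<in> C" for b
    using h that unfolding g_def bij_betw_def
    by (auto intro: f_inv_into_f) (metis inv_into_into lessThan_iff)
  have gh: "g (h t) = t" "h t \<in> C" if "t < card C" for t
    using h that unfolding g_def bij_betw_def by auto
  define \<phi> where "\<phi> y = (\<lambda>b. if b \<in> C then y $ g b else 0 :: 'k)" for y
  have "coord_space (module_vec TYPE('k) (card C)) C \<phi>"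
  proof
    show "bij_betw \<phi> (carrier (module_vec TYPE('k) (card C))) (funs_on C)"
    proof (rule bij_betw_byWitness[where f' = "\<lambda>f. vec (card C) (\<lambda>t. f (h t))"])
      show "\<forall>y\<in>carrier (module_vec TYPE('k) (card C)). vec (card C) (\<lambda>t. \<phi> y (h t)) = y"
        by (auto simp: module_vec_simps \<phi>_def gh intro!: eq_vecI)
      show "\<forall>f\<in>funs_on C. \<phi> (vec (card C) (\<lambda>t. f (h t))) = f"
        by (auto simp: \<phi>_def g funs_on_def fun_eq_iff)
    qed (auto simp: module_vec_simps \<phi>_def funs_on_def)
  qed (auto simp: module_vec_simps \<phi>_def assms g scal_def fun_eq_iff)
  then show ?thesis by blast
qed

lemma coord_rep_vec:
  fixes V :: "('k::field, 'x, 'v, 'a) rep"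
  assumes 1: "coord_rep Q V B v a \<phi>"
  shows "\<exists>(W :: ('k, 'k vec, 'v, 'a) rep) \<phi>'. coord_rep Q W B v a \<phi>'"
proof -
  interpret V: coord_rep Q V B v a \<phi> by (rule 1)
  have "\<forall>i. \<exists>\<phi>'. coord_space (module_vec TYPE('k) (card {b \<in> B. v b = i})) {b \<in> B. v b = i} \<phi>'"
    by (intro allI coord_space_vec) (simp add: V.finB)
  then obtain \<phi>' where \<phi>': "\<And>i. coord_space (module_vec TYPE('k) (card {b \<in> B. v b = i})) {b \<in> B. v b = i} (\<phi>' i)"
    by metis
  define sp where "sp i = module_vec TYPE('k) (card {b \<in> B. v b = i})" for i
  define W :: "('k, 'k vec, 'v, 'a) rep" where
    "W = \<lparr>space = sp,
      mor = (\<lambda>\<alpha> y. coord_space.elem (sp (head Q \<alpha>)) (\<phi>' (head Q \<alpha>)) (mat_op B (a \<alpha>) (\<phi>' (tail Q \<alpha>) y)))\<rparr>"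
  have "coord_rep Q W B v a \<phi>'"
  proof (rule coord_repI[OF V.wf V.finB V.vB])
    show "coord_space (space W i) {b \<in> B. v b = i} (\<phi>' i)" for i
      using \<phi>' by (simp add: W_def sp_def)
    fix \<alpha> y assume \<alpha>: "\<alpha> \<in> arcs Q"
    interpret Y: coord_space "sp (head Q \<alpha>)" "{b \<in> B. v b = head Q \<alpha>}" "\<phi>' (head Q \<alpha>)"
      unfolding sp_def by (rule \<phi>')
    have "mat_op B (a \<alpha>) f \<in> funs_on {b \<in> B. v b = head Q \<alpha>}" for f
      using funs_on_proj[OF funs_on_mat_op[of B "a \<alpha>" f], of v "head Q \<alpha>"] V.proj_mat_op[OF \<alpha>, of "head Q \<alpha>" f] by simp
    then show "mor W \<alpha> y \<in> carrier (space W (head Q \<alpha>)) \<and>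
      \<phi>' (head Q \<alpha>) (mor W \<alpha> y) = mat_op B (a \<alpha>) (\<phi>' (tail Q \<alpha>) y)"
      by (simp add: W_def Y.elem)
  qed (use V.mat_supp in auto)
  then show ?thesis by blast
qed

text \<open>
  A representation with a finite basis has a copy on column vectors, so the choice in \<open>vec_copy\<close> is
  proper; the copy is described by the same matrices.
\<close>

lemma coord_rep_vec_copy:
  fixes V :: "('k::field, 'x, 'v, 'a) rep"
  assumes "coord_rep Q V B v a \<phi>"
  shows "\<exists>\<phi>'. coord_rep Q (vec_copy Q V) B v a \<phi>'"
proof -
  obtain W :: "('k, 'k vec, 'v, 'a) rep" and \<phi>' where W: "coord_rep Q W B v a \<phi>'"
    using coord_rep_vec[OF assms] by blast
  interpret W: coord_rep Q W B v a \<phi>' by (rule W)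
  have "is_rep Q W \<and> rep_iso Q V W" using W.rep coord_rep_iso[OF assms W] by simp
  then have "is_rep Q (vec_copy Q V) \<and> rep_iso Q V (vec_copy Q V)"
    unfolding vec_copy_def by (rule someI)
  then show ?thesis using coord_rep_transfer[OF assms] by blast
qed

text \<open>
  Lists of length one start the description of the powers by lists.
\<close>

lemma coord_rep_singletons:
  fixes V :: "('k::field, 'x, 'v, 'a) rep" and C :: "'b set"
  assumes 1: "coord_rep Q V C w c \<psi>"
  shows "coord_rep Q V ((\<lambda>y. [y]) ` C) (\<lambda>l. w (hd l)) (\<lambda>\<alpha> l' l. c \<alpha> (hd l') (hd l))
    (\<lambda>i x l. case l of [y] \<Rightarrow> \<psi> i x y | _ \<Rightarrow> 0)"
proof -
  interpret V: coord_rep Q V C w c \<psi> by (rule 1)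
  show ?thesis
  proof (rule coord_repI[OF V.wf])
    fix i assume i: "i \<in> verts Q"
    interpret X: coord_space "space V i" "{b \<in> C. w b = i}" "\<psi> i" by (rule V.coord_space_vertex[OF i])
    have idx: "{l \<in> (\<lambda>y. [y]) ` C. w (hd l) = i} = (\<lambda>y. [y]) ` {b \<in> C. w b = i}" by auto
    show "coord_space (space V i) {l \<in> (\<lambda>y. [y]) ` C. w (hd l) = i}
      (\<lambda>x l. case l of [y] \<Rightarrow> \<psi> i x y | _ \<Rightarrow> 0)"
      unfolding idx
    proof
      have "bij_betw (\<lambda>f l. case l of [y] \<Rightarrow> f y | _ \<Rightarrow> 0) (funs_on {b \<in> C. w b = i} :: ('b \<Rightarrow> 'k) set)
        (funs_on ((\<lambda>y. [y]) ` {b \<in> C. w b = i}))"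
        by (rule bij_betw_byWitness[where f' = "\<lambda>g y. g [y]"])
           (auto simp: funs_on_def fun_eq_iff image_iff split: list.splits, blast)
      from bij_betw_trans[OF X.bij this]
      show "bij_betw (\<lambda>x l. case l of [y] \<Rightarrow> \<psi> i x y | _ \<Rightarrow> 0) (carrier (space V i))
        (funs_on ((\<lambda>y. [y]) ` {b \<in> C. w b = i}))" by (simp add: comp_def)
    qed (auto simp: X.fin X.zero_closed X.add_closed X.smult_closed X.hom_zero X.hom_add X.hom_smult
          fun_eq_iff scal_def split: list.splits)
  next
    fix \<alpha> x assume \<alpha>: "\<alpha> \<in> arcs Q" and x: "x \<in> carrier (space V (tail Q \<alpha>))"
    have "(case l' of [y] \<Rightarrow> \<psi> (head Q \<alpha>) (mor V \<alpha> x) y | _ \<Rightarrow> 0) =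
      mat_op ((\<lambda>y. [y]) ` C) (\<lambda>l' l. c \<alpha> (hd l') (hd l)) (\<lambda>l. case l of [y] \<Rightarrow> \<psi> (tail Q \<alpha>) x y | _ \<Rightarrow> 0) l'" for l'
      unfolding V.hom_mor[OF \<alpha> x]
      by (auto simp: mat_op_def sum.reindex inj_on_def split: list.splits)
    then show "mor V \<alpha> x \<in> carrier (space V (head Q \<alpha>)) \<and>
      (\<lambda>l. case l of [y] \<Rightarrow> \<psi> (head Q \<alpha>) (mor V \<alpha> x) y | _ \<Rightarrow> 0) =
      mat_op ((\<lambda>y. [y]) ` C) (\<lambda>l' l. c \<alpha> (hd l') (hd l)) (\<lambda>l. case l of [y] \<Rightarrow> \<psi> (tail Q \<alpha>) x y | _ \<Rightarrow> 0)"
      using V.mor_closed[OF \<alpha> x] by blast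
  qed (use V.finB V.vB V.mat_supp in auto)
qed

section \<open>Tensor products of representations in coordinates\<close>

text \<open>
  The Kronecker product of the matrices of the two factors.
\<close>

definition tens_mat ::
  "('a \<Rightarrow> 'c list \<Rightarrow> 'c list \<Rightarrow> 'k::field) \<Rightarrow> ('a \<Rightarrow> 'c \<Rightarrow> 'c \<Rightarrow> 'k) \<Rightarrow> 'a \<Rightarrow> 'c list \<Rightarrow> 'c list \<Rightarrow> 'k" where
  "tens_mat a c \<alpha> l' l = c \<alpha> (hd l') (hd l) * a \<alpha> (tl l') (tl l)"

lemma sum_tens_index:
  "(\<Sum>l\<in>tens_index B C. F l) = (\<Sum>y\<in>C. \<Sum>xs\<in>B. F (y # xs))"
proof -
  have e: "tens_index B C = (\<lambda>(y, xs). y # xs) ` (C \<times> B)" by (auto simp: tens_index_def)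
  have "inj_on (\<lambda>(y, xs). y # xs) (C \<times> B)" by (auto simp: inj_on_def)
  then show ?thesis unfolding e by (simp add: sum.reindex sum.cartesian_product case_prod_unfold)
qed

lemma mat_op_tens:
  "mat_op (tens_index B C) (tens_mat a c \<alpha>) (tens f g) = tens (mat_op B (a \<alpha>) f) (mat_op C (c \<alpha>) g)"
proof
  fix l'
  show "mat_op (tens_index B C) (tens_mat a c \<alpha>) (tens f g) l' = tens (mat_op B (a \<alpha>) f) (mat_op C (c \<alpha>) g) l'"
  proof (cases l')
    case Nil
    then show ?thesis by (simp add: mat_op_def tens_def tens_index_def)
  next
    case (Cons y' xs')
    have "(\<Sum>l\<in>tens_index B C. tens_mat a c \<alpha> l' l * tens f g l) =
      (\<Sum>y\<in>C. \<Sum>xs\<in>B. (a \<alpha> xs' xs * f xs) * (c \<alpha> y' y * g y))"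
      unfolding sum_tens_index by (simp add: tens_mat_def tens_def Cons mult_ac)
    also have "\<dots> = (\<Sum>xs\<in>B. a \<alpha> xs' xs * f xs) * (\<Sum>y\<in>C. c \<alpha> y' y * g y)"
      by (subst sum.swap) (simp only: sum_product)
    finally show ?thesis by (auto simp: mat_op_def tens_def tens_index_def Cons)
  qed
qed

text \<open>
  Deleting indices with zero row and column does not change the operator.
\<close>

lemma mat_op_restrict:
  assumes "B' \<subseteq> B" "finite B" "\<And>b b'. b \<in> B \<Longrightarrow> b' \<in> B \<Longrightarrow> A b' b \<noteq> 0 \<Longrightarrow> b \<in> B' \<and> b' \<in> B'"
  shows "mat_op B' A = mat_op B A"
proof (intro ext)
  fix f b'
  have z: "A b' b = 0" if "b \<in> B" "b' \<in> B" "b \<notin> B' \<or> b' \<notin> B'" for b using assms(3)[OF that(1,2)] that(3) by blast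
  show "mat_op B' A f b' = mat_op B A f b'"
  proof (cases "b' \<in> B")
    case True
    have "(\<Sum>b\<in>B'. A b' b * f b) = (\<Sum>b\<in>B. A b' b * f b)"
      using assms(1,2) True z by (intro sum.mono_neutral_left) auto
    moreover have "(\<Sum>b\<in>B. A b' b * f b) = 0" if "b' \<notin> B'"
      using True z that by (intro sum.neutral) auto
    ultimately show ?thesis using True assms(1) by (auto simp: mat_op_def)
  next
    case False
    then show ?thesis using assms(1) by (auto simp: mat_op_def)
  qed
qed

text \<open>
  At the vertex \<open>i\<close> the basis consists of the pairs of basis elements of both factors at \<open>i\<close>.  For all
  other pairs the Kronecker product vanishes, so that restricting it to this basis loses nothing.
\<close>

lemma coord_rep_pointwise_tensor:
  assumes 1: "coord_rep Q V B v a \<phi>" and 2: "coord_rep Q M C w c \<psi>"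
  shows "coord_rep Q (pointwise_tensor Q V M) {l \<in> tens_index B C. v (tl l) = w (hd l)}
    (\<lambda>l. w (hd l)) (tens_mat a c) (\<lambda>i. tens_coord (\<phi> i) (\<psi> i))"
proof -
  interpret V: coord_rep Q V B v a \<phi> by (rule 1)
  interpret M: coord_rep Q M C w c \<psi> by (rule 2)
  let ?D = "{l \<in> tens_index B C. v (tl l) = w (hd l)}"
  have fin: "finite (tens_index B C)" by (rule finite_tens_index[OF V.finB M.finB])
  have tc: "tensor_coords (space V i) {b \<in> B. v b = i} (\<phi> i) (space M i) {b \<in> C. w b = i} (\<psi> i)"
    if "i \<in> verts Q" for i
    using V.coord_space_vertex[OF that] M.coord_space_vertex[OF that] by (rule tensor_coords.intro)
  have idx: "{l \<in> ?D. w (hd l) = i} = tens_index {b \<in> B. v b = i} {b \<in> C. w b = i}" for i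
    by (auto simp: tens_index_def)
  have supp: "(v (tl l) = tail Q \<alpha> \<and> w (hd l) = tail Q \<alpha>) \<and> (v (tl l') = head Q \<alpha> \<and> w (hd l') = head Q \<alpha>)"
    if "\<alpha> \<in> arcs Q" "l \<in> tens_index B C" "l' \<in> tens_index B C" "tens_mat a c \<alpha> l' l \<noteq> 0" for \<alpha> l l'
    using that V.mat_supp[OF that(1)] M.mat_supp[OF that(1)] by (auto simp: tens_index_def tens_mat_def)
  show ?thesis
  proof (rule coord_repI[OF V.wf])
    fix i assume i: "i \<in> verts Q"
    show "coord_space (space (pointwise_tensor Q V M) i) {l \<in> ?D. w (hd l) = i} (tens_coord (\<phi> i) (\<psi> i))"
      unfolding idx using tensor_coords.coord_space_tensor[OF tc[OF i]] by (simp add: pointwise_tensor_def)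
  next
    fix \<alpha> A assume \<alpha>: "\<alpha> \<in> arcs Q" and A: "A \<in> carrier (space (pointwise_tensor Q V M) (tail Q \<alpha>))"
    note e = V.ends[OF \<alpha>]
    have A': "A \<in> carrier (tensor_space (space V (tail Q \<alpha>)) (space M (tail Q \<alpha>)))"
      using A by (simp add: pointwise_tensor_def)
    have D: "mat_op ?D (tens_mat a c \<alpha>) = mat_op (tens_index B C) (tens_mat a c \<alpha>)"
      using fin by (rule mat_op_restrict[rotated]) (auto dest: supp[OF \<alpha>])
    let ?h = "\<lambda>(x, y). basis_vec (mor V \<alpha> x, mor M \<alpha> y)"
    note ti = tensor_induced_coords[OF tc[OF e(1)] tc[OF e(2)],
      where L = "mat_op ?D (tens_mat a c \<alpha>)" and h = ?h, OF mat_op_add mat_op_scal _ _ A']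
    have h: "?h (x, y) \<in> carrier (tensor_free (space V (head Q \<alpha>)) (space M (head Q \<alpha>)))"
       "tens_eval (\<phi> (head Q \<alpha>)) (\<psi> (head Q \<alpha>)) (?h (x, y)) =
        mat_op ?D (tens_mat a c \<alpha>) (tens (\<phi> (tail Q \<alpha>) x) (\<psi> (tail Q \<alpha>) y))"
      if x: "x \<in> carrier (space V (tail Q \<alpha>))" and y: "y \<in> carrier (space M (tail Q \<alpha>))" for x y
    proof -
      show "?h (x, y) \<in> carrier (tensor_free (space V (head Q \<alpha>)) (space M (head Q \<alpha>)))"
        using V.mor_closed[OF \<alpha> x] M.mor_closed[OF \<alpha> y]
        by (simp add: tensor_free_def free_space_def basis_vec_def)
      show "tens_eval (\<phi> (head Q \<alpha>)) (\<psi> (head Q \<alpha>)) (?h (x, y)) =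
        mat_op ?D (tens_mat a c \<alpha>) (tens (\<phi> (tail Q \<alpha>) x) (\<psi> (tail Q \<alpha>) y))"
        unfolding D mat_op_tens
        by (simp add: tens_eval_def lin_ext_basis_vec V.hom_mor[OF \<alpha> x] M.hom_mor[OF \<alpha> y])
    qed
    show "mor (pointwise_tensor Q V M) \<alpha> A \<in> carrier (space (pointwise_tensor Q V M) (head Q \<alpha>)) \<and>
      tens_coord (\<phi> (head Q \<alpha>)) (\<psi> (head Q \<alpha>)) (mor (pointwise_tensor Q V M) \<alpha> A) =
      mat_op ?D (tens_mat a c \<alpha>) (tens_coord (\<phi> (tail Q \<alpha>)) (\<psi> (tail Q \<alpha>)) A)"
      using ti[OF h] by (simp add: pointwise_tensor_def)
  next
    fix \<alpha> l l' assume "\<alpha> \<in> arcs Q" "l \<in> ?D" "l' \<in> ?D" "tens_mat a c \<alpha> l' l \<noteq> 0"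
    then show "w (hd l) = tail Q \<alpha> \<and> w (hd l') = head Q \<alpha>" using supp[of \<alpha> l l'] by blast
  qed (use fin M.vB in \<open>auto simp: tens_index_def\<close>)
qed

text \<open>
  Coordinates on the module identified with a representation; its basis is the union of the bases at
  the vertices.
\<close>

definition total_coord ::
  "'b set \<Rightarrow> ('b \<Rightarrow> 'v) \<Rightarrow> ('v \<Rightarrow> 'x \<Rightarrow> 'b \<Rightarrow> 'k::field) \<Rightarrow> ('v \<Rightarrow> 'x) \<Rightarrow> 'b \<Rightarrow> 'k" where
  "total_coord B v \<phi> m = (\<lambda>b. if b \<in> B then \<phi> (v b) (m (v b)) b else 0)"

context coord_rep
begin

lemma total_coord_proj:
  assumes m: "m \<in> carrier (total_space Q V)" and i: "i \<in> verts Q"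
  shows "proj v i (total_coord B v \<phi> m) = \<phi> i (m i)"
proof
  fix b
  have "m i \<in> carrier (space V i)" using m i by (auto simp: total_space_def)
  then have "\<phi> i (m i) \<in> funs_on {b \<in> B. v b = i}" by (rule into[OF i])
  then show "proj v i (total_coord B v \<phi> m) b = \<phi> i (m i) b"
    by (auto simp: proj_def total_coord_def funs_on_def)
qed

lemma coord_space_total: "coord_space (total_space Q V) B (total_coord B v \<phi>)"
proof
  have total_funs: "m i \<in> carrier (space V i)" if "m \<in> carrier (total_space Q V)" "i \<in> verts Q" for m i
    using that by (auto simp: total_space_def)
  have vb: "v b \<in> verts Q" if "b \<in> B" for b using that vB by auto
  show "finite B" by (rule finB)
  show "\<zero>\<^bsub>total_space Q V\<^esub> \<in> carrier (total_space Q V)"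
    by (auto simp: total_space_def closed)
  show "x \<oplus>\<^bsub>total_space Q V\<^esub> y \<in> carrier (total_space Q V)"
    if "x \<in> carrier (total_space Q V)" "y \<in> carrier (total_space Q V)" for x y
    using total_funs[OF that(1)] total_funs[OF that(2)] by (auto simp: total_space_def closed)
  show "c \<odot>\<^bsub>total_space Q V\<^esub> x \<in> carrier (total_space Q V)"
    if "x \<in> carrier (total_space Q V)" for c x
    using total_funs[OF that] by (auto simp: total_space_def closed)
  show "total_coord B v \<phi> \<zero>\<^bsub>total_space Q V\<^esub> = 0"
    by (auto simp: total_coord_def total_space_def fun_eq_iff vb hom_zero)
  show "total_coord B v \<phi> (x \<oplus>\<^bsub>total_space Q V\<^esub> y) = total_coord B v \<phi> x + total_coord B v \<phi> y"
    if "x \<in> carrier (total_space Q V)" "y \<in> carrier (total_space Q V)" for x y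
    using total_funs[OF that(1)] total_funs[OF that(2)] hom_add
    by (auto simp: total_coord_def total_space_def fun_eq_iff vb)
  show "total_coord B v \<phi> (c \<odot>\<^bsub>total_space Q V\<^esub> x) = scal c (total_coord B v \<phi> x)"
    if "x \<in> carrier (total_space Q V)" for c x
    using total_funs[OF that] hom_smult
    by (auto simp: total_coord_def total_space_def fun_eq_iff vb scal_def)
  show "bij_betw (total_coord B v \<phi>) (carrier (total_space Q V)) (funs_on B)" unfolding bij_betw_def
  proof
    show "inj_on (total_coord B v \<phi>) (carrier (total_space Q V))"
    proof (rule inj_onI)
      fix x y assume xy: "x \<in> carrier (total_space Q V)" "y \<in> carrier (total_space Q V)"
        "total_coord B v \<phi> x = total_coord B v \<phi> y"
      have "x i = y i" if i: "i \<in> verts Q" for i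
      proof (rule inj_onD[OF inj[OF i] _ total_funs[OF xy(1) i] total_funs[OF xy(2) i]])
        show "\<phi> i (x i) = \<phi> i (y i)"
          using total_coord_proj[OF xy(1) i] total_coord_proj[OF xy(2) i] xy(3) by simp
      qed
      then show "x = y" using xy(1,2) by (intro PiE_ext[of x "verts Q" "\<lambda>i. carrier (space V i)"])
        (auto simp: total_space_def)
    qed
    show "total_coord B v \<phi> ` carrier (total_space Q V) = funs_on B"
    proof
      show "total_coord B v \<phi> ` carrier (total_space Q V) \<subseteq> funs_on B" by (auto simp: total_coord_def funs_on_def)
      show "funs_on B \<subseteq> total_coord B v \<phi> ` carrier (total_space Q V)"
      proof
        fix f :: "'b \<Rightarrow> 'k" assume f: "f \<in> funs_on B"
        define m where "m = (\<lambda>i\<in>verts Q. coord_space.elem (space V i) (\<phi> i) (proj v i f))"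
        have m: "m i \<in> carrier (space V i)" "\<phi> i (m i) = proj v i f" if "i \<in> verts Q" for i
          using coord_space.elem[OF coord_space_vertex[OF that] funs_on_proj[OF f]] that by (auto simp: m_def)
        have mT: "m \<in> carrier (total_space Q V)" using m(1) by (auto simp: total_space_def m_def)
        have "total_coord B v \<phi> m = f"
          using f m(2) vb by (auto simp: total_coord_def fun_eq_iff funs_on_def proj_def)
        then show "f \<in> total_coord B v \<phi> ` carrier (total_space Q V)" using mT by blast
      qed
    qed
  qed
qed

lemma trivial_path_action:
  assumes m: "m \<in> carrier (total_space Q V)" and s: "s \<in> verts Q"
  shows "path_action Q V (s, []) m \<in> carrier (total_space Q V)"
    and "total_coord B v \<phi> (path_action Q V (s, []) m) = proj v s (total_coord B v \<phi> m)"
proof -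
  have t: "path_target Q (s, []) = s" by (simp add: path_target_def pre_digraph.awalk_verts.simps)
  show "path_action Q V (s, []) m \<in> carrier (total_space Q V)"
    using m s closed(1) by (auto simp: total_space_def path_action_def t)
  show "total_coord B v \<phi> (path_action Q V (s, []) m) = proj v s (total_coord B v \<phi> m)"
    using vB by (auto simp: total_coord_def path_action_def t proj_def fun_eq_iff hom_zero image_subset_iff)
qed

lemma arrow_path_action:
  assumes m: "m \<in> carrier (total_space Q V)" and \<alpha>: "\<alpha> \<in> arcs Q"
  shows "path_action Q V (tail Q \<alpha>, [\<alpha>]) m \<in> carrier (total_space Q V)"
    and "total_coord B v \<phi> (path_action Q V (tail Q \<alpha>, [\<alpha>]) m) = mat_op B (a \<alpha>) (total_coord B v \<phi> m)"
proof -
  note e = ends[OF \<alpha>]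
  have t: "path_target Q (tail Q \<alpha>, [\<alpha>]) = head Q \<alpha>"
    by (simp add: path_target_def pre_digraph.awalk_verts.simps)
  have mt: "m (tail Q \<alpha>) \<in> carrier (space V (tail Q \<alpha>))" using m e by (auto simp: total_space_def)
  let ?p = "path_action Q V (tail Q \<alpha>, [\<alpha>]) m"
  show P: "?p \<in> carrier (total_space Q V)"
    using mor_closed[OF \<alpha> mt] closed(1) by (auto simp: total_space_def path_action_def t)
  have "?p (head Q \<alpha>) = mor V \<alpha> (m (tail Q \<alpha>))" using e by (simp add: path_action_def t)
  then have h: "\<phi> (head Q \<alpha>) (?p (head Q \<alpha>)) = mat_op B (a \<alpha>) (total_coord B v \<phi> m)"
    using hom_mor[OF \<alpha> mt] mat_op_proj[OF \<alpha>, of "total_coord B v \<phi> m"] total_coord_proj[OF m e(1)] by simp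
  show "total_coord B v \<phi> ?p = mat_op B (a \<alpha>) (total_coord B v \<phi> m)"
  proof (rule funs_on_eqI)
    show "total_coord B v \<phi> ?p \<in> funs_on B" by (auto simp: total_coord_def funs_on_def)
    fix i assume i: "i \<in> verts Q"
    show "proj v i (total_coord B v \<phi> ?p) = proj v i (mat_op B (a \<alpha>) (total_coord B v \<phi> m))"
      unfolding total_coord_proj[OF P i] proj_mat_op[OF \<alpha>]
      using h hom_zero[OF i] i by (auto simp: path_action_def t)
  qed (rule funs_on_mat_op)
qed

end

text \<open>
  This describes the images of the idempotents, which are spanned by part of the basis.
\<close>

lemma coord_space_subspace:
  fixes X :: "('k::field, 'x) module" and C :: "'b set"
  assumes X: "coord_space X C \<theta>" and D: "D \<subseteq> C" and S: "S = {x \<in> carrier X. \<theta> x \<in> funs_on D}"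
  shows "coord_space (X\<lparr>carrier := S\<rparr>) D \<theta>"
proof -
  interpret X: coord_space X C \<theta> by (rule X)
  show ?thesis
  proof
    show "finite D" using D X.fin by (rule finite_subset)
    show "bij_betw \<theta> (carrier (X\<lparr>carrier := S\<rparr>)) (funs_on D)" unfolding bij_betw_def
    proof
      show "inj_on \<theta> (carrier (X\<lparr>carrier := S\<rparr>))" using X.inj by (auto simp: S inj_on_def)
      show "\<theta> ` carrier (X\<lparr>carrier := S\<rparr>) = funs_on D"
      proof
        show "funs_on D \<subseteq> \<theta> ` carrier (X\<lparr>carrier := S\<rparr>)"
        proof
          fix f :: "'b \<Rightarrow> 'k" assume f: "f \<in> funs_on D"
          then have "f \<in> funs_on C" using funs_on_mono[OF D] by blast
          from X.elem[OF this] f show "f \<in> \<theta> ` carrier (X\<lparr>carrier := S\<rparr>)"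
            by (intro image_eqI[of f \<theta> "X.elem f"]) (auto simp: S)
        qed
      qed (auto simp: S)
    qed
  qed (auto simp: S X.zero_closed X.add_closed X.smult_closed X.hom_zero X.hom_add X.hom_smult funs_on_add funs_on_scal)
qed

text \<open>
  What a partitioning morphism with \<open>\<Delta> \<alpha> = \<alpha> \<otimes> \<alpha>\<close> looks like: the partition of the pairs of vertices is
  given by the fibres of the operation \<open>p\<close>.
\<close>

locale grouplike_comult =
  fixes Q :: "('v, 'a) pre_digraph" and \<Delta> :: "('k::field, 'v, 'a) comult" and p :: "'v \<Rightarrow> 'v \<Rightarrow> 'v"
  assumes wfQ: "wf_digraph Q" and finQ: "finite (verts Q)"
    and p_verts: "s \<in> verts Q \<Longrightarrow> t \<in> verts Q \<Longrightarrow> p s t \<in> verts Q"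
    and comult_vertex: "k \<in> verts Q \<Longrightarrow> \<Delta> (basis_vec (k, [])) =
      (\<Sum>(s, t)\<in>{(s, t). s \<in> verts Q \<and> t \<in> verts Q \<and> p s t = k}. basis_vec ((s, []), (t, [])))"
    and comult_arrow: "\<alpha> \<in> arcs Q \<Longrightarrow>
      \<Delta> (basis_vec (tail Q \<alpha>, [\<alpha>])) = basis_vec ((tail Q \<alpha>, [\<alpha>]), (tail Q \<alpha>, [\<alpha>]))"
    and p_tail: "\<alpha> \<in> arcs Q \<Longrightarrow> p (tail Q \<alpha>) (tail Q \<alpha>) = tail Q \<alpha>"
    and p_head: "\<alpha> \<in> arcs Q \<Longrightarrow> p (head Q \<alpha>) (head Q \<alpha>) = head Q \<alpha>"
begin

text \<open>
  The idempotent \<open>e\<^sub>k\<close> acts by \<open>\<Sum> e\<^sub>s \<otimes> e\<^sub>t\<close> over the pairs with \<open>p s t = k\<close>, that is, by the projection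
  to the pairs of basis elements whose vertices are combined to \<open>k\<close>.  An arrow \<open>\<alpha>\<close> acts by \<open>\<alpha> \<otimes> \<alpha>\<close>,
  that is, by the Kronecker product on all pairs.  The latter is nonzero only on pairs at the tail of
  \<open>\<alpha>\<close>, which lie at the tail again because \<open>p\<close> is idempotent there.
\<close>

lemma coord_rep_comult_tensor:
  assumes 1: "coord_rep Q V B v a \<phi>" and 2: "coord_rep Q M C w c \<psi>"
  shows "coord_rep Q (comult_tensor Q \<Delta> V M) (tens_index B C)
    (\<lambda>l. p (v (tl l)) (w (hd l))) (tens_mat a c)
    (\<lambda>_. tens_coord (total_coord B v \<phi>) (total_coord C w \<psi>))"
proof -
  interpret V: coord_rep Q V B v a \<phi> by (rule 1)
  interpret M: coord_rep Q M C w c \<psi> by (rule 2)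
  let ?X = "total_space Q V" and ?Y = "total_space Q M"
  let ?\<phi> = "total_coord B v \<phi>" and ?\<psi> = "total_coord C w \<psi>"
  let ?u = "\<lambda>l. p (v (tl l)) (w (hd l))" and ?I = "tens_index B C"
  define \<Theta> where "\<Theta> = tens_coord ?\<phi> ?\<psi>"
  have tc: "tensor_coords ?X B ?\<phi> ?Y C ?\<psi>"
    using V.coord_space_total M.coord_space_total by (rule tensor_coords.intro)
  interpret P: tensor_coords ?X B ?\<phi> ?Y C ?\<psi> by (rule tc)
  let ?Z = "tensor_space ?X ?Y"
  have cs: "coord_space ?Z ?I \<Theta>" unfolding \<Theta>_def by (rule P.coord_space_tensor)
  interpret Z: coord_space ?Z ?I \<Theta> by (rule cs)
  define h where "h b = (\<lambda>(m, n). \<Sum>(\<mu>, \<nu>)\<in>Poly_Mapping.keys (\<Delta> b).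
    Poly_Mapping.single (path_action Q V \<mu> m, path_action Q M \<nu> n)
      (Poly_Mapping.lookup (\<Delta> b) (\<mu>, \<nu>)))" for b
  have h_eq: "h b (m, n) = free_extend (\<lambda>(\<mu>, \<nu>). basis_vec (path_action Q V \<mu> m, path_action Q M \<nu> n)) (\<Delta> b)" for b m n
    by (simp add: h_def free_extend_def basis_vec_def case_prod_unfold)
  have ev_h: "P.ev (h b (m, n)) =
    lin_ext (\<lambda>(\<mu>, \<nu>). tens (?\<phi> (path_action Q V \<mu> m)) (?\<psi> (path_action Q M \<nu> n))) (\<Delta> b)" for b m n
    unfolding h_eq tens_eval_def lin_ext_free_extend by (simp add: lin_ext_basis_vec case_prod_unfold)
  have act: "comult_action Q \<Delta> V M b = tensor_induced ?X ?Y (h b)" for b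
    by (simp add: comult_action_def h_def[abs_def])
  have fv: "finite {(s, t). s \<in> verts Q \<and> t \<in> verts Q \<and> p s t = k}" for k
    by (rule finite_subset[of _ "verts Q \<times> verts Q"]) (use finQ in auto)

  have vert_act: "comult_action Q \<Delta> V M (basis_vec (k, [])) A \<in> carrier ?Z"
    "\<Theta> (comult_action Q \<Delta> V M (basis_vec (k, [])) A) = proj ?u k (\<Theta> A)"
    if k: "k \<in> verts Q" and A: "A \<in> carrier ?Z" for k A
  proof -
    let ?E = "{(s, t). s \<in> verts Q \<and> t \<in> verts Q \<and> p s t = k}"
    have hc: "h (basis_vec (k, [])) (m, n) \<in> carrier P.F" if m: "m \<in> carrier ?X" and n: "n \<in> carrier ?Y" for m n
      unfolding h_eq P.F_simps
    proof (intro CollectI keys_free_extend)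
      fix q assume "q \<in> Poly_Mapping.keys (\<Delta> (basis_vec (k, [])))"
      then have "(\<Sum>(s, t)\<in>?E. Poly_Mapping.lookup (basis_vec ((s, []), (t, [])) :: _ \<Rightarrow>\<^sub>0 'k) q) \<noteq> 0"
        by (simp add: in_keys_iff comult_vertex[OF k] lookup_sum case_prod_unfold)
      then obtain z where "z \<in> ?E" "(case z of (s, t) \<Rightarrow>
          Poly_Mapping.lookup (basis_vec ((s, []), (t, [])) :: _ \<Rightarrow>\<^sub>0 'k) q) \<noteq> 0"
        by (rule sum.not_neutral_contains_not_neutral)
      moreover obtain s t where z: "z = (s, t)" by (cases z)
      ultimately have st: "(s, t) \<in> ?E"
        and "Poly_Mapping.lookup (basis_vec ((s, []), (t, [])) :: _ \<Rightarrow>\<^sub>0 'k) q \<noteq> 0" by simp_all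
      then have "q = ((s, []), (t, []))"
        by (simp add: basis_vec_def lookup_single when_def split: if_splits)
      moreover have "s \<in> verts Q" "t \<in> verts Q" using st by simp_all
      ultimately show "Poly_Mapping.keys (case q of (\<mu>, \<nu>) \<Rightarrow>
          basis_vec (path_action Q V \<mu> m, path_action Q M \<nu> n)) \<subseteq> carrier ?X \<times> carrier ?Y"
        using V.trivial_path_action(1)[OF m] M.trivial_path_action(1)[OF n] by (simp add: basis_vec_def)
    qed
    have he: "P.ev (h (basis_vec (k, [])) (m, n)) = proj ?u k (tens (?\<phi> m) (?\<psi> n))"
      if m: "m \<in> carrier ?X" and n: "n \<in> carrier ?Y" for m n
    proof
      fix l
      have "P.ev (h (basis_vec (k, [])) (m, n)) l =
        (\<Sum>(s, t)\<in>?E. tens (?\<phi> (path_action Q V (s, []) m)) (?\<psi> (path_action Q M (t, []) n)) l)"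
        unfolding ev_h comult_vertex[OF k] by (simp add: lin_ext_sum lin_ext_basis_vec case_prod_unfold sum_fun_apply)
      also have "\<dots> = (\<Sum>(s, t)\<in>?E. tens (proj v s (?\<phi> m)) (proj w t (?\<psi> n)) l)"
        using V.trivial_path_action(2)[OF m] M.trivial_path_action(2)[OF n] by (intro sum.cong) auto
      also have "\<dots> = proj ?u k (tens (?\<phi> m) (?\<psi> n)) l"
      proof (cases "l \<in> ?I")
        case False
        have "tens f g l = 0" if "f \<in> funs_on B" "g \<in> funs_on C" for f :: "'c list \<Rightarrow> 'k" and g
          using tens_funs_on[OF that] False by (auto simp: funs_on_def)
        moreover have "proj v s (?\<phi> m) \<in> funs_on B" "proj w t (?\<psi> n) \<in> funs_on C" "?\<phi> m \<in> funs_on B" "?\<psi> n \<in> funs_on C" for s t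
          by (auto simp: funs_on_def proj_def total_coord_def)
        ultimately show ?thesis by (simp add: proj_def)
      next
        case True
        then obtain y xs where l: "l = y # xs" "y \<in> C" "xs \<in> B" by (auto simp: tens_index_def)
        then have yx: "w y \<in> verts Q" "v xs \<in> verts Q" using V.vB M.vB by auto
        have "(\<Sum>(s, t)\<in>?E. tens (proj v s (?\<phi> m)) (proj w t (?\<psi> n)) l) =
          (\<Sum>q\<in>?E. if q = (v xs, w y) then ?\<phi> m xs * ?\<psi> n y else 0)"
          by (intro sum.cong) (auto simp: l tens_def proj_def split: if_splits)
        \<comment> \<open>A single pair of vertices contributes, that of the two entries of \<open>l\<close>.\<close>
        also have "\<dots> = (if p (v xs) (w y) = k then ?\<phi> m xs * ?\<psi> n y else 0)"
          using fv yx by (simp add: sum.delta)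
        also have "\<dots> = proj ?u k (tens (?\<phi> m) (?\<psi> n)) l" by (simp add: l proj_def tens_def)
        finally show ?thesis .
      qed
      finally show "P.ev (h (basis_vec (k, [])) (m, n)) l = proj ?u k (tens (?\<phi> m) (?\<psi> n)) l" .
    qed
    show "comult_action Q \<Delta> V M (basis_vec (k, [])) A \<in> carrier ?Z"
      unfolding act by (rule tensor_induced_coords(1)[OF tc tc proj_add proj_scal hc he A])
    show "\<Theta> (comult_action Q \<Delta> V M (basis_vec (k, [])) A) = proj ?u k (\<Theta> A)"
      unfolding act \<Theta>_def by (rule tensor_induced_coords(2)[OF tc tc proj_add proj_scal hc he A])
  qed

  have arrow_act: "comult_action Q \<Delta> V M (basis_vec (tail Q \<alpha>, [\<alpha>])) A \<in> carrier ?Z"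
    "\<Theta> (comult_action Q \<Delta> V M (basis_vec (tail Q \<alpha>, [\<alpha>])) A) = mat_op ?I (tens_mat a c \<alpha>) (\<Theta> A)"
    if \<alpha>: "\<alpha> \<in> arcs Q" and A: "A \<in> carrier ?Z" for \<alpha> A
  proof -
    let ?b = "basis_vec (tail Q \<alpha>, [\<alpha>])"
    have h1: "h ?b (m, n) = basis_vec (path_action Q V (tail Q \<alpha>, [\<alpha>]) m, path_action Q M (tail Q \<alpha>, [\<alpha>]) n)" for m n
      unfolding h_eq comult_arrow[OF \<alpha>] by (simp add: free_extend_def basis_vec_def)
    have hc: "h ?b (m, n) \<in> carrier P.F" if m: "m \<in> carrier ?X" and n: "n \<in> carrier ?Y" for m n
      using V.arrow_path_action(1)[OF m \<alpha>] M.arrow_path_action(1)[OF n \<alpha>]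
      unfolding h1 P.F_simps by (simp add: basis_vec_def)
    have he: "P.ev (h ?b (m, n)) = mat_op ?I (tens_mat a c \<alpha>) (tens (?\<phi> m) (?\<psi> n))"
      if m: "m \<in> carrier ?X" and n: "n \<in> carrier ?Y" for m n
      unfolding h1 tens_eval_def lin_ext_basis_vec mat_op_tens
      by (simp add: V.arrow_path_action(2)[OF m \<alpha>] M.arrow_path_action(2)[OF n \<alpha>])
    show "comult_action Q \<Delta> V M ?b A \<in> carrier ?Z"
      unfolding act by (rule tensor_induced_coords(1)[OF tc tc mat_op_add mat_op_scal hc he A])
    show "\<Theta> (comult_action Q \<Delta> V M ?b A) = mat_op ?I (tens_mat a c \<alpha>) (\<Theta> A)"
      unfolding act \<Theta>_def by (rule tensor_induced_coords(2)[OF tc tc mat_op_add mat_op_scal hc he A])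
  qed

  have supp: "?u l = tail Q \<alpha> \<and> ?u l' = head Q \<alpha>"
    if "\<alpha> \<in> arcs Q" "l \<in> ?I" "l' \<in> ?I" "tens_mat a c \<alpha> l' l \<noteq> 0" for \<alpha> l l'
    using that V.mat_supp[OF that(1)] M.mat_supp[OF that(1)] p_tail[OF that(1)] p_head[OF that(1)]
    by (auto simp: tens_index_def tens_mat_def)
  have sp: "space (comult_tensor Q \<Delta> V M) i =
    ?Z\<lparr>carrier := comult_action Q \<Delta> V M (basis_vec (i, [])) ` carrier ?Z\<rparr>" for i
    by (simp add: comult_tensor_def Let_def)
  \<comment> \<open>The space at \<open>i\<close> is the image of a projection, hence its set of fixed points.\<close>
  have img: "comult_action Q \<Delta> V M (basis_vec (i, [])) ` carrier ?Z =
    {A \<in> carrier ?Z. \<Theta> A \<in> funs_on {l \<in> ?I. ?u l = i}}" if i: "i \<in> verts Q" for i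
  proof
    show "comult_action Q \<Delta> V M (basis_vec (i, [])) ` carrier ?Z \<subseteq>
      {A \<in> carrier ?Z. \<Theta> A \<in> funs_on {l \<in> ?I. ?u l = i}}"
      using vert_act[OF i] funs_on_proj[OF Z.into, of _ ?u i] by auto
    show "{A \<in> carrier ?Z. \<Theta> A \<in> funs_on {l \<in> ?I. ?u l = i}} \<subseteq>
      comult_action Q \<Delta> V M (basis_vec (i, [])) ` carrier ?Z"
    proof
      fix A assume "A \<in> {A \<in> carrier ?Z. \<Theta> A \<in> funs_on {l \<in> ?I. ?u l = i}}"
      then have A: "A \<in> carrier ?Z" "proj ?u i (\<Theta> A) = \<Theta> A" by (auto intro: proj_id)
      then have "comult_action Q \<Delta> V M (basis_vec (i, [])) A = A"
        using Z.inj[OF vert_act(1)[OF i A(1)] A(1)] vert_act(2)[OF i A(1)] by simp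
      then show "A \<in> comult_action Q \<Delta> V M (basis_vec (i, [])) ` carrier ?Z" using A(1) by (metis imageI)
    qed
  qed
  have "coord_rep Q (comult_tensor Q \<Delta> V M) ?I ?u (tens_mat a c) (\<lambda>_. \<Theta>)"
  proof (rule coord_repI[OF wfQ Z.fin _ _ _ supp])
    show "?u ` ?I \<subseteq> verts Q" using V.vB M.vB p_verts by (auto simp: tens_index_def image_subset_iff)
    fix i assume i: "i \<in> verts Q"
    show "coord_space (space (comult_tensor Q \<Delta> V M) i) {l \<in> ?I. ?u l = i} \<Theta>"
      unfolding sp by (rule coord_space_subspace[OF cs _ img[OF i]]) auto
  next
    fix \<alpha> A assume \<alpha>: "\<alpha> \<in> arcs Q" and A: "A \<in> carrier (space (comult_tensor Q \<Delta> V M) (tail Q \<alpha>))"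
    note e = V.ends[OF \<alpha>]
    have A': "A \<in> carrier ?Z" using A unfolding sp by (simp add: img[OF e(1)])
    have z: "mat_op ?I (tens_mat a c \<alpha>) f \<in> funs_on {l \<in> ?I. ?u l = head Q \<alpha>}" for f
    proof -
      have "mat_op ?I (tens_mat a c \<alpha>) f l' = 0" if l': "l' \<in> ?I" "?u l' \<noteq> head Q \<alpha>" for l'
      proof -
        have "tens_mat a c \<alpha> l' l = 0" if "l \<in> ?I" for l using supp[OF \<alpha> that l'(1)] l'(2) by blast
        then show ?thesis by (simp add: mat_op_def)
      qed
      then show ?thesis by (auto simp: funs_on_def mat_op_def)
    qed
    show "mor (comult_tensor Q \<Delta> V M) \<alpha> A \<in> carrier (space (comult_tensor Q \<Delta> V M) (head Q \<alpha>)) \<and>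
      \<Theta> (mor (comult_tensor Q \<Delta> V M) \<alpha> A) = mat_op ?I (tens_mat a c \<alpha>) (\<Theta> A)"
      unfolding sp using arrow_act[OF \<alpha> A'] z
      by (simp add: img[OF e(2)]) (simp add: comult_tensor_def Let_def)
  qed
  then show ?thesis by (simp add: \<Theta>_def)
qed

end

section \<open>Splitting off vectors that no arrow touches\<close>

context coord_rep
begin

text \<open>
  Outside \<open>N\<close> all matrices vanish, so each remaining basis element spans a one-dimensional summand, which
  is indecomposable.  The decomposition of the part on \<open>N\<close> may be taken with respect to any vertex map
  \<open>v'\<close> that agrees with \<open>v\<close> on \<open>N\<close>, because only the restrictions of the operators to this part enter;
  this allows the same \<open>\<U>\<close> to be used for both kinds of powers.
\<close>

lemma num_summands_split:
  assumes NB: "N \<subseteq> B" and v': "\<And>b. b \<in> N \<Longrightarrow> v' b = v b"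
    and supp: "\<And>\<alpha> b b'. \<alpha> \<in> arcs Q \<Longrightarrow> b \<in> B \<Longrightarrow> b' \<in> B \<Longrightarrow> a \<alpha> b' b \<noteq> 0 \<Longrightarrow> b \<in> N \<and> b' \<in> N"
    and D: "operators.indec_decomposition (rep_ops Q N v' a) \<U> (funs_on N)"
  shows "num_summands Q V = card \<U> + card (B - N)"
proof -
  let ?T' = "rep_ops Q N v' a"
  interpret T': operators ?T' by (rule operators_rep_ops)
  have mo: "mat_op N (a \<alpha>) = mat_op B (a \<alpha>)" if "\<alpha> \<in> arcs Q" for \<alpha>
    by (rule mat_op_restrict[OF NB finB]) (rule supp[OF that])
  have pr: "proj v' i f = proj v i f" if f: "f \<in> funs_on N" for f i
  proof
    fix b
    show "proj v' i f b = proj v i f b"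
      using f v'[of b] by (cases "b \<in> N") (simp_all add: proj_def funs_on_def)
  qed
  have T_cases: "P t" if "t \<in> T" "\<And>c. P (scal c)" "\<And>i. i \<in> verts Q \<Longrightarrow> P (proj v i)"
      "\<And>\<alpha>. \<alpha> \<in> arcs Q \<Longrightarrow> P (mat_op B (a \<alpha>))" for P t
    using that unfolding rep_ops_def by blast
  have T'_cases: "P t" if "t \<in> ?T'" "\<And>c. P (scal c)" "\<And>i. i \<in> verts Q \<Longrightarrow> P (proj v' i)"
      "\<And>\<alpha>. \<alpha> \<in> arcs Q \<Longrightarrow> P (mat_op N (a \<alpha>))" for P t
    using that unfolding rep_ops_def by blast
  have in_T: "scal c \<in> T" "i \<in> verts Q \<Longrightarrow> proj v i \<in> T" "\<alpha> \<in> arcs Q \<Longrightarrow> mat_op B (a \<alpha>) \<in> T" for c i \<alpha>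
    by (auto simp: rep_ops_def)
  have in_T': "scal c \<in> ?T'" "i \<in> verts Q \<Longrightarrow> proj v' i \<in> ?T'" "\<alpha> \<in> arcs Q \<Longrightarrow> mat_op N (a \<alpha>) \<in> ?T'" for c i \<alpha>
    by (auto simp: rep_ops_def)
  \<comment> \<open>On functions supported on \<open>N\<close> the two sets of operators act alike.\<close>
  have os: "op_subgroup T U \<longleftrightarrow> op_subgroup ?T' U" if U: "U \<subseteq> funs_on N" for U
  proof
    assume O: "op_subgroup T U"
    have "t f \<in> U" if t: "t \<in> ?T'" and f: "f \<in> U" for t f
      by (rule T'_cases[OF t])
         (use op_subgroup_op[OF O _ f] in_T pr[of f] mo U f in auto)
    then show "op_subgroup ?T' U" using O by (simp add: op_subgroup_def)
  next
    assume O: "op_subgroup ?T' U"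
    have "t f \<in> U" if t: "t \<in> T" and f: "f \<in> U" for t f
    proof (rule T_cases[OF t])
      show "scal c f \<in> U" for c using op_subgroup_op[OF O in_T'(1) f] .
      show "proj v i f \<in> U" if "i \<in> verts Q" for i
        using op_subgroup_op[OF O in_T'(2)[OF that] f] pr[of f] U f by auto
      show "mat_op B (a \<alpha>) f \<in> U" if "\<alpha> \<in> arcs Q" for \<alpha>
        using op_subgroup_op[OF O in_T'(3)[OF that] f] mo[OF that] by simp
    qed
    then show "op_subgroup T U" using O by (simp add: op_subgroup_def)
  qed
  have sp: "splits T X A C \<longleftrightarrow> splits ?T' X A C" if X: "X \<subseteq> funs_on N" for X A C
  proof -
    have "A \<subseteq> funs_on N \<and> C \<subseteq> funs_on N" if "splits T X A C \<or> splits ?T' X A C"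
      using that X splits_subset[of X A C] T'.splits_subset[of X A C] by blast
    then show ?thesis using os unfolding splits_def by blast
  qed
  have ind: "indec T U \<longleftrightarrow> indec ?T' U" if "U \<subseteq> funs_on N" for U
    unfolding indec_def using sp[OF that] by simp
  have D': "internal_sum ?T' \<U> (\<lambda>U. U) (funs_on N)" "\<And>U. U \<in> \<U> \<Longrightarrow> indec ?T' U"
    using D by (auto simp: T'.indec_decomposition_def)
  have UN: "U \<subseteq> funs_on N" if "U \<in> \<U>" for U using internal_sum_summand_subset[OF D'(1) that] .
  have 1: "internal_sum T \<U> (\<lambda>U. U) (funs_on N)"
  proof -
    have "\<forall>U\<in>\<U>. op_subgroup T U" using os[OF UN] internal_sum_op_subgroup[OF D'(1)] by blast
    then show ?thesis using D'(1) unfolding internal_sum_def by (elim conjE, intro conjI)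
  qed
  have 2: "indec T U" if "U \<in> \<U>" for U using ind[OF UN[OF that]] D'(2)[OF that] by simp

  have fin: "finite (B - N)" using finB by simp
  \<comment> \<open>Arrows annihilate functions supported off \<open>N\<close>, so every set of basis elements there spans a summand.\<close>
  have kill: "mat_op B (a \<alpha>) f = 0" if "\<alpha> \<in> arcs Q" "f \<in> funs_on D" "D \<subseteq> B - N" for \<alpha> f D
  proof
    fix b'
    have "a \<alpha> b' b * f b = 0" if "b \<in> B" "b' \<in> B" for b
      using supp[OF \<open>\<alpha> \<in> arcs Q\<close> that] \<open>f \<in> funs_on D\<close> \<open>D \<subseteq> B - N\<close> by (auto simp: funs_on_def)
    then show "mat_op B (a \<alpha>) f b' = 0 b'" by (auto simp: mat_op_def)
  qed
  have opD: "op_subgroup T (funs_on D)" if D: "D \<subseteq> B - N" for D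
    unfolding op_subgroup_def
  proof (intro conjI ballI)
    fix t and f :: "'b \<Rightarrow> 'k" assume t: "t \<in> T" and f: "f \<in> funs_on D"
    show "t f \<in> funs_on D"
      by (rule T_cases[OF t]) (use f kill[OF _ f D] in \<open>auto simp: funs_on_scal\<close>, auto simp: funs_on_def proj_def)
  qed (auto simp: funs_on_diff)
  have opN: "op_subgroup T (funs_on N)"
    unfolding op_subgroup_def
  proof (intro conjI ballI)
    fix t and f :: "'b \<Rightarrow> 'k" assume t: "t \<in> T" and f: "f \<in> funs_on N"
    show "t f \<in> funs_on N"
    proof (rule T_cases[OF t])
      show "mat_op B (a \<alpha>) f \<in> funs_on N" if "\<alpha> \<in> arcs Q" for \<alpha>
        unfolding mo[OF that, symmetric] by (rule funs_on_mat_op)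
    qed (use f in \<open>auto simp: funs_on_scal\<close>, auto simp: funs_on_def proj_def)
  qed (auto simp: funs_on_diff)
  have ne: "funs_on {b} \<noteq> ({0} :: ('b \<Rightarrow> 'k) set)" for b :: 'b
  proof
    assume "funs_on {b} = ({0} :: ('b \<Rightarrow> 'k) set)"
    moreover have "delta b \<in> (funs_on {b} :: ('b \<Rightarrow> 'k) set)" by (auto simp: funs_on_def delta_def)
    ultimately have "delta b = (0 :: 'b \<Rightarrow> 'k)" by blast
    from fun_cong[OF this, of b] show False by (simp add: delta_def)
  qed
  have line: "indec T (funs_on {b})" for b
    unfolding indec_def
  proof (intro conjI allI impI ne)
    fix A C assume s: "splits T (funs_on {b}) A C"
    have A: "op_subgroup T A" and C: "op_subgroup T C" and AC: "A \<inter> C = {0}"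
      using s by (auto simp: splits_def)
    show "A = {0} \<or> C = {0}"
    proof (cases "A = {0}")
      case False
      then obtain f where f: "f \<in> A" "f \<noteq> 0" using op_subgroup_zero[OF A] by blast
      then have fb: "f \<in> funs_on {b}" using splits_subset(1)[OF s] by blast
      have "f b \<noteq> 0"
      proof
        assume "f b = 0"
        then have "f = 0" using fb by (auto simp: funs_on_def fun_eq_iff)
        then show False using f by simp
      qed
      have "funs_on {b} \<subseteq> A"
      proof
        fix g :: "'b \<Rightarrow> 'k" assume g: "g \<in> funs_on {b}"
        have "g = scal (g b / f b) f"
        proof
          fix b'
          show "g b' = scal (g b / f b) f b'"
            using g fb \<open>f b \<noteq> 0\<close> by (cases "b' = b") (simp_all add: funs_on_def scal_def)
        qed
        moreover have "scal (g b / f b) f \<in> A" using op_subgroup_op[OF A in_T(1) f(1)] .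
        ultimately show "g \<in> A" by simp
      qed
      then have "C \<subseteq> {0}" using splits_subset(2)[OF s] AC by blast
      then show ?thesis using op_subgroup_zero[OF C] by blast
    qed simp
  qed
  have lines: "internal_sum T (B - N) (\<lambda>b. funs_on {b}) (funs_on (B - N))"
    unfolding internal_sum_def
  proof (intro conjI allI impI fin ballI)
    show "op_subgroup T (funs_on {b})" if "b \<in> B - N" for b using that by (intro opD) simp
    show "funs_on (B - N) = {sum u (B - N) | u. \<forall>b\<in>B - N. u b \<in> (funs_on {b} :: ('b \<Rightarrow> 'k) set)}"
    proof
      show "funs_on (B - N) \<subseteq> {sum u (B - N) | u. \<forall>b\<in>B - N. u b \<in> (funs_on {b} :: ('b \<Rightarrow> 'k) set)}"
      proof
        fix f :: "'b \<Rightarrow> 'k" assume f: "f \<in> funs_on (B - N)"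
        let ?u = "\<lambda>b b'. if b' = b then f b' else 0"
        have "f = sum ?u (B - N)"
          using f fin by (auto simp: fun_eq_iff sum_fun_apply funs_on_def)
        moreover have "\<forall>b\<in>B - N. ?u b \<in> funs_on {b}" by (auto simp: funs_on_def)
        ultimately show "f \<in> {sum u (B - N) | u. \<forall>b\<in>B - N. u b \<in> (funs_on {b} :: ('b \<Rightarrow> 'k) set)}"
          by (intro CollectI exI[of _ ?u]) simp
      qed
      show "{sum u (B - N) | u. \<forall>b\<in>B - N. u b \<in> (funs_on {b} :: ('b \<Rightarrow> 'k) set)} \<subseteq> funs_on (B - N)"
      proof
        fix f assume "f \<in> {sum u (B - N) | u. \<forall>b\<in>B - N. u b \<in> (funs_on {b} :: ('b \<Rightarrow> 'k) set)}"
        then obtain u where u: "f = sum u (B - N)" "\<forall>b\<in>B - N. u b \<in> (funs_on {b} :: ('b \<Rightarrow> 'k) set)" by blast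
        have "u b \<in> funs_on (B - N)" if "b \<in> B - N" for b
          using u(2) that funs_on_mono[of "{b}" "B - N"] by blast
        then show "f \<in> funs_on (B - N)" unfolding u(1) using op_subgroup_sum[OF opD[OF subset_refl]] by blast
      qed
    qed
  next
    fix u b assume u: "(\<forall>b\<in>B - N. u b \<in> (funs_on {b} :: ('b \<Rightarrow> 'k) set)) \<and> sum u (B - N) = 0" and b: "b \<in> B - N"
    have "sum u (B - N) b = (\<Sum>b'\<in>B - N. if b' = b then u b b else 0)"
      unfolding sum_fun_apply using u by (intro sum.cong) (auto simp: funs_on_def)
    also have "\<dots> = u b b" using fin b by simp
    finally have "u b b = 0" using u by simp
    moreover have "u b \<in> funs_on {b}" using u b by blast
    ultimately show "u b = 0" by (auto simp: funs_on_def fun_eq_iff)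
  qed
  have inj_l: "inj_on (\<lambda>b. funs_on {b} :: ('b \<Rightarrow> 'k) set) (B - N)"
    by (rule internal_sum_nonzero_inj[OF lines ne])
  let ?L = "(\<lambda>b. funs_on {b} :: ('b \<Rightarrow> 'k) set) ` (B - N)"
  have 3: "internal_sum T ?L (\<lambda>U. U) (funs_on (B - N))"
    unfolding internal_sum_reindex[OF inj_l] by (rule lines)
  have disj: "\<U> \<inter> ?L = {}"
  proof (rule ccontr)
    assume "\<U> \<inter> ?L \<noteq> {}"
    then obtain b where b: "b \<in> B - N" "funs_on {b} \<in> \<U>" by blast
    then have "funs_on {b} \<subseteq> (funs_on N :: ('b \<Rightarrow> 'k) set)" using UN by blast
    moreover have "delta b \<in> (funs_on {b} :: ('b \<Rightarrow> 'k) set)" by (auto simp: funs_on_def delta_def)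
    ultimately have "delta b \<in> (funs_on N :: ('b \<Rightarrow> 'k) set)" by blast
    then show False using b by (auto simp: funs_on_def delta_def)
  qed
  have "splits T (funs_on B) (funs_on N) (funs_on (B - N))" unfolding splits_def
  proof (intro conjI opN opD subset_refl)
    have "f = 0" if f: "f \<in> funs_on N" "f \<in> funs_on (B - N)" for f :: "'b \<Rightarrow> 'k"
    proof
      show "f b = 0 b" for b using f by (cases "b \<in> N") (simp_all add: funs_on_def)
    qed
    then show "funs_on N \<inter> funs_on (B - N) = {0 :: 'b \<Rightarrow> 'k}" by auto
    show "funs_on B = {f + g | f g. f \<in> funs_on N \<and> g \<in> (funs_on (B - N) :: ('b \<Rightarrow> 'k) set)}"
    proof
      show "{f + g | f g. f \<in> funs_on N \<and> g \<in> (funs_on (B - N) :: ('b \<Rightarrow> 'k) set)} \<subseteq> funs_on B"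
        using NB by (auto simp: funs_on_def)
      show "funs_on B \<subseteq> {f + g | f g. f \<in> funs_on N \<and> g \<in> (funs_on (B - N) :: ('b \<Rightarrow> 'k) set)}"
      proof
        fix f :: "'b \<Rightarrow> 'k" assume f: "f \<in> funs_on B"
        let ?g = "\<lambda>b. if b \<in> N then f b else 0" and ?h = "\<lambda>b. if b \<in> N then 0 else f b"
        have "f = ?g + ?h" by (auto simp: fun_eq_iff)
        moreover have "?g \<in> funs_on N" "?h \<in> funs_on (B - N)" using f by (auto simp: funs_on_def)
        ultimately show "f \<in> {f + g | f g. f \<in> funs_on N \<and> g \<in> (funs_on (B - N) :: ('b \<Rightarrow> 'k) set)}" by blast
      qed
    qed
  qed
  then have "internal_sum T (\<U> \<union> ?L) (\<lambda>U. U) (funs_on B)"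
    using internal_sum_Un[OF 1 3 disj] by blast
  then have "indec_decomposition (\<U> \<union> ?L) (total_funs whole)"
    unfolding indec_decomposition_def total_funs_whole using 2 line by auto
  then have "num_summands Q V = card (\<U> \<union> ?L)" by (rule num_summands_eq)
  also have "\<dots> = card \<U> + card ?L"
    using internal_sum_finite[OF 1] fin disj by (intro card_Un_disjoint) auto
  also have "card ?L = card (B - N)" by (rule card_image[OF inj_l])
  finally show ?thesis .
qed

end

section \<open>Powers in coordinates\<close>

text \<open>
  Powers have exponent \<open>n + 1\<close> for the recursion index \<open>n\<close>, so \<open>tuples C n\<close> consists of lists of
  length \<open>n + 1\<close>.
\<close>

primrec tuples :: "'c set \<Rightarrow> nat \<Rightarrow> 'c list set" where
  "tuples C 0 = (\<lambda>y. [y]) ` C"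
| "tuples C (Suc n) = tens_index (tuples C n) C"

text \<open>
  The tuples whose entries all lie at the same vertex.  The condition compares only neighbouring entries,
  which is the form in which the pointwise tensor product adds a factor.
\<close>

primrec diag_tuples :: "'c set \<Rightarrow> ('c \<Rightarrow> 'v) \<Rightarrow> nat \<Rightarrow> 'c list set" where
  "diag_tuples C w 0 = (\<lambda>y. [y]) ` C"
| "diag_tuples C w (Suc n) = {l \<in> tens_index (diag_tuples C w n) C. w (hd (tl l)) = w (hd l)}"

primrec power_mat ::
  "('a \<Rightarrow> 'c \<Rightarrow> 'c \<Rightarrow> 'k::field) \<Rightarrow> nat \<Rightarrow> 'a \<Rightarrow> 'c list \<Rightarrow> 'c list \<Rightarrow> 'k" where
  "power_mat c 0 = (\<lambda>\<alpha> l' l. c \<alpha> (hd l') (hd l))"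
| "power_mat c (Suc n) = tens_mat (power_mat c n) c"

text \<open>
  The vertex of a tuple in the power for \<open>\<Delta>\<close>: the operation \<open>p\<close>, iterated with the brackets to the left.
  The last factor is the head of the list, hence the right argument.
\<close>

primrec power_vertex :: "('v \<Rightarrow> 'v \<Rightarrow> 'v) \<Rightarrow> ('c \<Rightarrow> 'v) \<Rightarrow> nat \<Rightarrow> 'c list \<Rightarrow> 'v" where
  "power_vertex p w 0 = (\<lambda>l. w (hd l))"
| "power_vertex p w (Suc n) = (\<lambda>l. p (power_vertex p w n (tl l)) (w (hd l)))"

lemma coord_rep_pointwise_power:
  assumes M: "coord_rep Q M C w c \<psi>"
  shows "\<exists>\<phi>. coord_rep Q (pointwise_power Q M (Suc n)) (diag_tuples C w n) (\<lambda>l. w (hd l)) (power_mat c n) \<phi>"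
proof (induction n)
  case 0
  show ?case using coord_rep_vec_copy[OF coord_rep_singletons[OF M]]
    by (simp only: pointwise_power.simps diag_tuples.simps power_mat.simps)
next
  case (Suc n)
  then obtain \<phi> where \<phi>: "coord_rep Q (pointwise_power Q M (Suc n)) (diag_tuples C w n) (\<lambda>l. w (hd l)) (power_mat c n) \<phi>"
    by blast
  show ?case using coord_rep_vec_copy[OF coord_rep_pointwise_tensor[OF \<phi> M]]
    by (simp only: pointwise_power.simps diag_tuples.simps power_mat.simps)
qed

lemma (in grouplike_comult) coord_rep_comult_power:
  assumes M: "coord_rep Q M C w c \<psi>"
  shows "\<exists>\<phi>. coord_rep Q (comult_power Q \<Delta> M (Suc n)) (tuples C n) (power_vertex p w n) (power_mat c n) \<phi>"
proof (induction n)
  case 0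
  show ?case using coord_rep_vec_copy[OF coord_rep_singletons[OF M]]
    by (simp only: comult_power.simps tuples.simps power_mat.simps power_vertex.simps)
next
  case (Suc n)
  then obtain \<phi> where \<phi>: "coord_rep Q (comult_power Q \<Delta> M (Suc n)) (tuples C n) (power_vertex p w n) (power_mat c n) \<phi>"
    by blast
  show ?case using coord_rep_vec_copy[OF coord_rep_comult_tensor[OF \<phi> M]]
    by (simp only: comult_power.simps tuples.simps power_mat.simps power_vertex.simps)
qed

lemma finite_tuples: "finite C \<Longrightarrow> finite (tuples C n)"
  by (induction n) (auto intro: finite_tens_index)

lemma card_tens_index:
  assumes "finite B" "finite C"
  shows "card (tens_index B C) = card B * card C"
proof -
  have e: "tens_index B C = (\<lambda>(y, xs). y # xs) ` (C \<times> B)" by (auto simp: tens_index_def)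
  have "inj_on (\<lambda>(y, xs). y # xs) (C \<times> B)" by (auto simp: inj_on_def)
  then show ?thesis unfolding e by (simp add: card_image card_cartesian_product)
qed

lemma card_tuples: "finite C \<Longrightarrow> card (tuples C n) = card C ^ Suc n"
  by (induction n) (simp_all add: card_image inj_on_def card_tens_index finite_tuples)

lemma diag_tuples_subset: "diag_tuples C w n \<subseteq> tuples C n"
  by (induction n) (auto simp: tens_index_def)

lemma hd_tuples: "l \<in> tuples C n \<Longrightarrow> hd l \<in> C"
  by (cases n) (auto simp: tens_index_def)

lemma diag_tuples_fibre: "{l \<in> diag_tuples C w n. w (hd l) = k} = tuples {b \<in> C. w b = k} n"
proof (induction n)
  case 0
  show ?case by auto
next
  case (Suc n)
  have "{l \<in> diag_tuples C w (Suc n). w (hd l) = k} =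
    tens_index {l \<in> diag_tuples C w n. w (hd l) = k} {b \<in> C. w b = k}"
    by (auto simp: tens_index_def)
  then show ?case using Suc by simp
qed

lemma card_diag_tuples:
  assumes "finite C" "finite I" "w ` C \<subseteq> I"
  shows "card (diag_tuples C w n) = (\<Sum>k\<in>I. card {b \<in> C. w b = k} ^ Suc n)"
proof -
  have fin: "finite (diag_tuples C w n)"
    using finite_subset[OF diag_tuples_subset finite_tuples[OF assms(1)]] .
  have "w (hd l) \<in> I" if "l \<in> diag_tuples C w n" for l
    using hd_tuples[of l C n] that diag_tuples_subset[of C w n] assms(3) by blast
  then have "diag_tuples C w n = (\<Union>k\<in>I. {l \<in> diag_tuples C w n. w (hd l) = k})" by auto
  then have "card (diag_tuples C w n) = card (\<Union>k\<in>I. {l \<in> diag_tuples C w n. w (hd l) = k})" by simp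
  also have "\<dots> = (\<Sum>k\<in>I. card {l \<in> diag_tuples C w n. w (hd l) = k})"
    using fin assms(2) by (intro card_UN_disjoint) auto
  also have "\<dots> = (\<Sum>k\<in>I. card {b \<in> C. w b = k} ^ Suc n)"
    unfolding diag_tuples_fibre using assms(1) by (simp add: card_tuples del: power_Suc)
  finally show ?thesis .
qed

text \<open>
  A product of matrix entries of \<open>\<alpha>\<close> is nonzero only if every factor is, which places all entries of
  \<open>l\<close> at the tail and all entries of \<open>l'\<close> at the head of \<open>\<alpha>\<close>.
\<close>

lemma (in coord_rep) power_mat_support:
  assumes \<alpha>: "\<alpha> \<in> arcs Q" and "l \<in> tuples B n" "l' \<in> tuples B n" "power_mat a n \<alpha> l' l \<noteq> 0"
  shows "l \<in> diag_tuples B v n \<and> v (hd l) = tail Q \<alpha> \<and> l' \<in> diag_tuples B v n \<and> v (hd l') = head Q \<alpha>"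
  using assms(2-)
proof (induction n arbitrary: l l')
  case 0
  then show ?case using mat_supp[OF \<alpha>] by auto
next
  case (Suc n)
  then obtain y xs y' xs' where l: "l = y # xs" "y \<in> B" "xs \<in> tuples B n"
    and l': "l' = y' # xs'" "y' \<in> B" "xs' \<in> tuples B n" by (auto simp: tens_index_def)
  then have "a \<alpha> y' y \<noteq> 0" "power_mat a n \<alpha> xs' xs \<noteq> 0" using Suc.prems(3) by (auto simp: tens_mat_def)
  then show ?case using Suc.IH[OF l(3) l'(3)] mat_supp[OF \<alpha> l(2) l'(2)] l l'
    by (auto simp: tens_index_def)
qed

lemma power_vertex_diag:
  assumes "p k k = k" "l \<in> diag_tuples C w n" "w (hd l) = k"
  shows "power_vertex p w n l = k"
  using assms(2,3)
proof (induction n arbitrary: l)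
  case (Suc n)
  then have "tl l \<in> diag_tuples C w n" "w (hd (tl l)) = k" by (auto simp: tens_index_def)
  then show ?case using Suc.IH Suc.prems(2) assms(1) by simp
qed simp

section \<open>Partitioning morphisms\<close>

lemma mult_basis_algebra:
  "basis_vec b \<otimes>\<^bsub>basis_algebra B c e\<^esub> g = (\<Sum>d\<in>Poly_Mapping.keys g.
     (case c b d of None \<Rightarrow> 0 | Some r \<Rightarrow> Poly_Mapping.single r (Poly_Mapping.lookup g d)))"
  "g \<otimes>\<^bsub>basis_algebra B c e\<^esub> basis_vec b = (\<Sum>d\<in>Poly_Mapping.keys g.
     (case c d b of None \<Rightarrow> 0 | Some r \<Rightarrow> Poly_Mapping.single r (Poly_Mapping.lookup g d)))"
  by (simp_all add: basis_algebra_def free_space_def basis_vec_def cong: option.case_cong)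

text \<open>
  For an arrow \<open>\<alpha>\<close> with tail \<open>i\<close> the equation \<open>\<alpha> * e\<^sub>i = \<alpha>\<close> is mapped to
  \<open>(\<alpha> \<otimes> \<alpha>) * \<Delta> e\<^sub>i = \<alpha> \<otimes> \<alpha>\<close>.  The only summand \<open>e\<^sub>s \<otimes> e\<^sub>t\<close> of \<open>\<Delta> e\<^sub>i\<close> that contributes to the
  left side is \<open>e\<^sub>i \<otimes> e\<^sub>i\<close>, so this pair belongs to the block of \<open>i\<close>.  Multiplication from the left treats
  the head.
\<close>

lemma partitioning_morphism_grouplike:
  fixes Q :: "('v, 'a) pre_digraph" and \<Delta> :: "('k::field, 'v, 'a) comult"
  assumes wf: "wf_digraph Q" and fin: "finite (verts Q)" and pm: "partitioning_morphism Q \<Delta>"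
    and gl: "\<forall>\<mu>\<in>quiver_paths Q. length (snd \<mu>) \<ge> 1 \<longrightarrow> \<Delta> (basis_vec \<mu>) = basis_vec (\<mu>, \<mu>)"
  shows "\<exists>p. grouplike_comult Q \<Delta> p"
proof -
  obtain E where E: "disjoint_family_on E (verts Q)" "(\<Union>k\<in>verts Q. E k) = verts Q \<times> verts Q"
    "\<And>k. k \<in> verts Q \<Longrightarrow> \<Delta> (basis_vec (k, [])) = (\<Sum>(i, j)\<in>E k. basis_vec ((i, []), (j, [])))"
    using pm unfolding partitioning_morphism_def partitioning_map_def by blast
  have hom: "\<Delta> \<in> Ring.ring_hom (path_algebra Q) (path_algebra_square Q)"
    using pm by (simp add: partitioning_morphism_def)
  define p where "p s t = (THE k. k \<in> verts Q \<and> (s, t) \<in> E k)" for s t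
  have ex1: "\<exists>!k. k \<in> verts Q \<and> (s, t) \<in> E k" if "s \<in> verts Q" "t \<in> verts Q" for s t
  proof (rule ex_ex1I)
    show "\<exists>k. k \<in> verts Q \<and> (s, t) \<in> E k" using E(2) that by blast
    fix k k' assume "k \<in> verts Q \<and> (s, t) \<in> E k" "k' \<in> verts Q \<and> (s, t) \<in> E k'"
    then show "k = k'" using E(1) unfolding disjoint_family_on_def by blast
  qed
  have p: "p s t \<in> verts Q" "(s, t) \<in> E (p s t)" if "s \<in> verts Q" "t \<in> verts Q" for s t
    using theI'[OF ex1[OF that]] by (auto simp: p_def)
  have p_eq: "p s t = k" if "k \<in> verts Q" "(s, t) \<in> E k" for s t k
  proof -
    have "s \<in> verts Q" "t \<in> verts Q" using E(2) that by blast+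
    then show ?thesis unfolding p_def using ex1 that by (intro the1_equality) auto
  qed
  have Ek: "E k = {(s, t). s \<in> verts Q \<and> t \<in> verts Q \<and> p s t = k}" if "k \<in> verts Q" for k
  proof
    show "E k \<subseteq> {(s, t). s \<in> verts Q \<and> t \<in> verts Q \<and> p s t = k}"
    proof
      fix z assume z: "z \<in> E k"
      then have "z \<in> verts Q \<times> verts Q" using E(2) that by blast
      then show "z \<in> {(s, t). s \<in> verts Q \<and> t \<in> verts Q \<and> p s t = k}" using p_eq[OF that] z by auto
    qed
    show "{(s, t). s \<in> verts Q \<and> t \<in> verts Q \<and> p s t = k} \<subseteq> E k" using p(2) by auto
  qed
  have finE: "finite (E k)" if "k \<in> verts Q" for k
    by (rule finite_subset[of _ "verts Q \<times> verts Q"]) (use E(2) that fin in auto)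
  have keysE: "Poly_Mapping.keys (\<Delta> (basis_vec (k, []))) \<subseteq> (\<lambda>(s, t). ((s, []), (t, []))) ` E k"
    if k: "k \<in> verts Q" for k
  proof
    fix q assume "q \<in> Poly_Mapping.keys (\<Delta> (basis_vec (k, [])))"
    then have "(\<Sum>(s, t)\<in>E k. Poly_Mapping.lookup (basis_vec ((s, []), (t, [])) :: _ \<Rightarrow>\<^sub>0 'k) q) \<noteq> 0"
      by (simp add: in_keys_iff E(3)[OF k] lookup_sum case_prod_unfold)
    then obtain z where "z \<in> E k" "(case z of (s, t) \<Rightarrow>
        Poly_Mapping.lookup (basis_vec ((s, []), (t, [])) :: _ \<Rightarrow>\<^sub>0 'k) q) \<noteq> 0"
      by (rule sum.not_neutral_contains_not_neutral)
    then show "q \<in> (\<lambda>(s, t). ((s, []), (t, []))) ` E k"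
      by (auto simp: basis_vec_def lookup_single when_def split: if_splits prod.splits)
  qed
  have path: "(k, []) \<in> quiver_paths Q" if "k \<in> verts Q" for k
    using that by (auto simp: quiver_paths_def pre_digraph.awalk_def pre_digraph.cas.simps)
  have arrow: "(tail Q \<alpha>, [\<alpha>]) \<in> quiver_paths Q" if "\<alpha> \<in> arcs Q" for \<alpha>
    using that wf by (auto simp: quiver_paths_def pre_digraph.awalk_def pre_digraph.cas.simps wf_digraph_def)
  have carr: "basis_vec \<mu> \<in> carrier (path_algebra Q :: ('k, _) module)" if "\<mu> \<in> quiver_paths Q" for \<mu>
    using that by (simp add: path_algebra_def basis_algebra_def free_space_def basis_vec_def)
  have target: "path_target Q (k, []) = k" "path_target Q (k, [\<alpha>]) = head Q \<alpha>" for k \<alpha>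
    by (simp_all add: path_target_def pre_digraph.awalk_verts.simps)
  have \<Delta>\<alpha>: "\<Delta> (basis_vec (tail Q \<alpha>, [\<alpha>])) = basis_vec ((tail Q \<alpha>, [\<alpha>]), (tail Q \<alpha>, [\<alpha>]))"
    if "\<alpha> \<in> arcs Q" for \<alpha> using gl arrow[OF that] by auto
  have nz: "basis_vec z \<noteq> (0 :: _ \<Rightarrow>\<^sub>0 'k)" for z :: "('v, 'a) path \<times> ('v, 'a) path"
  proof
    assume "basis_vec z = (0 :: _ \<Rightarrow>\<^sub>0 'k)"
    from arg_cong[OF this, of "\<lambda>f. Poly_Mapping.lookup f z"] show False by (simp add: basis_vec_def)
  qed
  have tail: "p (tail Q \<alpha>) (tail Q \<alpha>) = tail Q \<alpha>" if \<alpha>: "\<alpha> \<in> arcs Q" for \<alpha>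
  proof -
    let ?s = "tail Q \<alpha>" and ?\<mu> = "(tail Q \<alpha>, [\<alpha>])"
    have s: "?s \<in> verts Q" using wf \<alpha> by (auto simp: wf_digraph_def)
    have "basis_vec ?\<mu> \<otimes>\<^bsub>path_algebra Q\<^esub> basis_vec (?s, []) = (basis_vec ?\<mu> :: _ \<Rightarrow>\<^sub>0 'k)"
      unfolding path_algebra_def mult_basis_algebra(1)
      by (simp add: basis_vec_def path_comp_def target)
    then have "\<Delta> (basis_vec ?\<mu>) \<otimes>\<^bsub>path_algebra_square Q\<^esub> \<Delta> (basis_vec (?s, [])) = \<Delta> (basis_vec ?\<mu>)"
      using Ring.ring_hom_mult[OF hom carr[OF arrow[OF \<alpha>]] carr[OF path[OF s]]] by simp
    then have ne: "(\<Sum>d\<in>Poly_Mapping.keys (\<Delta> (basis_vec (?s, []))). (case path_comp2 Q (?\<mu>, ?\<mu>) d of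
        None \<Rightarrow> 0 | Some r \<Rightarrow> Poly_Mapping.single r (Poly_Mapping.lookup (\<Delta> (basis_vec (?s, []))) d))) \<noteq> 0"
      unfolding \<Delta>\<alpha>[OF \<alpha>] path_algebra_square_def mult_basis_algebra(1) using nz by simp
    then obtain d where d: "d \<in> Poly_Mapping.keys (\<Delta> (basis_vec (?s, [])))" "path_comp2 Q (?\<mu>, ?\<mu>) d \<noteq> None"
      by (rule sum.not_neutral_contains_not_neutral) (auto split: option.splits)
    then obtain x y where xy: "(x, y) \<in> E ?s" "d = ((x, []), (y, []))" using keysE[OF s] by auto
    then have "x = ?s" "y = ?s"
      using d(2) by (auto simp: path_comp2_def path_comp_def target split: if_splits)
    then show ?thesis using p_eq[OF s] xy(1) by simp
  qed
  have head: "p (head Q \<alpha>) (head Q \<alpha>) = head Q \<alpha>" if \<alpha>: "\<alpha> \<in> arcs Q" for \<alpha>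
  proof -
    let ?s = "head Q \<alpha>" and ?\<mu> = "(tail Q \<alpha>, [\<alpha>])"
    have s: "?s \<in> verts Q" using wf \<alpha> by (auto simp: wf_digraph_def)
    have "basis_vec (?s, []) \<otimes>\<^bsub>path_algebra Q\<^esub> basis_vec ?\<mu> = (basis_vec ?\<mu> :: _ \<Rightarrow>\<^sub>0 'k)"
      unfolding path_algebra_def mult_basis_algebra(1)
      by (simp add: basis_vec_def path_comp_def target)
    then have "\<Delta> (basis_vec (?s, [])) \<otimes>\<^bsub>path_algebra_square Q\<^esub> \<Delta> (basis_vec ?\<mu>) = \<Delta> (basis_vec ?\<mu>)"
      using Ring.ring_hom_mult[OF hom carr[OF path[OF s]] carr[OF arrow[OF \<alpha>]]] by simp
    then have ne: "(\<Sum>d\<in>Poly_Mapping.keys (\<Delta> (basis_vec (?s, []))). (case path_comp2 Q d (?\<mu>, ?\<mu>) of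
        None \<Rightarrow> 0 | Some r \<Rightarrow> Poly_Mapping.single r (Poly_Mapping.lookup (\<Delta> (basis_vec (?s, []))) d))) \<noteq> 0"
      unfolding \<Delta>\<alpha>[OF \<alpha>] path_algebra_square_def mult_basis_algebra(2) using nz by simp
    then obtain d where d: "d \<in> Poly_Mapping.keys (\<Delta> (basis_vec (?s, [])))" "path_comp2 Q d (?\<mu>, ?\<mu>) \<noteq> None"
      by (rule sum.not_neutral_contains_not_neutral) (auto split: option.splits)
    then obtain x y where xy: "(x, y) \<in> E ?s" "d = ((x, []), (y, []))" using keysE[OF s] by auto
    then have "x = ?s" "y = ?s"
      using d(2) by (auto simp: path_comp2_def path_comp_def target split: if_splits)
    then show ?thesis using p_eq[OF s] xy(1) by simp
  qed
  have "grouplike_comult Q \<Delta> p"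
  proof
    show "\<Delta> (basis_vec (k, [])) = (\<Sum>(s, t)\<in>{(s, t). s \<in> verts Q \<and> t \<in> verts Q \<and> p s t = k}.
      basis_vec ((s, []), (t, [])))" if "k \<in> verts Q" for k
      using E(3)[OF that] Ek[OF that] by simp
  qed (use wf fin p(1) \<Delta>\<alpha> tail head in \<open>auto simp: wf_digraph_def\<close>)
  then show ?thesis by blast
qed

section \<open>The number of summands of the powers\<close>

text \<open>
  The common part \<open>N\<close> of both powers consists of the diagonal tuples at endpoints of arrows; the power for
  \<open>\<Delta>\<close> has all tuples as a basis, the pointwise power the diagonal ones.
\<close>

lemma num_summands_comult_power:
  fixes Q :: "('v, 'a) pre_digraph" and \<Delta> :: "('k::field, 'v, 'a) comult"
    and M :: "('k, 'x, 'v, 'a) rep"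
  assumes wf: "wf_digraph Q" and fin: "finite (verts Q)"
    and pm: "partitioning_morphism Q \<Delta>"
    and gl: "\<forall>\<mu>\<in>quiver_paths Q. length (snd \<mu>) \<ge> 1 \<longrightarrow> \<Delta> (basis_vec \<mu>) = basis_vec (\<mu>, \<mu>)"
    and rep: "is_rep Q M" and fd: "finite_dimensional Q M" and n: "n \<ge> 1"
  shows "int (b_comult Q \<Delta> n M) =
    int (b_pointwise Q n M) + int (rep_dim Q M) ^ n - (\<Sum>k\<in>verts Q. int (dim_at M k) ^ n)"
proof -
  obtain m where m: "n = Suc m" using n by (cases n) auto
  obtain C :: "('v \<times> 'x) set" and c \<psi> where M: "coord_rep Q M C fst c \<psi>"
    and dimC: "\<And>k. k \<in> verts Q \<Longrightarrow> card {b \<in> C. fst b = k} = dim_at M k"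
    using ex_coord_rep[OF wf fin rep fd] by blast
  interpret M: coord_rep Q M C fst c \<psi> by (rule M)
  obtain p where "grouplike_comult Q \<Delta> p"
    using partitioning_morphism_grouplike[OF wf fin pm gl] by blast
  then interpret D: grouplike_comult Q \<Delta> p .
  define N where "N = {l \<in> diag_tuples C fst m. fst (hd l) \<in> tail Q ` arcs Q \<union> head Q ` arcs Q}"
  let ?T = "rep_ops Q N (\<lambda>l. fst (hd l)) (power_mat c m)"
  interpret T: operators ?T by (rule operators_rep_ops)
  have fT: "finite (tuples C m)" and fD: "finite (diag_tuples C fst m)"
    using finite_tuples[OF M.finB] finite_subset[OF diag_tuples_subset finite_tuples[OF M.finB]] by auto
  have ND: "N \<subseteq> diag_tuples C fst m" and DT: "diag_tuples C fst m \<subseteq> tuples C m"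
    unfolding N_def using diag_tuples_subset by auto
  have fN: "finite N" using finite_subset[OF ND fD] .
  have "op_subgroup ?T (funs_on N)" unfolding op_subgroup_def
  proof (intro conjI ballI)
    fix t and f :: "('v \<times> 'x) list \<Rightarrow> 'k" assume "t \<in> ?T" "f \<in> funs_on N"
    then show "t f \<in> funs_on N"
      by (auto simp: rep_ops_def funs_on_scal funs_on_mat_op) (auto simp: funs_on_def proj_def)
  qed (auto simp: funs_on_diff)
  then obtain \<U> where \<U>: "T.indec_decomposition \<U> (funs_on N)"
    using T.indec_decomposition_exists[OF finite_length_funs_on[OF _ fN]] by (auto simp: rep_ops_def)
  have supp: "l \<in> N \<and> l' \<in> N" if "\<alpha> \<in> arcs Q" "l \<in> tuples C m" "l' \<in> tuples C m" "power_mat c m \<alpha> l' l \<noteq> 0" for \<alpha> l l'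
    using M.power_mat_support[OF that] that(1) by (auto simp: N_def)
  obtain \<phi> where "coord_rep Q (pointwise_power Q M (Suc m)) (diag_tuples C fst m) (\<lambda>l. fst (hd l)) (power_mat c m) \<phi>"
    using coord_rep_pointwise_power[OF M] by blast
  then interpret P: coord_rep Q "pointwise_power Q M (Suc m)" "diag_tuples C fst m" "\<lambda>l. fst (hd l)" "power_mat c m" \<phi> .
  have 1: "b_pointwise Q n M = card \<U> + card (diag_tuples C fst m - N)"
    unfolding b_pointwise_def m using ND \<U> DT
    by (intro P.num_summands_split[where v' = "\<lambda>l. fst (hd l)"]) (auto dest: supp)
  obtain \<phi>' where "coord_rep Q (comult_power Q \<Delta> M (Suc m)) (tuples C m) (power_vertex p fst m) (power_mat c m) \<phi>'"
    using D.coord_rep_comult_power[OF M] by blast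
  then interpret R: coord_rep Q "comult_power Q \<Delta> M (Suc m)" "tuples C m" "power_vertex p fst m" "power_mat c m" \<phi>' .
  have pv: "fst (hd l) = power_vertex p fst m l" if "l \<in> N" for l
  proof -
    have "p (fst (hd l)) (fst (hd l)) = fst (hd l)" using that D.p_tail D.p_head by (auto simp: N_def)
    then show ?thesis using that power_vertex_diag[of p "fst (hd l)" l C fst m] by (simp add: N_def)
  qed
  have 2: "b_comult Q \<Delta> n M = card \<U> + card (tuples C m - N)"
    unfolding b_comult_def m
    by (rule R.num_summands_split[OF _ pv supp \<U>]) (use ND DT in auto)
  have cT: "card (tuples C m) = rep_dim Q M ^ n"
  proof -
    have "card C = (\<Sum>k\<in>verts Q. card {b \<in> C. fst b = k})"
    proof -
      have "C = (\<Union>k\<in>verts Q. {b \<in> C. fst b = k})" using M.vB by auto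
      then have "card C = card (\<Union>k\<in>verts Q. {b \<in> C. fst b = k})" by simp
      also have "\<dots> = (\<Sum>k\<in>verts Q. card {b \<in> C. fst b = k})"
        using M.finB fin by (intro card_UN_disjoint) auto
      finally show ?thesis .
    qed
    then have "card C = rep_dim Q M" unfolding rep_dim_def using dimC by simp
    then show ?thesis using card_tuples[OF M.finB, of m] m by simp
  qed
  have cD: "card (diag_tuples C fst m) = (\<Sum>k\<in>verts Q. dim_at M k ^ n)"
    using card_diag_tuples[OF M.finB fin M.vB, of m] dimC m by simp
  have "card (tuples C m - N) = card (tuples C m) - card N"
    "card (diag_tuples C fst m - N) = card (diag_tuples C fst m) - card N"
    using ND DT fN by (auto intro: card_Diff_subset)
  moreover have "card N \<le> card (diag_tuples C fst m)" "card N \<le> card (tuples C m)"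
    using ND DT fT fD by (auto intro: card_mono)
  ultimately have "int (b_comult Q \<Delta> n M) = int (b_pointwise Q n M) + int (card (tuples C m)) - int (card (diag_tuples C fst m))"
    unfolding 1 2 by simp
  then show ?thesis unfolding cT cD by simp
qed

theorem corollary4p10:
  fixes Q :: "('v, 'a) pre_digraph"
    and \<Delta> :: "('k::alg_closed_field, 'v, 'a) comult"
    and M :: "('k, 'x, 'v, 'a) rep"
    and n :: nat
  assumes "wf_digraph Q" and "finite (verts Q)"
    and "partitioning_morphism Q \<Delta>" and "coassociative Q \<Delta>"
    and "\<forall>\<mu>\<in>quiver_paths Q. length (snd \<mu>) \<ge> 1 \<longrightarrow> \<Delta> (basis_vec \<mu>) = basis_vec (\<mu>, \<mu>)"
    and "is_rep Q M" and "finite_dimensional Q M"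
    and "n \<ge> 1"
  shows "int (b_comult Q \<Delta> n M) =
           int (b_pointwise Q n M) + int (rep_dim Q M) ^ n - (\<Sum>k\<in>verts Q. int (dim_at M k) ^ n) \<and>
         (\<forall>\<Delta>' :: ('k, 'v, 'a) comult.
            partitioning_morphism Q \<Delta>' \<and> coassociative Q \<Delta>' \<and>
            (\<forall>\<mu>\<in>quiver_paths Q. length (snd \<mu>) \<ge> 1 \<longrightarrow> \<Delta>' (basis_vec \<mu>) = basis_vec (\<mu>, \<mu>)) \<longrightarrow>
            b_comult Q \<Delta>' n M = b_comult Q \<Delta> n M)"
proof (intro conjI allI impI)
  show formula: "int (b_comult Q \<Delta> n M) =
    int (b_pointwise Q n M) + int (rep_dim Q M) ^ n - (\<Sum>k\<in>verts Q. int (dim_at M k) ^ n)"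
    by (rule num_summands_comult_power) (use assms in auto)
  fix \<Delta>' :: "('k, 'v, 'a) comult"
  assume \<Delta>': "partitioning_morphism Q \<Delta>' \<and> coassociative Q \<Delta>' \<and>
    (\<forall>\<mu>\<in>quiver_paths Q. length (snd \<mu>) \<ge> 1 \<longrightarrow> \<Delta>' (basis_vec \<mu>) = basis_vec (\<mu>, \<mu>))"
  have "int (b_comult Q \<Delta>' n M) =
    int (b_pointwise Q n M) + int (rep_dim Q M) ^ n - (\<Sum>k\<in>verts Q. int (dim_at M k) ^ n)"
    by (rule num_summands_comult_power) (use assms \<Delta>' in auto)
  then show "b_comult Q \<Delta>' n M = b_comult Q \<Delta> n M" using formula by simp
qed

end
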